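(* For all integers $k\ge 2$ and $n\ge 2$, \[GR_k(C_{2n})=\begin{cases}(n-1)k+n+1 & \text{if } n\ge 3,\\ (n-1)k+n+2 & \text{if } n=2.\end{cases}\]
   Context: A Gallai $k$-coloring of a complete graph is an edge-coloring with colors from $\{1,\dots,k\}$ with no rainbow triangle (a triangle whose three edges receive three distinct colors). $C_m$ denotes the cycle on $m$ vertices. $GR_k(H)$ is the least positive integer $N$ such that every Gallai $k$-coloring of the complete graph $K_N$ contains a monochromatic copy of $H$ (a subgraph isomorphic to $H$ all of whose edges have the same color). *)

theory Defs
  imports "HOL-Library.Ramsey" "HOL-Library.FuncSet"
begin

text \<open>A graph is a pair of its vertex set and its set of edges, an edge being a two-element
  set of vertices.\<close>

type_synonym 'a sgraph = "'a set \<times> 'a set set"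

abbreviation verts :: "'a sgraph \<Rightarrow> 'a set" where "verts \<equiv> fst"
abbreviation edges :: "'a sgraph \<Rightarrow> 'a set set" where "edges \<equiv> snd"

definition complete_graph :: "nat \<Rightarrow> nat sgraph" where
  "complete_graph N = ({..<N}, nsets {..<N} 2)"

text \<open>This is the cycle on \<open>m\<close> vertices only for \<open>m \<ge> 3\<close>.\<close>

definition cycle_graph :: "nat \<Rightarrow> nat sgraph" where
  "cycle_graph m = ({..<m}, (\<lambda>i. {i, Suc i mod m}) ` {..<m})"

definition subgraph :: "'a sgraph \<Rightarrow> 'a sgraph \<Rightarrow> bool" where
  "subgraph H G \<longleftrightarrow>
     verts H \<subseteq> verts G \<and> edges H \<subseteq> edges G \<and> (\<forall>e\<in>edges H. e \<subseteq> verts H)"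

definition graph_iso :: "'a sgraph \<Rightarrow> 'b sgraph \<Rightarrow> bool" where
  "graph_iso G H \<longleftrightarrow>
     (\<exists>f. bij_betw f (verts G) (verts H) \<and> edges H = (\<lambda>e. f ` e) ` edges G)"

definition rainbow_triangle :: "nat sgraph \<Rightarrow> (nat set \<Rightarrow> nat) \<Rightarrow> bool" where
  "rainbow_triangle G c \<longleftrightarrow>
     (\<exists>x y z. {x, y} \<in> edges G \<and> {y, z} \<in> edges G \<and> {x, z} \<in> edges G \<and>
        c {x, y} \<noteq> c {y, z} \<and> c {y, z} \<noteq> c {x, z} \<and> c {x, y} \<noteq> c {x, z})"

text \<open>The colors are taken from \<open>{1..k}\<close>; not all of them need to occur. Values of the coloring
  outside the edge set are irrelevant.\<close>

definition gallai_coloring :: "nat \<Rightarrow> nat sgraph \<Rightarrow> (nat set \<Rightarrow> nat) \<Rightarrow> bool" where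
  "gallai_coloring k G c \<longleftrightarrow> c \<in> edges G \<rightarrow> {1..k} \<and> \<not> rainbow_triangle G c"

definition has_mono_copy :: "nat sgraph \<Rightarrow> (nat set \<Rightarrow> nat) \<Rightarrow> 'a sgraph \<Rightarrow> bool" where
  "has_mono_copy G c H \<longleftrightarrow>
     (\<exists>H'. subgraph H' G \<and> graph_iso H H' \<and> (\<exists>i. \<forall>e\<in>edges H'. c e = i))"

definition gallai_ramsey :: "nat \<Rightarrow> 'a sgraph \<Rightarrow> nat" where
  "gallai_ramsey k H =
     (LEAST N. N > 0 \<and>
        (\<forall>c. gallai_coloring k (complete_graph N) c \<longrightarrow> has_mono_copy (complete_graph N) c H))"

end

theory Submission
  imports Defs
begin

text \<open>Upper bound: take a minimal module \<open>M\<close> with at least \<open>n\<close> vertices. By Gallai's theorem there are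
  two colors such that the remaining ones do not connect \<open>M\<close>. At most \<open>n - 1\<close> vertices are joined to \<open>M\<close>
  in any one color, as there is no monochromatic \<open>K\<^sub>n\<^sub>,\<^sub>n\<close>, so dropping the vertices
  joined to it in the remaining colors leaves a two-colored blow-up with classes of size at most \<open>n - 1\<close>
  on \<open>3n - 1\<close> vertices (\<open>6\<close> if \<open>n = 2\<close>). Such a blow-up contains a monochromatic \<open>C\<^sub>2\<^sub>n\<close>, by
  induction on \<open>n\<close>: removing three vertices that meet all largest classes yields a cycle of length \<open>2n - 2\<close>, say red. If
  it cannot be extended in red by two vertices, then most edges at the \<open>n + 1\<close> vertices off the cycle are blue,
  and Jackson's theorem yields a blue cycle. The base cases on \<open>6\<close> and \<open>8\<close> vertices are propositional.

  Lower bound: color a suitable clique with one or two colors, and then let each further color be that of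
  the edges from \<open>n - 1\<close> new vertices to all earlier ones; such a color has a vertex cover too small for \<open>C\<^sub>2\<^sub>n\<close>.\<close>

section \<open>Cycles as lists\<close>

text \<open>The bound is \<open>(k - 2) * (n - 1)\<close> plus the two-color Ramsey number of the
  cycle, which is 3n - 1 for n >= 3 and 6 for n = 2. The two-color theorem is needed for blow-ups
  because edges inside a class may have any color and are of no use; minimality of the module keeps
  the classes inside it below n, since they are smaller modules. The engine is one exchange. For x
  off a red cycle of length 2n - 2, let S consist of x and the successors of its red neighbours on
  the cycle. Another vertex off the cycle with two red neighbours in S could be absorbed together
  with x. So it has at most one, which makes blue nearly complete between S and the vertices off the
  cycle. The obstacle is twins: a pair that is not red is blue only if its ends lie in different
  classes. Classes split between the cycle and its outside are therefore ruled out first: their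
  vertices off the cycle have no red edges there, and a blue cycle from Jackson's theorem can be
  lengthened by them two steps at a time. Once no class is split, the vertices with many red
  neighbours on the cycle turn out to see the same alternate vertices, and this rigid picture is
  refuted.\<close>

definition is_cycle :: "('a \<Rightarrow> 'a \<Rightarrow> bool) \<Rightarrow> 'a list \<Rightarrow> bool" where
  "is_cycle R xs \<longleftrightarrow> xs \<noteq> [] \<and> distinct xs \<and> successively R xs \<and> R (last xs) (hd xs)"

text \<open>The head of the rotation of \<open>xs\<close> that starts after \<open>y\<close>; the
  trailing \<open>[y]\<close> makes \<open>y\<close> its own successor in a one-element list.
  Predecessors are written \<open>nxt (rev xs)\<close>.\<close>

definition nxt :: "'a list \<Rightarrow> 'a \<Rightarrow> 'a" where
  "nxt xs y = hd (tl (dropWhile (\<lambda>z. z \<noteq> y) xs) @ takeWhile (\<lambda>z. z \<noteq> y) xs @ [y])"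

lemma nxt_split:
  assumes "distinct (as @ y # bs)"
  shows "nxt (as @ y # bs) y = hd (bs @ as @ [y])"
proof -
  have "dropWhile (\<lambda>z. z \<noteq> y) (as @ y # bs) = y # bs"
    using assms by (subst dropWhile_append2) auto
  moreover have "takeWhile (\<lambda>z. z \<noteq> y) (as @ y # bs) = as"
    using assms by (subst takeWhile_append2) auto
  ultimately show ?thesis by (simp add: nxt_def)
qed

lemma is_cycle_rotate:
  assumes "is_cycle R (as @ bs)"
  shows "is_cycle R (bs @ as)"
proof (cases "as = [] \<or> bs = []")
  case True then show ?thesis using assms by auto
next
  case False
  then show ?thesis using assms
    unfolding is_cycle_def by (auto simp: successively_append_iff)
qed

lemma is_cycle_rev:
  assumes "is_cycle R xs" "symp R"
  shows "is_cycle R (rev xs)"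
proof -
  have "successively (\<lambda>x y. R y x) xs"
    by (rule successively_mono[of R]) (use assms in \<open>auto simp: is_cycle_def dest: sympD\<close>)
  then show ?thesis using assms
    by (auto simp: is_cycle_def successively_rev hd_rev last_rev dest: sympD)
qed

lemma is_cycle_mono:
  assumes "is_cycle R xs" "\<And>x y. R x y \<Longrightarrow> R' x y"
  shows "is_cycle R' xs"
proof -
  have "successively R' xs"
    by (rule successively_mono[of R]) (use assms in \<open>auto simp: is_cycle_def\<close>)
  then show ?thesis using assms by (auto simp: is_cycle_def)
qed

lemma nxt_rotate:
  assumes "distinct (as @ bs)" "y \<in> set (as @ bs)"
  shows "nxt (bs @ as) y = nxt (as @ bs) y"
proof (cases "y \<in> set as")
  case True
  then obtain u v where as: "as = u @ y # v" by (meson split_list)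
  have "nxt (as @ bs) y = hd ((v @ bs) @ u @ [y])"
    using nxt_split[of u y "v @ bs"] assms as by simp
  moreover have "nxt (bs @ as) y = hd (v @ (bs @ u) @ [y])"
  proof -
    have "distinct ((bs @ u) @ y # v)" using assms(1) as by auto
    from nxt_split[OF this] show ?thesis using as by simp
  qed
  ultimately show ?thesis by simp
next
  case False
  then have "y \<in> set bs" using assms(2) by auto
  then obtain u v where bs: "bs = u @ y # v" by (meson split_list)
  have "nxt (as @ bs) y = hd (v @ (as @ u) @ [y])"
    using nxt_split[of "as @ u" y v] assms bs by simp
  moreover have "nxt (bs @ as) y = hd ((v @ as) @ u @ [y])"
  proof -
    have "distinct (u @ y # (v @ as))" using assms(1) bs by auto
    from nxt_split[OF this] show ?thesis using bs by simp
  qed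
  ultimately show ?thesis by simp
qed

lemma nxt_last: "distinct (ys @ [y]) \<Longrightarrow> nxt (ys @ [y]) y = hd (ys @ [y])"
  using nxt_split[of ys y "[]"] by (simp add: hd_append)

text \<open>With \<open>y\<close> in last place an insertion after \<open>y\<close> is an append at
  the end of the list, while the successor map stays the same.\<close>

lemma cycle_rotate_to_last:
  assumes "is_cycle R C" "y \<in> set C"
  obtains D where "is_cycle R (D @ [y])" "set (D @ [y]) = set C" "length (D @ [y]) = length C"
    "hd (D @ [y]) = nxt C y" "\<And>z. z \<in> set C \<Longrightarrow> nxt (D @ [y]) z = nxt C z"
proof -
  obtain u v where C: "C = u @ y # v" using assms by (meson split_list)
  have d: "distinct C" using assms by (simp add: is_cycle_def)
  have c: "is_cycle R ((v @ u) @ [y])" using is_cycle_rotate[of R "u @ [y]" v] assms C by simp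
  show ?thesis
  proof (rule that[OF c])
    show "set ((v @ u) @ [y]) = set C" "length ((v @ u) @ [y]) = length C" using C by auto
    show n: "nxt ((v @ u) @ [y]) z = nxt C z" if "z \<in> set C" for z
      using nxt_rotate[of "u @ [y]" v z] d C that by simp
    show "hd ((v @ u) @ [y]) = nxt C y"
      using nxt_last[of "v @ u" y] c n[of y] assms by (simp add: is_cycle_def)
  qed
qed

lemma nxt_edge:
  assumes "is_cycle R C" "y \<in> set C"
  shows "R y (nxt C y)" "nxt C y \<in> set C"
proof -
  obtain D where D: "is_cycle R (D @ [y])" "set (D @ [y]) = set C" "hd (D @ [y]) = nxt C y"
    using cycle_rotate_to_last[OF assms] by metis
  show "R y (nxt C y)" using D by (simp add: is_cycle_def)
  show "nxt C y \<in> set C" using D by (metis hd_in_set snoc_eq_iff_butlast)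
qed

lemma nxt_nth:
  assumes "distinct xs" "i < length xs"
  shows "nxt xs (xs ! i) = xs ! (Suc i mod length xs)"
proof -
  have *: "xs = take i xs @ xs ! i # drop (Suc i) xs"
    using assms by (simp add: id_take_nth_drop)
  then have "nxt xs (xs ! i) = hd (drop (Suc i) xs @ take i xs @ [xs ! i])"
    using nxt_split[of "take i xs" "xs ! i" "drop (Suc i) xs"] assms by metis
  also have "\<dots> = xs ! (Suc i mod length xs)"
  proof (cases "Suc i < length xs")
    case True then show ?thesis by (simp add: hd_drop_conv_nth hd_append)
  next
    case False
    then have i: "Suc i = length xs" using assms by simp
    have "hd (take i xs @ [xs ! i]) = xs ! 0"
      using assms i by (cases xs) (auto simp: take_Cons split: nat.split)
    then show ?thesis using i by simp
  qed
  finally show ?thesis .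
qed

lemma bij_nxt:
  assumes "distinct xs"
  shows "bij_betw (nxt xs) (set xs) (set xs)"
proof (cases "xs = []")
  case False
  have "set xs \<subseteq> nxt xs ` set xs"
  proof
    fix z assume "z \<in> set xs"
    then obtain i where i: "i < length xs" "z = xs ! i" by (metis in_set_conv_nth)
    show "z \<in> nxt xs ` set xs"
    proof (cases i)
      case 0
      have "nxt xs (xs ! (length xs - 1)) = xs ! 0" using nxt_nth[OF assms, of "length xs - 1"] False by simp
      then show ?thesis using i 0 False by (metis diff_less image_eqI length_greater_0_conv nth_mem zero_less_one)
    next
      case (Suc j)
      then have "nxt xs (xs ! j) = z" using nxt_nth[OF assms, of j] i by simp
      then show ?thesis using i Suc by (metis Suc_lessD image_eqI nth_mem)
    qed
  qed
  moreover have "nxt xs ` set xs \<subseteq> set xs"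
  proof
    fix z assume "z \<in> nxt xs ` set xs"
    then obtain i where "i < length xs" "z = nxt xs (xs ! i)" by (metis image_iff in_set_conv_nth)
    then show "z \<in> set xs" using nxt_nth[OF assms, of i] False by simp
  qed
  ultimately show ?thesis
    by (simp add: bij_betw_def eq_card_imp_inj_on[OF finite_set] subset_antisym)
qed (simp add: bij_betw_def)

lemma inj_nxt: "distinct xs \<Longrightarrow> inj_on (nxt xs) (set xs)"
  using bij_nxt[of xs] by (simp add: bij_betw_def)

lemma card_nxt_image: "distinct xs \<Longrightarrow> A \<subseteq> set xs \<Longrightarrow> card (nxt xs ` A) = card A"
  by (rule card_image[OF inj_on_subset[OF inj_nxt]])

lemma nxt_rev:
  assumes "distinct xs" "y \<in> set xs"
  shows "nxt (rev xs) (nxt xs y) = y"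
proof -
  obtain u v where C: "xs = u @ y # v" using assms by (meson split_list)
  show ?thesis
  proof (cases v)
    case (Cons w ws)
    have "nxt xs y = w" using nxt_split[of u y v] assms C Cons by simp
    moreover have "nxt (rev xs) w = y"
      using nxt_split[of "rev ws" w "y # rev u"] assms C Cons by auto
    ultimately show ?thesis by simp
  next
    case Nil
    show ?thesis
    proof (cases u)
      case (Cons w ws)
      have "nxt xs y = w" using nxt_split[of u y v] assms C Cons Nil by simp
      moreover have "nxt (rev xs) w = y"
        using nxt_split[of "y # rev ws" w "[]"] assms C Cons Nil by auto
      ultimately show ?thesis by simp
    next
      case Nil
      then show ?thesis using C \<open>v = []\<close> nxt_split[of "[]" y "[]"] by simp
    qed
  qed
qed

text \<open>If \<open>x\<close> is adjacent to \<open>v\<close> and \<open>w\<close> on a cycle and \<open>u\<close> to the successors of \<open>v\<close> and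
  \<open>w\<close>, then reversing the segment between them absorbs both \<open>x\<close> and \<open>u\<close>; if \<open>u\<close> is adjacent
  to \<open>x\<close> itself, the two are inserted between \<open>v\<close> and its successor.\<close>

lemma cycle_extend2:
  assumes sym: "symp R" and C: "is_cycle R C" and x: "x \<notin> set C" and u: "u \<notin> set C" and "x \<noteq> u"
    and y: "y \<in> insert x (nxt C ` {z \<in> set C. R x z})" and y': "y' \<in> insert x (nxt C ` {z \<in> set C. R x z})"
    and "y \<noteq> y'" and uy: "R u y" "R u y'"
  shows "\<exists>D. is_cycle R D \<and> set D = set C \<union> {x, u}"
proof -
  note s = sympD[OF sym]
  have 1: ?thesis if xu: "R u x" and z: "z \<in> set C" "R x z" "R u (nxt C z)" for z
  proof -
    obtain D where D: "is_cycle R (D @ [z])" "set (D @ [z]) = set C" "hd (D @ [z]) = nxt C z"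
      using cycle_rotate_to_last[OF C z(1)] by metis
    have "is_cycle R ((D @ [z]) @ [x, u])"
      using D x u \<open>x \<noteq> u\<close> z s[OF xu] s[OF z(2)]
      by (auto simp: is_cycle_def successively_append_iff hd_append split: if_splits)
    then show ?thesis using D by (intro exI[of _ "(D @ [z]) @ [x, u]"]) auto
  qed
  have 2: ?thesis if z: "z \<in> set C" "R x z" "R u (nxt C z)" and z': "z' \<in> set C" "R x z'" "R u (nxt C z')"
    and "z \<noteq> z'" for z z'
  proof -
    obtain D where D: "is_cycle R (D @ [z])" "set (D @ [z]) = set C" "hd (D @ [z]) = nxt C z"
        "\<And>t. t \<in> set C \<Longrightarrow> nxt (D @ [z]) t = nxt C t"
      using cycle_rotate_to_last[OF C z(1)] by metis
    have "z' \<in> set (D @ [z])" using D z' by metis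
    then have "z' \<in> set D" using \<open>z \<noteq> z'\<close> by auto
    then obtain P Q where PQ: "D = P @ z' # Q" by (meson split_list)
    define P' where "P' = P @ [z']"
    define Q' where "Q' = Q @ [z]"
    have DD: "D @ [z] = P' @ Q'" using PQ P'_def Q'_def by simp
    have c: "is_cycle R (P' @ Q')" using D DD by simp
    have hQ: "hd Q' = nxt C z'"
      using nxt_split[of P z' "Q'"] D(4)[OF z'(1)] c DD PQ Q'_def
      by (auto simp: is_cycle_def hd_append split: if_splits)
    have hP: "hd P' = nxt C z" using D(3) DD P'_def by (auto simp: hd_append split: if_splits)
    have ne: "P' \<noteq> []" "Q' \<noteq> []" by (auto simp: P'_def Q'_def)
    have l: "last P' = z'" "last Q' = z" by (auto simp: P'_def Q'_def)
    have sy: "successively R (rev Q')"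
      unfolding successively_rev
    proof (rule successively_mono[of R Q'])
      show "successively R Q'" using c by (simp add: is_cycle_def successively_append_iff)
    qed (rule s)
    have sQ: "set P' \<union> set Q' = set C" using D DD by auto
    \<comment> \<open>\<open>P'\<close> runs from the successor of \<open>z\<close> to
      \<open>z'\<close> and \<open>Q'\<close> from the successor of \<open>z'\<close> to
      \<open>z\<close>. So \<open>x\<close> joins \<open>z'\<close> to \<open>z\<close>, and
      \<open>u\<close> joins the successor of \<open>z'\<close> back to that of
      \<open>z\<close>.\<close>
    have "is_cycle R (P' @ [x] @ rev Q' @ [u])"
      using c sy sQ ne l hP hQ x u \<open>x \<noteq> u\<close> z z' s[OF z(2)] s[OF z(3)] s[OF z'(2)] s[OF z'(3)] unfolding is_cycle_def
      by (auto simp: successively_append_iff hd_rev last_rev successively_Cons hd_append)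
    then show ?thesis using sQ by (intro exI[of _ "P' @ [x] @ rev Q' @ [u]"]) auto
  qed
  show ?thesis
    using y y' \<open>y \<noteq> y'\<close> uy 1 2 by blast
qed

text \<open>Here \<open>x\<close> replaces \<open>z\<close> between the two cycle neighbours of
  \<open>z\<close>. The length is kept while the set of vertices off the cycle changes, so facts
  about all cycles of that length can be applied again.\<close>

lemma cycle_swap:
  assumes C: "is_cycle R C" and sym: "symp R" and z: "z \<in> set C" and x: "x \<notin> set C"
    and "R x w" "R x (nxt C z)" "w \<in> set C" "nxt C w = z" "length C \<ge> 3"
  shows "\<exists>D. is_cycle R D \<and> set D = insert x (set C - {z})"
proof -
  obtain D where D: "is_cycle R (D @ [z])" "set (D @ [z]) = set C" "length (D @ [z]) = length C"
     "hd (D @ [z]) = nxt C z" "\<And>t. t \<in> set C \<Longrightarrow> nxt (D @ [z]) t = nxt C t"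
    using cycle_rotate_to_last[OF C z] by metis
  have "D \<noteq> []" using D(3) assms(9) by auto
  have "nxt (D @ [z]) (last D) = z"
  proof -
    have "D @ [z] = butlast D @ last D # [z]" using \<open>D \<noteq> []\<close> by simp
    moreover have "distinct (D @ [z])" using D(1) by (simp add: is_cycle_def)
    ultimately show ?thesis using nxt_split[of "butlast D" "last D" "[z]"]
      by (metis append_Cons append_Nil list.sel(1))
  qed
  then have "nxt C (last D) = nxt C w"
    using D assms(8) by (metis Un_iff \<open>D \<noteq> []\<close> last_in_set set_append)
  then have w: "last D = w"
    using inj_nxt[of C] C D assms(7) \<open>D \<noteq> []\<close>
    by (metis Un_iff inj_onD is_cycle_def last_in_set set_append)
  have "is_cycle R (D @ [x])"
    using D x \<open>D \<noteq> []\<close> assms(6) w sympD[OF sym assms(5)]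
    by (auto simp: is_cycle_def successively_append_iff hd_append)
  then show ?thesis using D by (intro exI[of _ "D @ [x]"]) (auto simp: is_cycle_def)
qed

lemma nxt_nxt_neq:
  assumes "distinct C" "length C \<ge> 3" "y \<in> set C"
  shows "nxt C (nxt C y) \<noteq> y"
proof -
  obtain i where i: "i < length C" "y = C ! i" using assms by (metis in_set_conv_nth)
  let ?j = "Suc i mod length C" and ?n = "length C"
  have n0: "0 < ?n" using i by linarith
  have j: "?j < ?n" by (rule mod_less_divisor[OF n0])
  have "nxt C (nxt C y) = C ! (Suc ?j mod ?n)"
    using nxt_nth[OF assms(1) i(1)] nxt_nth[OF assms(1) j] i by simp
  moreover have "Suc ?j mod ?n \<noteq> i"
    using assms(2) i(1) by (cases "Suc i < ?n"; cases "Suc (Suc i) < ?n") (auto simp: not_less le_Suc_eq)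
  moreover have "Suc ?j mod ?n < ?n" by (rule mod_less_divisor[OF n0])
  ultimately show ?thesis using i assms(1) by (simp add: nth_eq_iff_index_eq)
qed

lemma two_elements:
  assumes "2 \<le> card A"
  obtains a b where "a \<in> A" "b \<in> A" "a \<noteq> b"
proof -
  obtain B where "B \<subseteq> A" "card B = 2" by (rule obtain_subset_with_card_n[OF assms])
  then show ?thesis using that by (auto simp: card_2_iff)
qed

lemma card_le_1I:
  assumes "\<And>a b. a \<in> A \<Longrightarrow> b \<in> A \<Longrightarrow> a = b"
  shows "card A \<le> 1"
proof (rule ccontr)
  assume "\<not> card A \<le> 1"
  then have "2 \<le> card A" by simp
  from two_elements[OF this] assms show False by metis
qed

lemma is_cycle_card: "is_cycle R C \<Longrightarrow> card (set C) = length C"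
  by (simp add: is_cycle_def distinct_card)

definition bip :: "('a \<Rightarrow> 'a \<Rightarrow> bool) \<Rightarrow> 'a set \<Rightarrow> 'a set \<Rightarrow> 'a \<Rightarrow> 'a \<Rightarrow> bool" where
  "bip R L T x y \<longleftrightarrow> R x y \<and> (x \<in> L \<and> y \<in> T \<or> x \<in> T \<and> y \<in> L)"

lemma symp_bip: "symp R \<Longrightarrow> symp (bip R L T)"
  by (auto simp: symp_def bip_def)

lemma bip_cycle_subset: "is_cycle (bip R L T) C \<Longrightarrow> set C \<subseteq> L \<union> T"
  using nxt_edge(1)[of "bip R L T" C] by (auto simp: bip_def)

lemma bip_cycle_is_cycle: "is_cycle (bip R L T) C \<Longrightarrow> is_cycle R C"
  by (erule is_cycle_mono) (simp add: bip_def)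

lemma bip_cycle_card:
  assumes "is_cycle (bip R L T) C" "L \<subseteq> set C" "length C = 2 * card L" "L \<inter> T = {}" "finite L"
  shows "card (set C \<inter> T) = card L"
proof -
  have "set C = L \<union> (set C \<inter> T)" using bip_cycle_subset[OF assms(1)] assms(2) by auto
  then have "card (set C) = card L + card (set C \<inter> T)"
    using assms(4,5) by (metis Int_assoc Int_commute card_Un_disjoint finite_Int finite_set inf_bot_left)
  then show ?thesis using is_cycle_card[OF assms(1)] assms(3) by simp
qed

section \<open>Long cycles in bipartite graphs\<close>

text \<open>Jackson's theorem. In the induction step, a cycle through all of \<open>L\<close> but \<open>x\<close> that cannot
  absorb \<open>x\<close> leaves unused neighbourhoods of \<open>x\<close> and of the successors of its neighbours that are
  pairwise disjoint (lemma \<open>cycle_extend2\<close>), and these do not fit into \<open>T\<close>.\<close>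

lemma jackson:
  assumes sym: "symp R" and fin: "finite L" "finite T" and disj: "L \<inter> T = {}"
    and "2 \<le> card L" "card L \<le> k" "card T + 2 \<le> 2 * k"
    and "\<And>x. x \<in> L \<Longrightarrow> k \<le> card {y \<in> T. R x y}"
  shows "\<exists>C. is_cycle (bip R L T) C \<and> L \<subseteq> set C \<and> length C = 2 * card L"
  using fin(1) assms(4-6,8)
proof (induction "card L" arbitrary: L)
  case 0 then show ?case by simp
next
  case (Suc a)
  let ?N = "\<lambda>x. {y \<in> T. R x y}"
  \<comment> \<open>Inclusion-exclusion leaves at least \<open>2 * k - card T\<close> common
    neighbours, and this is at least 2.\<close>
  have common: "2 \<le> card (?N x \<inter> ?N y)" if "x \<in> L" "y \<in> L" for x y
  proof -
    have "card (?N x) + card (?N y) = card (?N x \<union> ?N y) + card (?N x \<inter> ?N y)"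
      using fin(2) by (intro card_Un_Int) auto
    moreover have "card (?N x \<union> ?N y) \<le> card T" using fin(2) by (intro card_mono) auto
    moreover have "k \<le> card (?N x)" "k \<le> card (?N y)" using Suc.prems(5) that by blast+
    ultimately show ?thesis using assms(7) by linarith
  qed
  show ?case
  proof (cases "a = 1")
    case True
    then obtain x y where L: "L = {x, y}" "x \<noteq> y"
      using Suc(2) by (metis One_nat_def card_2_iff numeral_2_eq_2)
    obtain f g where fg: "f \<in> ?N x \<inter> ?N y" "g \<in> ?N x \<inter> ?N y" "f \<noteq> g"
      using two_elements common[of x y] L by blast
    have "is_cycle (bip R L T) [x, f, y, g]"
      using fg L Suc.prems(2) sympD[OF sym] by (auto simp: is_cycle_def bip_def)
    then show ?thesis using L by (intro exI[of _ "[x, f, y, g]"]) auto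
  next
    case False
    then have a2: "2 \<le> a" using Suc by linarith
    obtain x where x: "x \<in> L" using Suc(2) by (metis card.empty ex_in_conv nat.distinct(1))
    define L0 where "L0 = L - {x}"
    have L: "L = insert x L0" "x \<notin> L0" using x by (auto simp: L0_def)
    have fL0: "finite L0" using Suc.prems(1) by (simp add: L0_def)
    have cL0: "card L0 = a" using Suc(2) x Suc.prems(1) by (simp add: L0_def)
    have "\<exists>C. is_cycle (bip R L0 T) C \<and> L0 \<subseteq> set C \<and> length C = 2 * card L0"
    proof (rule Suc(1)[of L0])
      show "a = card L0" "2 \<le> card L0" using cL0 a2 by simp_all
      show "finite L0" by (rule fL0)
      show "L0 \<inter> T = {}" using Suc.prems(2) by (auto simp: L0_def)
      show "card L0 \<le> k" using Suc.prems(4) cL0 Suc(2) by linarith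
      show "k \<le> card (?N z)" if "z \<in> L0" for z using Suc.prems(5)[of z] that by (simp add: L0_def)
    qed
    then obtain C0 where C0: "is_cycle (bip R L0 T) C0" "L0 \<subseteq> set C0" "length C0 = 2 * a"
      using cL0 by auto
    define W where "W = set C0 \<inter> T"
    have cW: "card W = a" using bip_cycle_card[OF C0(1,2)] C0(3) cL0 fL0 Suc.prems(2) L by (auto simp: W_def)
    have sC0: "set C0 = L0 \<union> W" using bip_cycle_subset[OF C0(1)] C0(2) W_def by auto
    have xC0: "x \<notin> set C0" using sC0 L Suc.prems(2) W_def by auto
    let ?R = "bip R L T"
    have symR: "symp ?R" by (rule symp_bip[OF sym])
    have C: "is_cycle ?R C0" by (rule is_cycle_mono[OF C0(1)]) (auto simp: bip_def L)
    have good: ?thesis if "is_cycle ?R D" "set D = set C0 \<union> {x, f}" "f \<in> T - W" for D f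
    proof -
      have "f \<notin> set C0" "x \<noteq> f" using that(3) sC0 Suc.prems(2) L(1) x by auto
      moreover have "set D = insert x (insert f (set C0))" using that(2) by auto
      ultimately have "card (set D) = card (set C0) + 2" using xC0 by simp
      then have "length D = 2 * card L"
        using is_cycle_card[OF that(1)] is_cycle_card[OF C] C0(3) Suc(2) by simp
      then show ?thesis using that sC0 L by (intro exI[of _ D]) auto
    qed
    define J where "J = {z \<in> set C0. ?R x z}"
    have JW: "J \<subseteq> W" using Suc.prems(2) x sC0 by (auto simp: J_def bip_def W_def)
    have Ls: "nxt C0 z \<in> L0" if "z \<in> W" for z
    proof -
      have "bip R L0 T z (nxt C0 z)" by (rule nxt_edge[OF C0(1)]) (use that sC0 in auto)
      then show ?thesis using that Suc.prems(2) L by (auto simp: bip_def W_def)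
    qed
    show ?thesis
    proof (cases "J = {}")
      case True
      have NxF: "?N x \<subseteq> T - W" using True x sC0 by (auto simp: J_def bip_def)
      obtain w where w: "w \<in> W" using cW a2 by (metis card.empty ex_in_conv not_numeral_le_zero)
      then have wC: "w \<in> set C0" using sC0 by auto
      obtain D where D: "is_cycle (bip R L0 T) (D @ [w])" "set (D @ [w]) = set C0" "length (D @ [w]) = length C0"
        using cycle_rotate_to_last[OF C0(1) wC] by metis
      have D3: "length D \<ge> 3" using D(3) C0(3) a2 by simp
      then have Dn: "D \<noteq> []" by auto
      have "bip R L0 T (last D) w" "bip R L0 T w (hd D)"
        using D(1) Dn by (auto simp: is_cycle_def successively_append_iff)
      then have u: "last D \<in> L0" "hd D \<in> L0" using w Suc.prems(2) L by (auto simp: bip_def W_def)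
      obtain f where f: "f \<in> ?N x \<inter> ?N (last D)"
        using two_elements common[of x "last D"] u x L by blast
      obtain f1 f2 where "f1 \<in> ?N x \<inter> ?N (hd D)" "f2 \<in> ?N x \<inter> ?N (hd D)" "f1 \<noteq> f2"
        using two_elements common[of x "hd D"] u x L by blast
      then obtain g where g: "g \<in> ?N x \<inter> ?N (hd D)" "g \<noteq> f" by metis
      have fg: "f \<notin> set C0" "g \<notin> set C0" using f g NxF sC0 Suc.prems(2) L by auto
      have "is_cycle ?R (D @ [f, x, g])"
      proof -
        have "is_cycle ?R (D @ [w])" by (rule is_cycle_mono[OF D(1)]) (auto simp: bip_def L)
        moreover have "?R (last D) f" "?R f x" "?R x g" "?R g (hd D)"
          using f g u L sympD[OF sym] by (auto simp: bip_def)
        moreover have "f \<notin> set D" "g \<notin> set D" "x \<notin> set D" using fg xC0 D(2) by auto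
        moreover have "f \<noteq> x" "g \<noteq> x" using f g Suc.prems(2) L by auto
        ultimately show ?thesis using g(2) Dn
          by (auto simp: is_cycle_def successively_append_iff)
      qed
      moreover have "L \<subseteq> set (D @ [f, x, g])"
      proof -
        have "w \<notin> L0" using w Suc.prems(2) L(1) by (auto simp: W_def)
        moreover have "L0 \<subseteq> insert w (set D)" using C0(2) D(2) by simp
        ultimately show ?thesis unfolding L(1) by auto
      qed
      moreover have "length (D @ [f, x, g]) = 2 * card L" using D(3) C0(3) Suc(2) by simp
      ultimately show ?thesis by blast
    next
      case False
      show ?thesis
      proof (rule ccontr)
        assume no: "\<not> ?thesis"
        define F where "F = T - W"
        define NF where "NF y = {f \<in> F. R y f}" for y
        define S where "S = insert x (nxt C0 ` J)"
        have finF: "finite F" "finite W" "finite J" using fin(2) JW by (auto simp: F_def W_def J_def)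
        have SL: "S \<subseteq> L" using Ls JW L x by (auto simp: S_def)
        have dis: "NF y \<inter> NF y' = {}" if "y \<in> S" "y' \<in> S" "y \<noteq> y'" for y y'
        proof (rule ccontr)
          assume "NF y \<inter> NF y' \<noteq> {}"
          then obtain f where f: "f \<in> F" "R y f" "R y' f" by (auto simp: NF_def)
          have "\<exists>D. is_cycle ?R D \<and> set D = set C0 \<union> {x, f}"
          proof (rule cycle_extend2[OF symR C xC0])
            show "f \<notin> set C0" using f sC0 Suc.prems(2) L by (auto simp: F_def)
            show "x \<noteq> f" using f x Suc.prems(2) by (auto simp: F_def)
            show "y \<in> insert x (nxt C0 ` {z \<in> set C0. ?R x z})" "y' \<in> insert x (nxt C0 ` {z \<in> set C0. ?R x z})"
              using that by (auto simp: S_def J_def)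
            show "?R f y" "?R f y'" using f that SL sympD[OF sym] by (auto simp: bip_def F_def)
          qed (use that in auto)
          then show False using good f no by (auto simp: F_def)
        qed
        have "(\<Sum>y\<in>S. card (NF y)) = card (\<Union>y\<in>S. NF y)"
          by (rule card_UN_disjoint[symmetric]) (use finF dis in \<open>auto simp: S_def NF_def\<close>)
        also have "\<dots> \<le> card F" using finF by (intro card_mono) (auto simp: NF_def)
        also have "card F = card T - a" using cW finF(2) card_Diff_subset[of W T] by (simp add: F_def W_def)
        finally have 1: "(\<Sum>y\<in>S. card (NF y)) \<le> card T - a" .
        have lowL: "k - a \<le> card (NF y)" if "y \<in> L" for y
        proof -
          have "k \<le> card (?N y)" by (rule Suc.prems(5)[OF that])
          also have "\<dots> \<le> card (NF y \<union> W)" using finF fin(2) by (intro card_mono) (auto simp: NF_def F_def)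
          also have "\<dots> \<le> card (NF y) + a" using card_Un_le[of "NF y" W] cW by simp
          finally show ?thesis by simp
        qed
        have lowx: "k - card J \<le> card (NF x)"
        proof -
          have "k \<le> card (?N x)" by (rule Suc.prems(5)[OF x])
          also have "\<dots> \<le> card (NF x \<union> J)" using finF fin(2) x
            by (intro card_mono) (auto simp: NF_def F_def J_def bip_def W_def)
          also have "\<dots> \<le> card (NF x) + card J" by (rule card_Un_le)
          finally show ?thesis by simp
        qed
        have xS: "x \<notin> nxt C0 ` J" using Ls JW L by auto
        have cS: "card (nxt C0 ` J) = card J"
          by (rule card_nxt_image) (use C in \<open>auto simp: is_cycle_def J_def\<close>)
        have "(\<Sum>y\<in>S. card (NF y)) = card (NF x) + (\<Sum>y\<in>nxt C0 ` J. card (NF y))"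
          using xS finF by (simp add: S_def)
        moreover have "(\<Sum>y\<in>nxt C0 ` J. card (NF y)) \<ge> card J * (k - a)"
          unfolding cS[symmetric]
          using sum_bounded_below[of "nxt C0 ` J" "k - a" "\<lambda>y. card (NF y)"] lowL SL by (auto simp: S_def)
        ultimately have 2: "k - card J + card J * (k - a) \<le> card T - a" using 1 lowx by linarith
        have Ja: "1 \<le> card J" using False finF by (simp add: Suc_leI card_gt_0_iff)
        have Jk: "card J \<le> a" using card_mono[OF finF(2) JW] cW by simp
        obtain d where d: "k = a + 1 + d" using Suc.prems(4) Suc(2) le_Suc_ex[of "a + 1" k] by auto
        obtain j where j: "card J = Suc j" using Ja by (cases "card J") auto
        have "card J * (k - a) = card J + d + j * d" unfolding d j by (simp add: algebra_simps)
        then show False using 2 d assms(7) Jk by linarith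
      qed
    qed
  qed
qed

text \<open>The case |L| = k + 1, just beyond Jackson's theorem. Without one vertex \<open>x\<close>
  of \<open>L\<close> that theorem applies and leaves over only \<open>x\<close> and one vertex
  \<open>f\<close> of \<open>T\<close>. If \<open>x\<close> and \<open>f\<close> are adjacent, let
  \<open>v\<close> be another neighbour of \<open>f\<close>: unless both can be absorbed,
  \<open>x\<close> misses both cycle neighbours of \<open>v\<close>, one too many. Otherwise
  \<open>x\<close> sees all of \<open>T\<close> but \<open>f\<close>, so all of
  \<open>L - {x}\<close> are successors of neighbours of \<open>x\<close>, and two of them are
  adjacent to \<open>f\<close>.\<close>

lemma near_complete_bipartite_hamiltonian:
  assumes sym: "symp R" and fin: "finite L" "finite T" and disj: "L \<inter> T = {}"
    and n: "card L = n" "card T = n" "4 \<le> n"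
    and miss: "\<And>x. x \<in> L \<Longrightarrow> card {y \<in> T. \<not> R x y} \<le> 1"
    and deg: "\<And>y. y \<in> T \<Longrightarrow> 2 \<le> card {x \<in> L. R x y}"
  shows "\<exists>C. is_cycle (bip R L T) C \<and> length C = 2 * n"
proof -
  obtain x where x: "x \<in> L" using n by (metis card.empty ex_in_conv not_numeral_le_zero)
  define L0 where "L0 = L - {x}"
  have L0: "card L0 = n - 1" "finite L0" "L0 \<inter> T = {}" "x \<notin> L0" "L = insert x L0"
    using x fin n disj by (auto simp: L0_def)
  have "\<exists>C. is_cycle (bip R L0 T) C \<and> L0 \<subseteq> set C \<and> length C = 2 * card L0"
  \<comment> \<open>For k = n - 1 and \<open>card T = n\<close> the bound
    \<open>card T + 2 \<le> 2 * k\<close> says n >= 4.\<close>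
  proof (rule jackson[OF sym L0(2) fin(2) L0(3), where k = "n - 1"])
    fix z assume "z \<in> L0"
    then have "card {y \<in> T. \<not> R z y} \<le> 1" using miss L0 by auto
    moreover have "card T = card {y \<in> T. R z y} + card {y \<in> T. \<not> R z y}"
      using fin(2) by (subst card_Un_disjoint[symmetric]) (auto intro: arg_cong[where f = card])
    ultimately show "n - 1 \<le> card {y \<in> T. R z y}" using n by linarith
  qed (use L0 n in auto)
  then obtain C0 where C0: "is_cycle (bip R L0 T) C0" "L0 \<subseteq> set C0" "length C0 = 2 * card L0" by blast
  define W where "W = set C0 \<inter> T"
  have cW: "card W = n - 1" using bip_cycle_card[OF C0 L0(3,2)] L0(1) by (simp add: W_def)
  have sC0: "set C0 = L0 \<union> W" using bip_cycle_subset[OF C0(1)] C0(2) W_def by auto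
  have xC0: "x \<notin> set C0" using sC0 L0 disj x W_def by auto
  have "card (T - W) = 1" using card_Diff_subset[of W T] cW n fin by (simp add: W_def)
  then obtain f where f: "T - W = {f}" by (metis card_1_singletonE)
  let ?R = "bip R L T"
  have symR: "symp ?R" by (rule symp_bip[OF sym])
  have C: "is_cycle ?R C0" by (rule is_cycle_mono[OF C0(1)]) (auto simp: bip_def L0)
  have dC: "distinct C0" using C by (simp add: is_cycle_def)
  have l3: "length C0 \<ge> 3" using C0(3) L0(1) n by simp
  have fC0: "f \<notin> set C0" using f sC0 L0 by auto
  have xf: "x \<noteq> f" using f x disj by auto
  have fT: "f \<in> T" using f by auto
  have good: ?thesis if "is_cycle ?R D" "set D = set C0 \<union> {x, f}" for D
  proof -
    have "card (set D) = card (set C0) + 2" using that xC0 fC0 xf by auto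
    then have "length D = 2 * n"
      using is_cycle_card[OF that(1)] is_cycle_card[OF C] C0(3) L0(1) n by simp
    then show ?thesis using that by blast
  qed
  have nb: "nxt C0 y \<in> W" "nxt (rev C0) y \<in> W" if "y \<in> L0" for y
  proof -
    have "bip R L0 T y (nxt C0 y)" "bip R L0 T y (nxt (rev C0) y)"
      using nxt_edge[OF C0(1)] nxt_edge[OF is_cycle_rev[OF C0(1) symp_bip[OF sym]]] that C0(2) by auto
    moreover have "nxt C0 y \<in> set C0" "nxt (rev C0) y \<in> set C0"
      using nxt_edge[OF C0(1)] nxt_edge[OF is_cycle_rev[OF C0(1) symp_bip[OF sym]]] that C0(2) by auto
    ultimately show "nxt C0 y \<in> W" "nxt (rev C0) y \<in> W" using that L0 disj by (auto simp: bip_def W_def)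
  qed
  have inv: "nxt C0 (nxt (rev C0) y) = y" "nxt (rev C0) (nxt C0 y) = y" if "y \<in> set C0" for y
    using nxt_rev[of C0 y] nxt_rev[of "rev C0" y] dC that by auto
  show ?thesis
  proof (rule ccontr)
    assume no: "\<not> ?thesis"
    have ext: False if "y \<in> insert x (nxt D ` {z \<in> set D. ?R x z})" "y' \<in> insert x (nxt D ` {z \<in> set D. ?R x z})"
        "y \<noteq> y'" "?R f y" "?R f y'" "D = C0 \<or> D = rev C0" for y y' D
    proof -
      have "\<exists>E. is_cycle ?R E \<and> set E = set D \<union> {x, f}"
        by (rule cycle_extend2[OF symR _ _ _ xf that(1-5)]) (use that(6) C xC0 fC0 is_cycle_rev[OF C symR] in auto)
      then show False using good no that(6) by auto
    qed
    obtain u u' where u: "u \<in> L" "R u f" "u' \<in> L" "R u' f" "u \<noteq> u'"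
      using two_elements[OF deg[OF fT]] by (metis (mono_tags, lifting) mem_Collect_eq)
    show False
    proof (cases "R x f")
      case True
      obtain v where v: "v \<in> L0" "R v f" using u L0 by (metis insertE)
      have vC: "v \<in> set C0" using v C0(2) by auto
      have fv: "?R f v" "?R f x" using v True sympD[OF sym] fT L0 by (auto simp: bip_def)
      have "\<not> R x (nxt C0 v)"
      proof
        assume "R x (nxt C0 v)"
        then have "?R x (nxt C0 v)" using nb[OF v(1)] x by (auto simp: bip_def W_def)
        then have "v \<in> insert x (nxt (rev C0) ` {z \<in> set (rev C0). ?R x z})"
          using inv[OF vC] nb(1)[OF v(1)] by (auto simp: W_def intro!: image_eqI[of _ _ "nxt C0 v"])
        then show False using ext[of v "rev C0" x] fv v L0 by auto
      qed
      moreover have "\<not> R x (nxt (rev C0) v)"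
      proof
        assume "R x (nxt (rev C0) v)"
        then have "?R x (nxt (rev C0) v)" using nb[OF v(1)] x by (auto simp: bip_def W_def)
        then have "v \<in> insert x (nxt C0 ` {z \<in> set C0. ?R x z})"
          using inv[OF vC] nb(2)[OF v(1)] by (auto simp: W_def intro!: image_eqI[of _ _ "nxt (rev C0) v"])
        then show False using ext[of v C0 x] fv v L0 by auto
      qed
      moreover have "nxt C0 v \<noteq> nxt (rev C0) v"
        using nxt_nxt_neq[OF dC l3, of v] inv(1)[OF vC] vC by metis
      ultimately have "2 \<le> card {y \<in> T. \<not> R x y}"
        using nb[OF v(1)] fin(2) card_mono[of "{y \<in> T. \<not> R x y}" "{nxt C0 v, nxt (rev C0) v}"]
        by (auto simp: W_def)
      then show False using miss[OF x] by simp
    next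
      case False
      have all: "R x w" if "w \<in> W" for w
      proof (rule ccontr)
        assume "\<not> R x w"
        then have "{w, f} \<subseteq> {y \<in> T. \<not> R x y}" using False that fT by (auto simp: W_def)
        then have "card {w, f} \<le> card {y \<in> T. \<not> R x y}" using fin(2) by (intro card_mono) auto
        moreover have "w \<noteq> f" using that f by auto
        ultimately have "2 \<le> card {y \<in> T. \<not> R x y}" by simp
        then show False using miss[OF x] by simp
      qed
      have in_S: "y \<in> insert x (nxt C0 ` {z \<in> set C0. ?R x z})" if "y \<in> L0" for y
      proof -
        have "?R x (nxt (rev C0) y)" using nb(2)[OF that] all x by (auto simp: bip_def W_def)
        then show ?thesis using inv(1)[of y] that C0(2) nb(2)[OF that]
          by (auto simp: W_def intro!: image_eqI[of _ _ "nxt (rev C0) y"])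
      qed
      have "u \<in> L0" "u' \<in> L0" using u False L0 by auto
      then show False using ext[OF in_S in_S, of u u'] u sympD[OF sym] fT by (auto simp: bip_def)
    qed
  qed
qed

section \<open>Alternate vertices of an even cycle\<close>

definition evens :: "'a list \<Rightarrow> 'a set" where
  "evens xs = {xs ! i |i. i < length xs \<and> even i}"

definition odds :: "'a list \<Rightarrow> 'a set" where
  "odds xs = {xs ! i |i. i < length xs \<and> odd i}"

lemma evens_odds:
  shows "evens xs \<union> odds xs = set xs"
    and "distinct xs \<Longrightarrow> evens xs \<inter> odds xs = {}"
proof -
  show "evens xs \<union> odds xs = set xs" unfolding evens_def odds_def set_conv_nth by blast
  show "evens xs \<inter> odds xs = {}" if "distinct xs"
    using that by (auto simp: evens_def odds_def nth_eq_iff_index_eq)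
qed

lemma nxt_evens:
  assumes "distinct xs" "even (length xs)"
  shows "y \<in> evens xs \<Longrightarrow> nxt xs y \<in> odds xs" "y \<in> odds xs \<Longrightarrow> nxt xs y \<in> evens xs"
proof -
  have *: "Suc i mod length xs < length xs" "even (Suc i mod length xs) = odd i" if "i < length xs" for i
  proof -
    show "Suc i mod length xs < length xs" by (rule mod_less_divisor) (use that in linarith)
    show "even (Suc i mod length xs) = odd i"
    proof (cases "Suc i = length xs")
      case True
      then have "odd i" using assms(2) by (metis even_Suc)
      then show ?thesis using True by simp
    next
      case False
      then show ?thesis using that by simp
    qed
  qed
  show "nxt xs y \<in> odds xs" if "y \<in> evens xs"
    using that * nxt_nth[OF assms(1)] unfolding evens_def odds_def by blast
  show "nxt xs y \<in> evens xs" if "y \<in> odds xs"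
    using that * nxt_nth[OF assms(1)] unfolding evens_def odds_def by blast
qed

lemma prv_evens:
  assumes "distinct xs" "even (length xs)"
  shows "y \<in> evens xs \<Longrightarrow> nxt (rev xs) y \<in> odds xs" "y \<in> odds xs \<Longrightarrow> nxt (rev xs) y \<in> evens xs"
proof -
  have 1: "nxt xs (nxt (rev xs) y) = y" "nxt (rev xs) y \<in> set xs" if "y \<in> set xs" for y
    using nxt_rev[of "rev xs" y] bij_nxt[of "rev xs"] assms(1) that by (auto simp: bij_betw_def)
  show "nxt (rev xs) y \<in> odds xs" if "y \<in> evens xs"
    using 1[of y] that nxt_evens[OF assms, of "nxt (rev xs) y"] evens_odds[of xs] assms(1)
    by (metis IntI Un_iff empty_iff)
  show "nxt (rev xs) y \<in> evens xs" if "y \<in> odds xs"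
    using 1[of y] that nxt_evens[OF assms, of "nxt (rev xs) y"] evens_odds[of xs] assms(1)
    by (metis IntI Un_iff empty_iff)
qed

lemma card_evens:
  assumes "distinct xs" "length xs = 2 * t"
  shows "card (evens xs) = t" "card (odds xs) = t"
proof -
  have ev: "even (length xs)" using assms(2) by simp
  have sub: "evens xs \<subseteq> set xs" "odds xs \<subseteq> set xs" using evens_odds(1)[of xs] by blast+
  have f: "finite (evens xs)" "finite (odds xs)" using sub finite_subset[OF _ finite_set] by auto
  have "card (evens xs) \<le> card (odds xs)"
    by (rule card_inj_on_le[OF inj_on_subset[OF inj_nxt[OF assms(1)] sub(1)] _ f(2)])
      (use nxt_evens[OF assms(1) ev] in auto)
  moreover have "card (odds xs) \<le> card (evens xs)"
    by (rule card_inj_on_le[OF inj_on_subset[OF inj_nxt[OF assms(1)] sub(2)] _ f(1)])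
      (use nxt_evens[OF assms(1) ev] in auto)
  moreover have "card (evens xs) + card (odds xs) = 2 * t"
    using card_Un_disjoint[OF f evens_odds(2)[OF assms(1)]] distinct_card[OF assms(1)] assms(2)
    by (simp add: evens_odds(1))
  ultimately show "card (evens xs) = t" "card (odds xs) = t" by linarith+
qed

text \<open>On a cycle of even length, double steps reach every position of the same parity.\<close>

lemma nxt_nxt_closed:
  assumes "distinct xs" "even (length xs)" and cl: "\<And>y. y \<in> X \<Longrightarrow> nxt xs (nxt xs y) \<in> X"
    and i: "i < length xs" "xs ! i \<in> X" and j: "j < length xs" "even i = even j"
  shows "xs ! j \<in> X"
proof -
  let ?n = "length xs"
  have n0: "0 < ?n" using i by linarith
  have *: "xs ! ((i + 2 * k) mod ?n) \<in> X" for k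
  proof (induction k)
    case 0 then show ?case using i by simp
  next
    case (Suc k)
    have m: "m mod ?n < ?n" for m using n0 by simp
    have "nxt xs (nxt xs (xs ! ((i + 2 * k) mod ?n))) = xs ! (Suc (Suc ((i + 2 * k) mod ?n) mod ?n) mod ?n)"
      using nxt_nth[OF assms(1) m] by simp
    also have "Suc (Suc ((i + 2 * k) mod ?n) mod ?n) mod ?n = (i + 2 * Suc k) mod ?n"
      by (simp add: mod_Suc_eq)
    finally show ?case using cl[OF Suc] by simp
  qed
  have "even (j + ?n - i)" using assms(2) i(1) j(2) by presburger
  then obtain k where "j + ?n - i = 2 * k" by (elim evenE)
  then have "i + 2 * k = j + ?n" using i by simp
  then have "(i + 2 * k) mod ?n = j" using j by simp
  then show ?thesis using *[of k] by simp
qed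

text \<open>The cycle neighbours of the even part of \<open>I\<close> are odd and vice versa, so the
  two parts can be counted separately. A nonempty part that is not a full parity class has more
  neighbours than members: otherwise its successors and predecessors would coincide, making it
  closed under double steps. As \<open>I\<close> is neither parity class, both parts are
  nonempty.\<close>

lemma card_cycle_neighbours:
  assumes d: "distinct xs" and len: "length xs = 2 * t" and "3 \<le> t" and I: "I \<subseteq> set xs" "t \<le> card I"
    and nI: "I \<noteq> evens xs" "I \<noteq> odds xs"
  shows "t + 2 \<le> card (nxt xs ` I \<union> nxt (rev xs) ` I)"
proof -
  let ?f = "\<lambda>X. nxt xs ` X \<union> nxt (rev xs) ` X"
  have ev: "even (length xs)" using len by simp
  have inv: "nxt xs (nxt (rev xs) y) = y" if "y \<in> set xs" for y
    using nxt_rev[of "rev xs" y] d that by simp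
  have ge: "card X \<le> card (?f X)" if "X \<subseteq> set xs" for X
  proof -
    have "card X = card (nxt xs ` X)" using card_nxt_image[OF d that] by simp
    also have "\<dots> \<le> card (?f X)" by (intro card_mono) (use that finite_subset in \<open>auto intro: finite_subset\<close>)
    finally show ?thesis .
  qed
  have gt: "card X < card (?f X)" if X: "X \<subseteq> H" "X \<noteq> {}" "X \<noteq> H" and H: "H = evens xs \<or> H = odds xs" for X H
  proof (rule ccontr)
    assume "\<not> card X < card (?f X)"
    have XC: "X \<subseteq> set xs" using X H evens_odds(1)[of xs] by auto
    then have fX: "finite X" using finite_subset by auto
    have c: "card (nxt xs ` X) = card X" "card (nxt (rev xs) ` X) = card X"
      using card_nxt_image[OF d XC] card_nxt_image[of "rev xs" X] d XC by auto
    have "nxt xs ` X = ?f X"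
      by (rule card_seteq) (use fX c \<open>\<not> card X < card (?f X)\<close> in auto)
    moreover have "nxt (rev xs) ` X = ?f X"
      by (rule card_seteq) (use fX c \<open>\<not> card X < card (?f X)\<close> in auto)
    ultimately have eq: "nxt xs ` X = nxt (rev xs) ` X" by simp
    have cl: "nxt xs (nxt xs y) \<in> X" if "y \<in> X" for y
    proof -
      have "nxt xs y \<in> nxt (rev xs) ` X" using eq that by blast
      then obtain y' where "y' \<in> X" "nxt xs y = nxt (rev xs) y'" by auto
      then show ?thesis using inv[of y'] XC by auto
    qed
    have "H \<subseteq> X"
    proof
      fix z assume z: "z \<in> H"
      obtain y where y: "y \<in> X" using X(2) by blast
      then have "y \<in> H" using X(1) by auto
      then obtain i j where "i < length xs" "y = xs ! i" "j < length xs" "z = xs ! j" "even i = even j"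
        using z H unfolding evens_def odds_def by blast
      then show "z \<in> X" using nxt_nxt_closed[OF d ev cl, where i = i and j = j] y by simp
    qed
    then show False using X by auto
  qed
  define Ie where "Ie = I \<inter> evens xs"
  define Io where "Io = I \<inter> odds xs"
  have dis: "evens xs \<inter> odds xs = {}" by (rule evens_odds(2)[OF d])
  have IU: "I = Ie \<union> Io" using I evens_odds(1)[of xs] by (auto simp: Ie_def Io_def)
  have fin: "finite Ie" "finite Io" using I(1) finite_subset by (auto simp: Ie_def Io_def)
  have cI: "card I = card Ie + card Io" unfolding IU using fin dis
    by (intro card_Un_disjoint) (auto simp: Ie_def Io_def)
  have sub: "Ie \<subseteq> set xs" "Io \<subseteq> set xs" using I by (auto simp: Ie_def Io_def)
  have "?f Ie \<subseteq> odds xs" "?f Io \<subseteq> evens xs"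
    using nxt_evens[OF d ev] prv_evens[OF d ev] by (auto simp: Ie_def Io_def)
  then have "?f Ie \<inter> ?f Io = {}" using dis by blast
  moreover have "?f I = ?f Ie \<union> ?f Io" unfolding IU by auto
  ultimately have cf: "card (?f I) = card (?f Ie) + card (?f Io)"
    using fin by (simp add: card_Un_disjoint)
  note ce = card_evens[OF d len]
  have fe: "finite (evens xs)" "finite (odds xs)" using ce assms(3) by (auto intro: card_ge_0_finite)
  have le: "card Ie \<le> t" "card Io \<le> t"
    using ce fe card_mono[of "evens xs" Ie] card_mono[of "odds xs" Io] by (auto simp: Ie_def Io_def)
  have e: "Ie \<noteq> {}"
  proof
    assume "Ie = {}"
    then have "I \<subseteq> odds xs" "card (odds xs) \<le> card I" using IU I(2) ce by (auto simp: Io_def)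
    then show False using card_seteq[OF fe(2)] nI by blast
  qed
  have o: "Io \<noteq> {}"
  proof
    assume "Io = {}"
    then have "I \<subseteq> evens xs" "card (evens xs) \<le> card I" using IU I(2) ce by (auto simp: Ie_def)
    then show False using card_seteq[OF fe(1)] nI by blast
  qed
  have p: "card Ie > 0" "card Io > 0" using e o fin by (auto simp: card_gt_0_iff)
  show ?thesis
  proof (cases "Ie = evens xs")
    case True
    then have "card Ie = t" using ce by simp
    then show ?thesis
      using gt[of Io "odds xs"] ge[OF sub(1)] ge[OF sub(2)] cf p o ce \<open>3 \<le> t\<close>
      by (cases "Io = odds xs") (auto simp: Io_def)
  next
    case False
    then have 1: "card Ie < card (?f Ie)" using gt[of Ie "evens xs"] e by (auto simp: Ie_def)
    show ?thesis
    proof (cases "Io = odds xs")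
      case True then show ?thesis using 1 ge[OF sub(2)] cf p ce by auto
    next
      case False
      then have "card Io < card (?f Io)" using gt[of Io "odds xs"] o by (auto simp: Io_def)
      then show ?thesis using 1 cf cI I(2) by linarith
    qed
  qed
qed

section \<open>Two-colored blow-ups\<close>

text \<open>The fibres of \<open>p\<close> are the classes of the blow-up: vertices of the same class are twins in
  both colors, and two vertices of different classes are joined in at least one color.\<close>

locale blowup =
  fixes V :: "'a set" and p :: "'a \<Rightarrow> 'b" and R B :: "'a \<Rightarrow> 'a \<Rightarrow> bool"
  assumes fin: "finite V"
    and symR: "symp R" and symB: "symp B"
    and R_cls: "R x y \<Longrightarrow> p x \<noteq> p y" and B_cls: "B x y \<Longrightarrow> p x \<noteq> p y"
    and dich: "x \<in> V \<Longrightarrow> y \<in> V \<Longrightarrow> p x \<noteq> p y \<Longrightarrow> R x y \<or> B x y"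
    and twinR: "x \<in> V \<Longrightarrow> x' \<in> V \<Longrightarrow> y \<in> V \<Longrightarrow> p x = p x' \<Longrightarrow> R x y \<Longrightarrow> R x' y"
    and twinB: "x \<in> V \<Longrightarrow> x' \<in> V \<Longrightarrow> y \<in> V \<Longrightarrow> p x = p x' \<Longrightarrow> B x y \<Longrightarrow> B x' y"
begin

lemma swap: "blowup V p B R"
  using fin symR symB R_cls B_cls dich twinR twinB by unfold_locales blast+

lemma symR': "R x y \<Longrightarrow> R y x" by (rule sympD[OF symR])
lemma symB': "B x y \<Longrightarrow> B y x" by (rule sympD[OF symB])

text \<open>The path \<open>k\<close>, \<open>w\<close>, \<open>x\<close>, \<open>nxt Z k\<close>
  replaces the cycle edge after \<open>k\<close>, as \<open>x\<close> and its twin \<open>k\<close>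
  are both joined to \<open>w\<close> and to \<open>nxt Z k\<close>.\<close>

lemma twin_extend:
  assumes Z: "is_cycle B Z" "set Z \<subseteq> V" and x: "x \<in> V" "x \<notin> set Z" and k: "k \<in> set Z" "p k = p x"
    and w: "w \<in> V" "w \<notin> set Z" "B x w"
  shows "\<exists>Z'. is_cycle B Z' \<and> set Z' = set Z \<union> {x, w}"
proof -
  have "B k (nxt Z k)" "nxt Z k \<in> set Z" using nxt_edge[OF Z(1) k(1)] by auto
  then have "B x (nxt Z k)" using twinB[of k x "nxt Z k"] Z k x by auto
  moreover have "B w k" using twinB[of x k w] symB' Z k x w by auto
  ultimately have "\<exists>D. is_cycle B D \<and> set D = set Z \<union> {w, x}"
    using w x k B_cls[OF w(3)] \<open>nxt Z k \<in> set Z\<close>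
    by (intro cycle_extend2[OF symB Z(1), of w x w "nxt Z k"]) auto
  then show ?thesis by (auto simp: insert_commute)
qed

text \<open>The common neighbourhood fills so much more than half of the cycle that at least two
  cycle edges have both ends in it, enough room for both twins.\<close>

lemma twin_pair_extend:
  assumes Z: "is_cycle B Z" "set Z \<subseteq> V" and x: "x \<in> V" "x \<notin> set Z" and x': "x' \<in> V" "x' \<notin> set Z"
    and "x \<noteq> x'" "p x = p x'"
    and len: "length Z < 2 * card {v \<in> V. B x v} - 1" and sub: "{v \<in> V. B x v} \<subseteq> set Z"
  shows "\<exists>Z'. is_cycle B Z' \<and> set Z' = set Z \<union> {x, x'}"
proof -
  let ?N = "{v \<in> V. B x v}"
  define G where "G = {z \<in> ?N. nxt Z z \<in> ?N}"
  have d: "distinct Z" using Z by (simp add: is_cycle_def)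
  have fN: "finite ?N" using fin by simp
  have "nxt Z ` (?N - G) \<subseteq> set Z - ?N" using nxt_edge(2)[OF Z(1)] sub by (auto simp: G_def)
  then have "card (nxt Z ` (?N - G)) \<le> card (set Z - ?N)" by (intro card_mono) auto
  moreover have "card (nxt Z ` (?N - G)) = card (?N - G)" by (rule card_nxt_image[OF d]) (use sub in auto)
  moreover have "card (set Z - ?N) = length Z - card ?N"
    using card_Diff_subset[OF fN sub] is_cycle_card[OF Z(1)] by simp
  moreover have "card (?N - G) = card ?N - card G"
    by (rule card_Diff_subset) (auto simp: G_def fin)
  moreover have "card ?N \<le> length Z" using card_mono[OF _ sub] is_cycle_card[OF Z(1)] by simp
  ultimately have "2 \<le> card G" using len by linarith
  then obtain z z' where z: "z \<in> G" "z' \<in> G" "z \<noteq> z'" by (rule two_elements)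
  have ne: "nxt Z z \<noteq> nxt Z z'" using z sub inj_nxt[OF d] by (auto simp: G_def inj_on_def)
  have "B x' (nxt Z z)" "B x' (nxt Z z')" using z twinB[of x x'] x x' assms(8) by (auto simp: G_def)
  then show ?thesis
    using z ne sub x x' assms(7)
    by (intro cycle_extend2[OF symB Z(1), of x x' "nxt Z z" "nxt Z z'"]) (auto simp: G_def)
qed

end

section \<open>A counterexample in the induction step, and absorbing classes into a blue
  cycle\<close>

locale critical_blowup = blowup +
  fixes n :: nat
  \<comment> \<open>The case n = 3 is the base of the induction; several counts below require n >=
    4.\<close>
  assumes n4: "4 \<le> n" and cardV: "card V = 3 * n - 1"
    and cls: "x \<in> V \<Longrightarrow> card {v \<in> V. p v = p x} \<le> n - 1"
    and noR: "is_cycle R C \<Longrightarrow> set C \<subseteq> V \<Longrightarrow> length C \<noteq> 2 * n"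
    and noB: "is_cycle B C \<Longrightarrow> set C \<subseteq> V \<Longrightarrow> length C \<noteq> 2 * n"
begin

lemma swap_critical: "critical_blowup V p B R n"
  using swap n4 cardV cls noR noB by (simp add: critical_blowup_def critical_blowup_axioms_def)

lemma card_decomp:
  assumes "x \<in> V"
  shows "3 * n - 1 \<le> card {v \<in> V. p v = p x} + card {v \<in> V. R x v} + card {v \<in> V. B x v}"
proof -
  have "V = {v \<in> V. p v = p x} \<union> {v \<in> V. R x v} \<union> {v \<in> V. B x v}"
    using dich[OF assms] by auto metis
  then have "card V \<le> card ({v \<in> V. p v = p x} \<union> {v \<in> V. R x v}) + card {v \<in> V. B x v}"
    by (metis card_Un_le)
  also have "\<dots> \<le> card {v \<in> V. p v = p x} + card {v \<in> V. R x v} + card {v \<in> V. B x v}"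
    using card_Un_le[of "{v \<in> V. p v = p x}" "{v \<in> V. R x v}"] by simp
  finally show ?thesis using cardV by simp
qed

text \<open>Either some blue neighbour of \<open>x\<close> is unused, or there are so many of them on the cycle that
  two of its edges have both ends among them.\<close>

lemma split_class_extend:
  assumes Z: "is_cycle B Z" "set Z \<subseteq> V" "length Z \<le> 2 * n - 2"
    and x: "x \<in> V" "x \<notin> set Z" and k: "k \<in> set Z" "p k = p x" and deg: "card {v \<in> V. R x v} \<le> n - 1"
  shows "\<exists>Z'. is_cycle B Z' \<and> set Z \<subseteq> set Z' \<and> x \<in> set Z' \<and> set Z' \<subseteq> V \<and> length Z' = length Z + 2"
proof -
  let ?N = "{v \<in> V. B x v}"
  have fin2: ?thesis if "is_cycle B Z'" "set Z' = set Z \<union> {x, w}" "w \<in> V" "w \<notin> set Z" "w \<noteq> x" for Z' w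
  proof -
    have "set Z' = insert x (insert w (set Z))" using that by auto
    then have "card (set Z') = card (set Z) + 2" using that x by simp
    then have "length Z' = length Z + 2" using is_cycle_card[OF that(1)] is_cycle_card[OF Z(1)] by simp
    then show ?thesis using that Z x by (intro exI[of _ Z']) auto
  qed
  show ?thesis
  proof (cases "?N \<subseteq> set Z")
    case False
    then obtain w where w: "w \<in> V" "w \<notin> set Z" "B x w" by auto
    then show ?thesis using twin_extend[OF Z(1,2) x k w] fin2[of _ w] B_cls[OF w(3)] by metis
  next
    case True
    let ?K = "{v \<in> V. p v = p x}"
    have b: "card ?N \<ge> n + 1"
      using card_decomp[OF x(1)] cls[OF x(1)] deg n4 by linarith
    \<comment> \<open>Otherwise the blue neighbours of \<open>x\<close> and the rest of its class
      all lie on \<open>Z\<close>, and these are at least (3n - 1) - (n - 1) - 1 = 2n - 1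
      vertices.\<close>
    have "\<exists>x'. x' \<in> V \<and> x' \<notin> set Z \<and> x' \<noteq> x \<and> p x' = p x"
    proof (rule ccontr)
      assume "\<nexists>x'. x' \<in> V \<and> x' \<notin> set Z \<and> x' \<noteq> x \<and> p x' = p x"
      then have "?N \<union> (?K - {x}) \<subseteq> set Z" using True by auto
      then have "card (?N \<union> (?K - {x})) \<le> length Z" using card_mono is_cycle_card[OF Z(1)] by (metis finite_set)
      moreover have "card (?N \<union> (?K - {x})) = card ?N + card (?K - {x})"
        by (rule card_Un_disjoint) (use fin in \<open>auto dest: B_cls\<close>)
      moreover have "card (?K - {x}) = card ?K - 1" using x fin by simp
      ultimately show False using card_decomp[OF x(1)] Z(3) deg n4 by linarith
    qed
    then obtain x' where x': "x' \<in> V" "x' \<notin> set Z" "x' \<noteq> x" "p x' = p x" by blast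
    have "length Z < 2 * card ?N - 1" using b Z(3) by linarith
    then show ?thesis
      using twin_pair_extend[OF Z(1,2) x x'(1,2) x'(3)[symmetric] x'(4)[symmetric] _ True] fin2[of _ x'] x' by metis
  qed
qed

text \<open>The vertices of the classes in \<Lambda> are absorbed one after the other, each with a
  partner. A partner outside these classes lengthens the cycle by two at the cost of one vertex,
  which preserves the first alternative of \<open>cnt\<close>. If there is no such partner, the
  second alternative holds from then on, and the partner may come from the classes. Once they are
  exhausted the second alternative puts a whole class and all its blue neighbours on the cycle, at
  least 2n vertices.\<close>

lemma absorb_classes:
  assumes lam: "\<And>v. v \<in> V \<Longrightarrow> p v \<in> \<Lambda> \<Longrightarrow> card {w \<in> V. R v w} \<le> n - 1"
    and Z: "is_cycle B Z" "set Z \<subseteq> V" "even (length Z)" "length Z \<le> 2 * n"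
    and met: "\<And>l. l \<in> \<Lambda> \<Longrightarrow> \<exists>k\<in>set Z. p k = l"
    and cnt: "2 * n \<le> length Z + 2 * card ({v \<in> V. p v \<in> \<Lambda>} - set Z) \<or>
       (\<exists>x\<in>V. p x \<in> \<Lambda> \<and> {v \<in> V. B x v} - {v \<in> V. p v \<in> \<Lambda>} \<subseteq> set Z)"
  shows False
  using Z met cnt
proof (induction "card ({v \<in> V. p v \<in> \<Lambda>} - set Z)" arbitrary: Z rule: less_induct)
  case less
  let ?K = "{v \<in> V. p v \<in> \<Lambda>}"
  have l2: "length Z \<le> 2 * n - 2" using less.prems(3,4) noB[OF less.prems(1,2)] by presburger
  have dec: "card (?K - set Z') < card (?K - set Z)" if "set Z \<subseteq> set Z'" "x \<in> set Z'" "x \<in> ?K - set Z" for Z' x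
    by (rule psubset_card_mono) (use that fin in auto)
  show False
  proof (cases "?K \<subseteq> set Z")
    case True
    then have "card (?K - set Z) = 0" by (metis Diff_eq_empty_iff card.empty)
    then obtain x where x: "x \<in> V" "p x \<in> \<Lambda>" "{v \<in> V. B x v} - ?K \<subseteq> set Z"
      using less.prems(6) l2 n4 by auto
    have "{v \<in> V. B x v} \<union> {v \<in> V. p v = p x} \<subseteq> set Z" using x True by auto
    then have "card ({v \<in> V. B x v} \<union> {v \<in> V. p v = p x}) \<le> length Z"
      using card_mono is_cycle_card[OF less.prems(1)] by (metis finite_set)
    moreover have "card ({v \<in> V. B x v} \<union> {v \<in> V. p v = p x}) = card {v \<in> V. B x v} + card {v \<in> V. p v = p x}"
      by (rule card_Un_disjoint) (use fin in \<open>auto dest: B_cls\<close>)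
    ultimately show False using card_decomp[OF x(1)] lam[OF x(1,2)] l2 n4 by linarith
  next
    case False
    then obtain x where x: "x \<in> V" "p x \<in> \<Lambda>" "x \<notin> set Z" by auto
    obtain k where k: "k \<in> set Z" "p k = p x" using less.prems(5) x by metis
    show False
    proof (cases "{v \<in> V. B x v} - ?K \<subseteq> set Z")
      case True
      obtain Z' where Z': "is_cycle B Z'" "set Z \<subseteq> set Z'" "x \<in> set Z'" "set Z' \<subseteq> V" "length Z' = length Z + 2"
        using split_class_extend[OF less.prems(1,2) l2 x(1,3) k lam[OF x(1,2)]] by blast
      show False
      proof (rule less.hyps[OF dec Z'(1,4)])
        show "\<exists>k\<in>set Z'. p k = l" if "l \<in> \<Lambda>" for l using less.prems(5)[OF that] Z' by auto
        show "even (length Z')" "length Z' \<le> 2 * n" using Z' less.prems(3) l2 n4 by auto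
        show "2 * n \<le> length Z' + 2 * card (?K - set Z') \<or> (\<exists>x\<in>V. p x \<in> \<Lambda> \<and> {v \<in> V. B x v} - ?K \<subseteq> set Z')"
          using True Z' x by blast
      qed (use Z' x in auto)
    next
      case False
      then obtain w where w: "w \<in> V" "w \<notin> set Z" "B x w" "p w \<notin> \<Lambda>" by auto
      obtain Z' where Z': "is_cycle B Z'" "set Z' = set Z \<union> {x, w}"
        using twin_extend[OF less.prems(1,2) x(1,3) k w(1-3)] by blast
      have xw: "x \<noteq> w" using w x by auto
      have "set Z' = insert x (insert w (set Z))" using Z' by auto
      then have "card (set Z') = card (set Z) + 2" using w x xw by simp
      then have len: "length Z' = length Z + 2"
        using is_cycle_card[OF Z'(1)] is_cycle_card[OF less.prems(1)] by simp
      have "?K - set Z = insert x (?K - set Z')" using x w Z' by auto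
      moreover have "x \<notin> ?K - set Z'" using Z' by auto
      ultimately have c: "card (?K - set Z) = Suc (card (?K - set Z'))" using fin by simp
      show False
      proof (rule less.hyps[OF dec Z'(1)])
        show "\<exists>k\<in>set Z'. p k = l" if "l \<in> \<Lambda>" for l using less.prems(5)[OF that] Z' by auto
        show "even (length Z')" "length Z' \<le> 2 * n" using len less.prems(3) l2 n4 by auto
        show "set Z' \<subseteq> V" using Z' less.prems(2) x w by auto
        show "2 * n \<le> length Z' + 2 * card (?K - set Z') \<or> (\<exists>x\<in>V. p x \<in> \<Lambda> \<and> {v \<in> V. B x v} - ?K \<subseteq> set Z')"
          using less.prems(6) len c Z' by auto
      qed (use Z' x in auto)
    qed
  qed
qed

text \<open>A class that misses the cycle is made to meet it by turning \<open>a\<close>,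
  \<open>b\<close>, \<open>c\<close> into \<open>a\<close>, \<open>x\<close>, \<open>b\<close>,
  \<open>y\<close>, \<open>c\<close> with two of its members. Again the first three entries lie in
  \<open>M\<close>, so this can be repeated. Two vertices are spent on a gain of two, which is why
  \<open>cnt\<close> demands a surplus for every class still missing.\<close>

lemma meet_and_absorb_classes:
  assumes lam: "\<And>v. v \<in> V \<Longrightarrow> p v \<in> \<Lambda> \<Longrightarrow> card {w \<in> V. R v w} \<le> n - 1"
    and fL: "finite \<Lambda>" and two: "\<And>l. l \<in> \<Lambda> \<Longrightarrow> 2 \<le> card {v \<in> V. p v = l}"
    and M: "M \<subseteq> V" "\<And>v. v \<in> V \<Longrightarrow> p v \<in> \<Lambda> \<Longrightarrow> v \<in> M"
      "\<And>v w. v \<in> V \<Longrightarrow> p v \<in> \<Lambda> \<Longrightarrow> w \<in> M \<Longrightarrow> p w \<noteq> p v \<Longrightarrow> B v w"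
    and Z: "is_cycle B (a # b # c # D)" "set (a # b # c # D) \<subseteq> V" "even (length (a # b # c # D))"
       "length (a # b # c # D) \<le> 2 * n" and abc: "a \<in> M" "b \<in> M" "c \<in> M"
    and cnt: "2 * n + 2 * card {l \<in> \<Lambda>. \<forall>k\<in>set (a # b # c # D). p k \<noteq> l}
       \<le> length (a # b # c # D) + 2 * card ({v \<in> V. p v \<in> \<Lambda>} - set (a # b # c # D))"
  shows False
  using Z abc cnt
proof (induction "card {l \<in> \<Lambda>. \<forall>k\<in>set (a # b # c # D). p k \<noteq> l}" arbitrary: a b c D rule: less_induct)
  case less
  let ?Z = "a # b # c # D"
  let ?K = "{v \<in> V. p v \<in> \<Lambda>}"
  show False
  proof (cases "{l \<in> \<Lambda>. \<forall>k\<in>set ?Z. p k \<noteq> l} = {}")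
    case True
    show False
    proof (rule absorb_classes[OF lam less.prems(1-4)])
      show "\<exists>k\<in>set ?Z. p k = l" if "l \<in> \<Lambda>" for l using True that by blast
      show "2 * n \<le> length ?Z + 2 * card (?K - set ?Z) \<or> (\<exists>x\<in>V. p x \<in> \<Lambda> \<and> {v \<in> V. B x v} - ?K \<subseteq> set ?Z)"
        using less.prems(8) by linarith
    qed
  next
    case False
    then obtain l where l: "l \<in> \<Lambda>" "\<And>k. k \<in> set ?Z \<Longrightarrow> p k \<noteq> l" by blast
    obtain x y where "x \<in> {v \<in> V. p v = l}" "y \<in> {v \<in> V. p v = l}" and xyn: "x \<noteq> y"
      using two_elements[OF two[OF l(1)]] by blast
    then have xy: "x \<in> V" "p x = l" "y \<in> V" "p y = l" by auto
    have out: "x \<notin> set ?Z" "y \<notin> set ?Z" using l xy by auto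
    have l2: "length ?Z \<le> 2 * n - 2" using less.prems(3,4) noB[OF less.prems(1,2)] by presburger
    have "B x a" "B x b" "B y b" "B y c"
      using M(3)[of x] M(3)[of y] xy l less.prems(5-7) by auto
    note e = this this[THEN symB']
    let ?Z' = "a # x # b # y # c # D"
    have cyc: "is_cycle B ?Z'" using less.prems(1) e out xyn by (auto simp: is_cycle_def)
    have sZ: "set ?Z' = insert x (insert y (set ?Z))" by auto
    have un: "{l \<in> \<Lambda>. \<forall>k\<in>set ?Z. p k \<noteq> l} = insert l {l \<in> \<Lambda>. \<forall>k\<in>set ?Z'. p k \<noteq> l}"
      using l xy unfolding sZ by auto
    have "l \<notin> {l \<in> \<Lambda>. \<forall>k\<in>set ?Z'. p k \<noteq> l}" using xy unfolding sZ by auto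
    then have c1: "card {l \<in> \<Lambda>. \<forall>k\<in>set ?Z. p k \<noteq> l} = Suc (card {l \<in> \<Lambda>. \<forall>k\<in>set ?Z'. p k \<noteq> l})"
      unfolding un using fL by simp
    have "?K - set ?Z = insert x (insert y (?K - set ?Z'))" using out xy l(1) unfolding sZ by auto
    moreover have "x \<notin> insert y (?K - set ?Z')" "y \<notin> ?K - set ?Z'" using xyn unfolding sZ by auto
    ultimately have c2: "card (?K - set ?Z) = Suc (Suc (card (?K - set ?Z')))" using fin by simp
    show False
    proof (rule less.hyps[of a x b "y # c # D"])
      show "card {l \<in> \<Lambda>. \<forall>k\<in>set ?Z'. p k \<noteq> l} < card {l \<in> \<Lambda>. \<forall>k\<in>set ?Z. p k \<noteq> l}" using c1 by simp
      show "is_cycle B ?Z'" by (rule cyc)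
      show "set ?Z' \<subseteq> V" using less.prems(2) xy by auto
      show "even (length ?Z')" using less.prems(3) by simp
      show "length ?Z' \<le> 2 * n" using l2 n4 by simp
      show "a \<in> M" "x \<in> M" "b \<in> M" using less.prems M(2) xy l by auto
      show "2 * n + 2 * card {l \<in> \<Lambda>. \<forall>k\<in>set ?Z'. p k \<noteq> l} \<le> length ?Z' + 2 * card (?K - set ?Z')"
        using less.prems(8) unfolding c1 c2 by simp
    qed
  qed
qed

end

section \<open>A red cycle of length 2n - 2 that cannot be extended\<close>

text \<open>\<open>Q\<close> consists of the vertices off the cycle whose class meets the cycle. The set \<open>A\<close> and the classes
  meeting \<open>Q\<close> are pairwise completely joined in blue, and \<open>M\<close> is their union.\<close>

locale red_cycle = critical_blowup +
  fixes C :: "'a list"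
  assumes C: "is_cycle R C" and CV: "set C \<subseteq> V" and lenC: "length C = 2 * n - 2"
begin

definition "U = V - set C"
definition "I u = {z \<in> set C. R u z}"
definition "Q = {x \<in> U. \<exists>v\<in>set C. p v = p x}"
definition "A = U - Q"
definition "M = A \<union> {v \<in> V. p v \<in> p ` Q}"

lemma distC: "distinct C" and distrC: "distinct (rev C)"
  using C by (auto simp: is_cycle_def)

lemma cardC: "card (set C) = 2 * n - 2"
  using is_cycle_card[OF C] lenC by simp

lemma finU: "finite U" "finite Q" "finite A" "finite (I u)"
  using fin by (auto simp: U_def Q_def A_def I_def)

lemma cardU: "card U = n + 1"
  using card_Diff_subset[OF _ CV] cardC cardV n4 by (simp add: U_def)

lemma UV: "x \<in> U \<Longrightarrow> x \<in> V" "x \<in> U \<Longrightarrow> x \<notin> set C" "x \<in> Q \<Longrightarrow> x \<in> U" "x \<in> A \<Longrightarrow> x \<in> U"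
  by (auto simp: U_def A_def Q_def)

lemma cardAQ: "card A + card Q = n + 1"
  using card_Diff_subset[of Q U] card_mono[of U Q] finU cardU by (auto simp: A_def Q_def)

lemma no_extension:
  assumes "is_cycle R D" "set D = set C \<union> {x, u}" "x \<in> U" "u \<in> U" "x \<noteq> u"
  shows False
proof -
  have "set D = insert x (insert u (set C))" using assms by auto
  then have "card (set D) = card (set C) + 2" using assms UV by simp
  then have "length D = 2 * n" using is_cycle_card[OF assms(1)] cardC n4 by simp
  then show False using noR[OF assms(1)] assms UV CV by auto
qed

lemma cross:
  assumes "x \<in> U" "u \<in> U" "x \<noteq> u" "y \<in> insert x (nxt C ` I x)" "y' \<in> insert x (nxt C ` I x)" "R u y" "R u y'"
  shows "y = y'"
  using cycle_extend2[OF symR C UV(2)[OF assms(1)] UV(2)[OF assms(2)] assms(3), of y y']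
    no_extension assms by (auto simp: I_def)

lemma cross_rev:
  assumes "x \<in> U" "u \<in> U" "x \<noteq> u" "y \<in> insert x (nxt (rev C) ` I x)" "y' \<in> insert x (nxt (rev C) ` I x)" "R u y" "R u y'"
  shows "y = y'"
  using cycle_extend2[OF symR is_cycle_rev[OF C symR] _ _ assms(3), of y y'] UV(2)[OF assms(1)] UV(2)[OF assms(2)]
    no_extension assms by (auto simp: I_def)

text \<open>The source of blue density: apart from twins, \<open>u\<close> is blue to all but one
  vertex of the set, and the same holds with predecessors.\<close>

lemma red_le_1:
  assumes "x \<in> U" "u \<in> U" "x \<noteq> u"
  shows "card {y \<in> insert x (nxt C ` I x). R u y} \<le> 1"
    and "card {y \<in> insert x (nxt (rev C) ` I x). R u y} \<le> 1"
  by (rule card_le_1I; use cross[OF assms] cross_rev[OF assms] in blast)+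

lemma card_nxt_I: "card (nxt C ` I x) = card (I x)" "card (nxt (rev C) ` I x) = card (I x)"
  "nxt C ` I x \<subseteq> set C" "nxt (rev C) ` I x \<subseteq> set C"
proof -
  show "card (nxt C ` I x) = card (I x)" by (rule card_nxt_image[OF distC]) (auto simp: I_def)
  show "card (nxt (rev C) ` I x) = card (I x)" by (rule card_nxt_image[OF distrC]) (auto simp: I_def)
  show "nxt C ` I x \<subseteq> set C" "nxt (rev C) ` I x \<subseteq> set C"
    using nxt_edge(2)[OF C] nxt_edge(2)[OF is_cycle_rev[OF C symR]] by (auto simp: I_def)
qed

lemma prv:
  assumes "v \<in> set C"
  shows "nxt (rev C) v \<in> set C" "R v (nxt (rev C) v)" "nxt C (nxt (rev C) v) = v"
    "nxt (rev C) (nxt C v) = v"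
  using nxt_edge[OF is_cycle_rev[OF C symR], of v] nxt_rev[of "rev C" v] nxt_rev[of C v] distC assms by auto

text \<open>A red edge from \<open>x\<close> to \<open>u\<close> would give a red path from the
  predecessor of \<open>v\<close> through \<open>x\<close> and \<open>u\<close> to \<open>v\<close>,
  since \<open>x\<close> has the red neighbours of its twin \<open>v\<close>; the cycle would grow
  by two.\<close>

lemma split_not_red:
  assumes x: "x \<in> U" and v: "v \<in> set C" "p v = p x" and u: "u \<in> U"
  shows "\<not> R x u"
proof
  assume xu: "R x u"
  have vV: "v \<in> V" using v CV by auto
  have "R x (nxt (rev C) v)" using twinR[of v x "nxt (rev C) v"] prv[OF v(1)] vV UV(1)[OF x] CV v by auto
  then have "v \<in> nxt C ` I x" using prv[OF v(1)] by (auto simp: I_def intro!: image_eqI[of _ _ "nxt (rev C) v"])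
  moreover have "R u v" using symR' twinR[of x v u] xu vV UV(1) x u v by auto
  moreover have "R u x" "x \<noteq> u" using symR' xu R_cls by auto
  ultimately have "v = x" using cross[OF x u, of v x] by auto
  then show False using UV(2)[OF x] v by auto
qed

lemma M_blue:
  assumes v: "v \<in> V" "p v \<in> p ` Q" and w: "w \<in> M" "p w \<noteq> p v"
  shows "B v w"
proof -
  have *: "B v u" if u: "u \<in> U" "p u \<noteq> p v" for u
  proof -
    obtain x where x: "x \<in> Q" "p x = p v" using v by auto
    then obtain z where "z \<in> set C" "p z = p x" by (auto simp: Q_def)
    then have "\<not> R x u" using split_not_red UV(3)[OF x(1)] u(1) by blast
    then have "B x u" using dich[of x u] UV x u by metis
    then show ?thesis using twinB[of x v u] x v u UV by auto
  qed
  show ?thesis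
  proof (cases "w \<in> A")
    case True then show ?thesis using *[of w] w UV by auto
  next
    case False
    then obtain y where y: "y \<in> Q" "p y = p w" "w \<in> V" using w by (auto simp: M_def)
    then have "B v y" using *[of y] UV w by auto
    then show ?thesis using twinB[of y w v] y v UV symB' by blast
  qed
qed

lemma A_twin: "a \<in> A \<Longrightarrow> v \<in> set C \<Longrightarrow> p a \<noteq> p v" "a \<in> A \<Longrightarrow> x \<in> Q \<Longrightarrow> p a \<noteq> p x"
  unfolding A_def Q_def by auto

lemma A_blue:
  assumes "a \<in> A" "z \<in> set C" "\<not> R a z"
  shows "B a z"
  using dich[of a z] A_twin(1)[OF assms(1,2)] assms UV CV by blast

lemma Q_blue: "x \<in> Q \<Longrightarrow> a \<in> A \<Longrightarrow> B x a"
  by (rule M_blue) (use UV A_twin in \<open>auto simp: M_def\<close>)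

lemma finish_list:
  assumes \<Lambda>: "\<Lambda> \<subseteq> p ` Q" and lam: "\<And>x. x \<in> Q \<Longrightarrow> p x \<in> \<Lambda> \<Longrightarrow> card {w \<in> V. R x w} \<le> n - 1"
    and Z: "is_cycle B (a # b # c # D)" "set (a # b # c # D) \<subseteq> V" "even (length (a # b # c # D))"
       "length (a # b # c # D) \<le> 2 * n" and abc: "a \<in> M" "b \<in> M" "c \<in> M"
    and cnt: "2 * n \<le> length (a # b # c # D) + 2 * card {x \<in> Q - set (a # b # c # D). p x \<in> \<Lambda>}"
  shows False
proof (rule meet_and_absorb_classes[OF _ _ _ _ _ _ Z abc])
  show "finite \<Lambda>" by (rule finite_subset[OF \<Lambda>]) (simp add: finU)
  have tw: "\<exists>x v. x \<in> Q \<and> v \<in> set C \<and> p x = l \<and> p v = l" if "l \<in> \<Lambda>" for l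
    using \<Lambda> that unfolding Q_def by fastforce
  show "card {w \<in> V. R v w} \<le> n - 1" if v: "v \<in> V" "p v \<in> \<Lambda>" for v
  proof -
    obtain x where x: "x \<in> Q" "p x = p v" using tw[OF v(2)] by auto
    have "{w \<in> V. R v w} \<subseteq> {w \<in> V. R x w}" using twinR[of v x] v x UV by auto
    then have "card {w \<in> V. R v w} \<le> card {w \<in> V. R x w}" using fin by (intro card_mono) auto
    then show ?thesis using lam[OF x(1)] x v by simp
  qed
  show "2 \<le> card {v \<in> V. p v = l}" if "l \<in> \<Lambda>" for l
  proof -
    obtain x v where xv: "x \<in> Q" "v \<in> set C" "p x = l" "p v = l" using tw[OF \<open>l \<in> \<Lambda>\<close>] by blast
    have "{x, v} \<subseteq> {v \<in> V. p v = l}" using xv UV CV by auto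
    then have "card {x, v} \<le> card {v \<in> V. p v = l}" using fin by (intro card_mono) auto
    moreover have "x \<noteq> v" using xv UV by auto
    ultimately show ?thesis by simp
  qed
  show "M \<subseteq> V" using UV by (auto simp: M_def)
  show "v \<in> M" if "v \<in> V" "p v \<in> \<Lambda>" for v using that \<Lambda> by (auto simp: M_def)
  show "B v w" if "v \<in> V" "p v \<in> \<Lambda>" "w \<in> M" "p w \<noteq> p v" for v w using M_blue[of v w] that \<Lambda> by auto
  let ?Z = "set (a # b # c # D)"
  let ?un = "{l \<in> \<Lambda>. \<forall>k\<in>?Z. p k \<noteq> l}"
  \<comment> \<open>Each class still missing has a vertex \<open>f l\<close> on \<open>C\<close>. It
    is not counted in \<open>Q\<close> and pays the surplus that the absorption demands.\<close>
  obtain f where f: "\<And>l. l \<in> \<Lambda> \<Longrightarrow> f l \<in> set C \<and> p (f l) = l" using tw by metis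
  have inj: "inj_on f ?un" by (rule inj_onI) (use f in \<open>metis (mono_tags, lifting) mem_Collect_eq\<close>)
  have "card ({x \<in> Q - ?Z. p x \<in> \<Lambda>} \<union> f ` ?un) = card {x \<in> Q - ?Z. p x \<in> \<Lambda>} + card (f ` ?un)"
  proof (rule card_Un_disjoint)
    show "finite {x \<in> Q - ?Z. p x \<in> \<Lambda>}" using finU by simp
    show "finite (f ` ?un)" using finite_subset[OF \<Lambda>] finU by simp
    have "f ` ?un \<subseteq> set C" "Q \<inter> set C = {}" using f UV by blast+
    then show "{x \<in> Q - ?Z. p x \<in> \<Lambda>} \<inter> f ` ?un = {}" by blast
  qed
  moreover have "card ({x \<in> Q - ?Z. p x \<in> \<Lambda>} \<union> f ` ?un) \<le> card ({v \<in> V. p v \<in> \<Lambda>} - ?Z)"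
    by (rule card_mono) (use fin f UV CV in auto)
  moreover have "card (f ` ?un) = card ?un" by (rule card_image[OF inj])
  ultimately show "2 * n + 2 * card ?un \<le> length (a # b # c # D) + 2 * card ({v \<in> V. p v \<in> \<Lambda>} - ?Z)"
    using cnt by linarith
qed

text \<open>\<open>Z\<close> alternates between \<open>L\<close> and \<open>T\<close>, but
  absorption has to start from three consecutive vertices of \<open>M\<close>. As \<open>L\<close>
  lies in \<open>M\<close>, it is enough to have one vertex of a split class between two vertices of
  \<open>L\<close>.\<close>

lemma finish:
  assumes \<Lambda>: "\<Lambda> \<subseteq> p ` Q" and lam: "\<And>x. x \<in> Q \<Longrightarrow> p x \<in> \<Lambda> \<Longrightarrow> card {w \<in> V. R x w} \<le> n - 1"
    and "Q \<noteq> {}" and L: "L \<subseteq> A" "2 \<le> card L" "card L \<le> n" and T: "T \<subseteq> V" "L \<inter> T = {}"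
    and Z: "is_cycle (bip B L T) Z" "L \<subseteq> set Z" "length Z = 2 * card L"
    and cnt: "n \<le> card L + card {x \<in> Q - set Z. p x \<in> \<Lambda>}"
  shows False
proof -
  let ?K = "{v \<in> V. p v \<in> p ` Q}"
  have fL: "finite L" using L finU finite_subset by blast
  have sZ: "set Z \<subseteq> L \<union> T" by (rule bip_cycle_subset[OF Z(1)])
  have cT: "card (set Z \<inter> T) = card L" by (rule bip_cycle_card[OF Z T(2) fL])
  have AK: "a \<notin> ?K" if "a \<in> A" for a using A_twin(2)[OF that] by auto
  \<comment> \<open>If \<open>Z\<close> avoids the split classes, any \<open>w\<close> on the
    \<open>T\<close> side may be exchanged for a vertex \<open>w'\<close> of a split class, which is
    blue to all of \<open>A\<close>. Taking \<open>w'\<close> on \<open>C\<close> uses up no vertex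
    of \<open>Q\<close>.\<close>
  have "\<exists>w w'. w \<in> set Z \<inter> T \<and> w' \<in> ?K \<and> (w' = w \<or> w' \<notin> set Z \<and> w' \<in> set C)"
  proof (cases "set Z \<inter> ?K = {}")
    case False
    then show ?thesis using sZ L AK by blast
  next
    case True
    obtain w where "w \<in> set Z \<inter> T" using cT L(2) by (metis card.empty ex_in_conv not_numeral_le_zero)
    moreover obtain x v where "x \<in> Q" "v \<in> set C" "p v = p x" using \<open>Q \<noteq> {}\<close> by (auto simp: Q_def)
    then have "v \<in> ?K" "v \<in> set C" using CV by auto
    ultimately show ?thesis using True by blast
  qed
  then obtain w w' where w: "w \<in> set Z" "w \<in> T" "w' \<in> ?K" "w' = w \<or> w' \<notin> set Z \<and> w' \<in> set C" by auto
  obtain D where D: "is_cycle (bip B L T) (D @ [w])" "set (D @ [w]) = set Z" "length (D @ [w]) = length Z"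
    using cycle_rotate_to_last[OF Z(1) w(1)] by metis
  have l3: "length D \<ge> 3" using D(3) Z(3) L(2) by simp
  then obtain u D' where D': "D = u # D'" by (cases D) auto
  then have "D' \<noteq> []" using l3 by auto
  then obtain mid u' where mid: "D' = mid @ [u']" by (metis rev_exhaust)
  have Dd: "D = (u # mid) @ [u']" using D' mid by simp
  have "bip B L T u' w" "bip B L T w u"
  proof -
    have "D @ [w] = (u # mid) @ [u', w]" using Dd by simp
    then show "bip B L T u' w" "bip B L T w u"
      using D(1) unfolding is_cycle_def by (simp_all only: successively_append_iff) auto
  qed
  then have u: "u \<in> L" "u' \<in> L" using w T(2) by (auto simp: bip_def)
  have uA: "u \<in> A" "u' \<in> A" using u L by auto
  have c: "is_cycle B ([u', w] @ (u # mid))"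
    using is_cycle_rotate[of "bip B L T" "u # mid" "[u', w]"] D(1) Dd by (auto intro: bip_cycle_is_cycle)
  have Bw: "B u' w'" "B w' u"
    using M_blue[of w' u] M_blue[of w' u'] w(3) A_twin(2) uA symB' by (force simp: M_def)+
  have s: "set ([u', w'] @ (u # mid)) \<subseteq> insert w' (set Z)" "set Z = set ([u', w] @ (u # mid))"
    using D(2) Dd by auto
  have c': "is_cycle B (u' # w' # u # mid)"
    using c Bw w(4) s(2) by (auto simp: is_cycle_def)
  have len: "length (u' # w' # u # mid) = 2 * card L" using D(3) Dd Z(3) by simp
  have "{x \<in> Q - set Z. p x \<in> \<Lambda>} \<subseteq> {x \<in> Q - set (u' # w' # u # mid). p x \<in> \<Lambda>}"
    using s w UV by auto
  then have "card {x \<in> Q - set Z. p x \<in> \<Lambda>} \<le> card {x \<in> Q - set (u' # w' # u # mid). p x \<in> \<Lambda>}"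
    using finU by (intro card_mono) auto
  moreover have "set (u' # w' # u # mid) \<subseteq> V"
  proof -
    have "A \<subseteq> V" by (auto simp: A_def U_def)
    then have "insert w' (set Z) \<subseteq> V" using sZ L(1) T(1) w(3) by blast
    moreover have "set (u' # w' # u # mid) \<subseteq> insert w' (set Z)" using s(1) by simp
    ultimately show ?thesis by blast
  qed
  ultimately show False
  proof (intro finish_list[OF \<Lambda> lam c'])
    show "even (length (u' # w' # u # mid))" unfolding len by simp
    show "length (u' # w' # u # mid) \<le> 2 * n" unfolding len using L(3) by simp
    show "u' \<in> M" "w' \<in> M" "u \<in> M" using uA w(3) by (auto simp: M_def)
    assume "card {x \<in> Q - set Z. p x \<in> \<Lambda>} \<le> card {x \<in> Q - set (u' # w' # u # mid). p x \<in> \<Lambda>}"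
    then show "2 * n \<le> length (u' # w' # u # mid) + 2 * card {x \<in> Q - set (u' # w' # u # mid). p x \<in> \<Lambda>}"
      unfolding len using cnt by linarith
  qed
qed

text \<open>The contradiction reached for each choice of \<open>L\<close> and \<open>T\<close>
  below: Jackson's theorem yields a blue cycle of length 2|L|, and each vertex of \<open>Q\<close>
  outside \<open>T\<close> with its class in \<Lambda> is worth two more.\<close>

lemma jackson_finish:
  assumes \<Lambda>: "\<Lambda> \<subseteq> p ` Q" and lam: "\<And>x. x \<in> Q \<Longrightarrow> p x \<in> \<Lambda> \<Longrightarrow> card {w \<in> V. R x w} \<le> n - 1"
    and "Q \<noteq> {}" and L: "L \<subseteq> A" "2 \<le> card L" "card L \<le> n" and T: "T \<subseteq> V" "L \<inter> T = {}"
    and k: "card L \<le> k" "card T + 2 \<le> 2 * k" and deg: "\<And>x. x \<in> L \<Longrightarrow> k \<le> card {y \<in> T. B x y}"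
    and cnt: "n \<le> card L + card {x \<in> Q - T. p x \<in> \<Lambda>}"
  shows False
proof -
  have fL: "finite L" "finite T" using finite_subset[OF L(1)] finite_subset[OF T(1)] finU fin by auto
  obtain Z where Z: "is_cycle (bip B L T) Z" "L \<subseteq> set Z" "length Z = 2 * card L"
    using jackson[OF symB fL T(2) L(2) k deg] by blast
  have "L \<inter> Q = {}" using L(1) by (auto simp: A_def)
  then have "{x \<in> Q - T. p x \<in> \<Lambda>} \<subseteq> {x \<in> Q - set Z. p x \<in> \<Lambda>}" using bip_cycle_subset[OF Z(1)] by auto
  then have "card {x \<in> Q - T. p x \<in> \<Lambda>} \<le> card {x \<in> Q - set Z. p x \<in> \<Lambda>}" using finU by (intro card_mono) auto
  then show False using finish[OF \<Lambda> lam assms(3) L T Z] cnt by linarith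
qed

lemma card_filter_ge:
  assumes "finite T" "card {y \<in> T. \<not> P y} \<le> m"
  shows "card T - m \<le> card {y \<in> T. P y}"
proof -
  have "card T \<le> card {y \<in> T. P y} + card {y \<in> T. \<not> P y}"
  proof -
    have "T = {y \<in> T. P y} \<union> {y \<in> T. \<not> P y}" by auto
    then show ?thesis using card_Un_le by metis
  qed
  then show ?thesis using assms(2) by linarith
qed

end

section \<open>No class is split by the cycle\<close>

context red_cycle
begin

text \<open>For small \<open>A\<close>, where Jackson's theorem has nothing to work on:
  \<open>x\<close>, \<open>y\<close> and their twins on \<open>C\<close> form a blue 4-cycle, and n
  - 2 further vertices of \<open>Q\<close> bring it to length 2n.\<close>

lemma no_two_classes:
  assumes \<Lambda>: "\<Lambda> \<subseteq> p ` Q" and lam: "\<And>x. x \<in> Q \<Longrightarrow> p x \<in> \<Lambda> \<Longrightarrow> card {w \<in> V. R x w} \<le> n - 1"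
    and xy: "x \<in> Q" "y \<in> Q" "p x \<noteq> p y" and cnt: "n \<le> card {z \<in> Q - {x, y}. p z \<in> \<Lambda>} + 2"
  shows False
proof -
  obtain v w where v: "v \<in> set C" "p v = p x" and w: "w \<in> set C" "p w = p y"
    using xy by (auto simp: Q_def)
  have V: "v \<in> V" "w \<in> V" "x \<in> V" "y \<in> V" using v w xy UV CV by auto
  have ne: "x \<noteq> v" "x \<noteq> w" "y \<noteq> v" "y \<noteq> w" using xy v w UV by metis+
  have b: "B x y" "B y v" "B v w" "B w x"
    using M_blue[of x y] M_blue[of y v] M_blue[of v w] M_blue[of w x] xy v w V by (auto simp: M_def)
  have c: "is_cycle B [x, y, v, w]" using b ne xy v w by (auto simp: is_cycle_def)
  have "{z \<in> Q - set [x, y, v, w]. p z \<in> \<Lambda>} = {z \<in> Q - {x, y}. p z \<in> \<Lambda>}" using v w UV by auto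
  then show False
    using finish_list[OF \<Lambda> lam c] xy v w V n4 cnt by (auto simp: M_def)
qed

text \<open>Absorption needs red degree at most n - 1. A vertex \<open>x\<close> of \<open>Q\<close>
  beyond that is alone: all other vertices of \<open>Q\<close> lie in other classes and can be
  absorbed, while \<open>x\<close> is spent on the first blue cycle.\<close>

lemma no_split_large:
  assumes x: "x \<in> Q" and deg: "n \<le> card {w \<in> V. R x w}"
  shows False
proof -
  interpret sw: blowup V p B R by (rule swap)
  have tw: "\<exists>v\<in>set C. p v = p z" if "z \<in> Q" for z using that by (auto simp: Q_def)
  have Ieq: "{w \<in> V. R z w} = I z" if "z \<in> Q" for z
  proof -
    have "w \<in> set C" if "w \<in> V" "R z w" for w
    proof (rule ccontr)
      assume "w \<notin> set C"
      then show False using tw[OF \<open>z \<in> Q\<close>] split_not_red[of z _ w] UV(3)[OF \<open>z \<in> Q\<close>] that by (auto simp: U_def)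
    qed
    then show ?thesis using CV by (auto simp: I_def)
  qed
  have cI: "n \<le> card (I x)" using deg Ieq[OF x] by simp
  \<comment> \<open>A twin of \<open>x\<close> in \<open>Q\<close> would fit into the red cycle
    together with \<open>x\<close>. If \<open>I y\<close> also had n elements, it would share two of
    them with the n successors of \<open>I x\<close>, among only 2n - 2 vertices.\<close>
  have uniq: "p y \<noteq> p x" "card {w \<in> V. R y w} \<le> n - 1" if y: "y \<in> Q" "y \<noteq> x" for y
  proof -
    show "p y \<noteq> p x"
    proof
      assume "p y = p x"
      then have "\<exists>Z'. is_cycle R Z' \<and> set Z' = set C \<union> {x, y}"
        using sw.twin_pair_extend[OF C CV, of x y] x y UV Ieq[OF x] lenC deg n4 by (auto simp: I_def)
      then show False using no_extension[of _ x y] x y UV by auto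
    qed
    show "card {w \<in> V. R y w} \<le> n - 1"
    proof (rule ccontr)
      assume "\<not> card {w \<in> V. R y w} \<le> n - 1"
      then have "n \<le> card (I y)" using Ieq[OF y(1)] by simp
      moreover have "card (I y \<union> nxt C ` I x) \<le> 2 * n - 2"
        using card_nxt_I(3)[of x] card_mono[of "set C" "I y \<union> nxt C ` I x"] cardC by (auto simp: I_def)
      moreover have "card (I y) + card (nxt C ` I x) = card (I y \<union> nxt C ` I x) + card (I y \<inter> nxt C ` I x)"
        using finU by (intro card_Un_Int) auto
      ultimately have "2 \<le> card (I y \<inter> nxt C ` I x)" using cI card_nxt_I(1)[of x] n4 by linarith
      also have "\<dots> \<le> card {z \<in> insert x (nxt C ` I x). R y z}"
        using finU by (intro card_mono) (auto simp: I_def)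
      finally show False using red_le_1(1)[of x y] x y UV by auto
    qed
  qed
  let ?L = "p ` Q - {p x}"
  have lam: "card {w \<in> V. R z w} \<le> n - 1" if "z \<in> Q" "p z \<in> ?L" for z
    using uniq(2)[of z] that by auto
  have inL: "{z \<in> Q - X. p z \<in> ?L} = Q - insert x X" for X using uniq(1) by auto
  show False
  proof (cases "card A \<le> 1")
    case True
    then have q: "n \<le> card Q" using cardAQ by linarith
    have "card (Q - {x}) \<ge> 1" using q n4 x finU by simp
    then obtain y where y: "y \<in> Q" "y \<noteq> x"
      by (metis DiffE card.empty ex_in_conv not_one_le_zero singletonI)
    have "card {z \<in> Q - {x, y}. p z \<in> ?L} = card Q - 2"
      unfolding inL using x y finU by (simp add: card_Diff_subset insert_commute)
    then have "n \<le> card {z \<in> Q - {x, y}. p z \<in> ?L} + 2" using q by linarith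
    then show False
      by (intro no_two_classes[of ?L x y, OF _ lam x y(1) uniq(1)[OF y, symmetric]]) auto
  next
    case False
    let ?T = "insert x (nxt C ` I x)"
    have xC: "x \<notin> nxt C ` I x" using card_nxt_I(3)[of x] UV x by auto
    have cT: "card ?T = card (I x) + 1" using xC card_nxt_I(1)[of x] finU by simp
    show False
    \<comment> \<open>\<open>x\<close> is blue to all of \<open>A\<close> and is used up in
      \<open>T\<close>; the count is then |A| + |Q| - 1 = n.\<close>
    proof (rule jackson_finish[where \<Lambda> = ?L and L = A and T = ?T and k = "card ?T - 1", OF _ lam])
      have "0 < card Q" using x finU by (auto simp: card_gt_0_iff)
      then show "card A \<le> n" using cardAQ by linarith
      show "?T \<subseteq> V" using card_nxt_I(3)[of x] CV x UV by auto
      show "A \<inter> ?T = {}" using card_nxt_I(3)[of x] x by (auto simp: A_def U_def)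
      show "card A \<le> card ?T - 1" using \<open>card A \<le> n\<close> cT cI by simp
      show "card ?T + 2 \<le> 2 * (card ?T - 1)" using cT cI n4 by simp
      show "card ?T - 1 \<le> card {y \<in> ?T. B u y}" if u: "u \<in> A" for u
      proof (rule card_filter_ge)
        have "{y \<in> ?T. \<not> B u y} \<subseteq> {y \<in> ?T. R u y}"
          using A_blue[OF u] symB'[OF Q_blue[OF x u]] card_nxt_I(3)[of x] by blast
        then have "card {y \<in> ?T. \<not> B u y} \<le> card {y \<in> ?T. R u y}" using finU by (intro card_mono) auto
        moreover have "x \<noteq> u" using x u by (auto simp: A_def)
        ultimately show "card {y \<in> ?T. \<not> B u y} \<le> 1"
          using red_le_1(1)[OF UV(3)[OF x] UV(4)[OF u]] by linarith
      qed (use finU in simp)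
      have "Q - insert x ?T = Q - {x}" using card_nxt_I(3)[of x] UV by auto
      then have "card {z \<in> Q - ?T. p z \<in> ?L} = card Q - 1" unfolding inL using x finU by simp
      then show "n \<le> card A + card {z \<in> Q - ?T. p z \<in> ?L}" using cardAQ by linarith
    qed (use x False in auto)
  qed
qed

text \<open>Now every class meeting \<open>Q\<close> may be absorbed, so it remains to find a blue
  cycle that uses most of \<open>A\<close>; what is set aside in \<open>A\<close> is made up for by
  vertices of \<open>Q\<close>.\<close>

theorem no_split: "Q = {}"
proof (rule ccontr)
  assume ne: "Q \<noteq> {}"
  let ?L = "p ` Q"
  have lam: "card {w \<in> V. R z w} \<le> n - 1" if "z \<in> Q" for z
    using no_split_large[OF that] n4 by fastforce
  have inL: "{z \<in> X. p z \<in> ?L} = X" if "X \<subseteq> Q" for X using that by auto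
  obtain xs where xs: "xs \<in> Q" using ne by blast
  have q1: "1 \<le> card Q" using ne finU by (simp add: Suc_leI card_gt_0_iff)
  \<comment> \<open>In the main case one vertex of \<open>A\<close> may be set aside, and Jackson's
    theorem needs two more.\<close>
  consider "card A \<le> 1" | "card A = 2" | "3 \<le> card A" by linarith
  then show False
  proof cases
    case 1
    then have q: "n \<le> card Q" using cardAQ by linarith
    \<comment> \<open>\<open>Q\<close> has at least n vertices, a class at most n - 1.\<close>
    have "\<exists>y\<in>Q. p y \<noteq> p xs"
    proof (rule ccontr)
      assume "\<not> (\<exists>y\<in>Q. p y \<noteq> p xs)"
      then have "Q \<subseteq> {v \<in> V. p v = p xs}" using UV by auto
      then have "card Q \<le> card {v \<in> V. p v = p xs}" using fin by (intro card_mono) auto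
      then show False using cls[of xs] q UV xs n4 by fastforce
    qed
    then obtain y where y: "y \<in> Q" "p y \<noteq> p xs" by blast
    have "card {z \<in> Q - {xs, y}. p z \<in> ?L} = card Q - 2"
    proof -
      have "xs \<noteq> y" using y by auto
      then show ?thesis
        unfolding inL[OF Diff_subset] using xs y finU card_Diff_subset[of "{xs, y}" Q] by auto
    qed
    then have "n \<le> card {z \<in> Q - {xs, y}. p z \<in> ?L} + 2" using q by linarith
    then show False
      by (intro no_two_classes[of ?L xs y, OF _ lam xs y(1) y(2)[symmetric]]) auto
  next
    case 2
    then obtain x u where A: "A = {x, u}" "x \<noteq> u" by (meson card_2_iff)
    obtain v where v: "v \<in> set C" "p v = p xs" using xs by (auto simp: Q_def)
    have V: "v \<in> V" "xs \<in> V" "x \<in> V" "u \<in> V" "x \<notin> Q" "u \<notin> Q" "v \<notin> U" "x \<in> U" "u \<in> U" "xs \<in> U"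
    proof -
      have "x \<in> A" "u \<in> A" using A by auto
      then show "x \<in> V" "u \<in> V" "x \<notin> Q" "u \<notin> Q" "x \<in> U" "u \<in> U" by (auto simp: A_def U_def)
      show "v \<in> V" "xs \<in> V" "v \<notin> U" "xs \<in> U" using v xs CV by (auto simp: Q_def U_def)
    qed
    have b: "B xs x" "B xs u" "B v x" "B v u"
      using Q_blue[OF xs] M_blue[of v x] M_blue[of v u] A v xs V A_twin by (auto simp: M_def)
    have c: "is_cycle B [x, xs, u, v]" using b b[THEN symB'] A(2) V xs by (auto simp: is_cycle_def)
    have "Q - set [x, xs, u, v] = Q - {xs}" using V UV by auto
    then have "card {z \<in> Q - set [x, xs, u, v]. p z \<in> ?L} = card Q - 1"
      unfolding inL[OF Diff_subset] using xs finU by simp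
    moreover have "x \<in> M" "xs \<in> M" "u \<in> M" using A xs V by (auto simp: M_def)
    moreover have "set [x, xs, u, v] \<subseteq> V" using V by auto
    ultimately show False
      by (intro finish_list[of ?L, OF _ lam c]) (use 2 cardAQ n4 in auto)
  next
    case 3
    have AU: "A \<inter> set C = {}" "A \<subseteq> U" "A \<inter> Q = {}" by (auto simp: A_def U_def)
    define Bd where "Bd = {u \<in> A. n - 1 \<le> card (I u)}"
    have fBd: "finite Bd" using finU by (simp add: Bd_def)
    show False
    proof (cases "card Bd \<le> 1")
      case True
      have "\<exists>y\<in>A. Bd \<subseteq> {y}"
      proof (cases "Bd = {}")
        case True
        then show ?thesis using 3 by (metis card.empty equals0I empty_subsetI not_numeral_le_zero)
      next
        case False
        then obtain y where "Bd = {y}" using \<open>card Bd \<le> 1\<close> fBd by (metis card_1_singletonE card_gt_0_iff Suc_leI le_antisym One_nat_def)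
        then show ?thesis by (auto simp: Bd_def)
      qed
      then obtain y where y: "y \<in> A" "Bd \<subseteq> {y}" by blast
      have cL: "card (A - {y}) = card A - 1" using y finU by simp
      show False
      \<comment> \<open>Outside \<open>Bd\<close> there are at most n - 2 red, hence at least n blue
        neighbours among the 2n - 2 vertices of \<open>C\<close>.\<close>
      proof (rule jackson_finish[where \<Lambda> = ?L and L = "A - {y}" and T = "set C" and k = n, OF _ lam])
        show "n \<le> card {z \<in> set C. B u z}" if u: "u \<in> A - {y}" for u
        proof -
          have "card (I u) \<le> n - 2" using u y by (auto simp: Bd_def)
          moreover have "{z \<in> set C. \<not> B u z} \<subseteq> I u" using A_blue[of u] u by (auto simp: I_def)
          then have "card {z \<in> set C. \<not> B u z} \<le> card (I u)" using finU by (intro card_mono) auto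
          ultimately have "card (set C) - (n - 2) \<le> card {z \<in> set C. B u z}" by (intro card_filter_ge) auto
          then show ?thesis using cardC n4 by linarith
        qed
        have "Q - set C = Q" using UV by auto
        then show "n \<le> card (A - {y}) + card {x \<in> Q - set C. p x \<in> ?L}"
          using cL cardAQ 3 inL[of Q] by simp
      qed (use ne AU CV cardC cardAQ n4 3 cL q1 in auto)
    next
      case False
      show False
      \<comment> \<open>A bad \<open>x\<close> without twin in \<open>A\<close> may stand in
        \<open>T\<close> itself, because each other vertex of \<open>A\<close> is joined to it in
        red or blue.\<close>
      proof (cases "\<exists>x\<in>Bd. \<forall>u\<in>A. u \<noteq> x \<longrightarrow> p u \<noteq> p x")
        case True
        then obtain x where x: "x \<in> A" "n - 1 \<le> card (I x)" "\<And>u. u \<in> A \<Longrightarrow> u \<noteq> x \<Longrightarrow> p u \<noteq> p x"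
          by (auto simp: Bd_def)
        let ?T = "insert x (nxt C ` I x)"
        have xU: "x \<in> U" "x \<in> V" "x \<notin> set C" using x UV by blast+
        have "x \<notin> nxt C ` I x" using card_nxt_I(3)[of x] xU by blast
        then have cT: "card ?T = card (I x) + 1" using card_nxt_I(1)[of x] finU by simp
        have cL: "card (A - {x}) = card A - 1" using x finU by simp
        show False
        proof (rule jackson_finish[where \<Lambda> = ?L and L = "A - {x}" and T = ?T and k = "card ?T - 1", OF _ lam])
          show "card ?T - 1 \<le> card {y \<in> ?T. B u y}" if u: "u \<in> A - {x}" for u
          proof (rule card_filter_ge)
            have "{y \<in> ?T. \<not> B u y} \<subseteq> {y \<in> ?T. R u y}"
            proof -
              have "B u x" if "\<not> R u x" using dich[of u x] x(3)[of u] u UV xU that by auto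
              moreover have "B u y" if "\<not> R u y" "y \<in> nxt C ` I x" for y
                using A_blue[of u y] u card_nxt_I(3)[of x] that by blast
              ultimately show ?thesis by blast
            qed
            then have "card {y \<in> ?T. \<not> B u y} \<le> card {y \<in> ?T. R u y}" using finU by (intro card_mono) auto
            then show "card {y \<in> ?T. \<not> B u y} \<le> 1" using red_le_1(1)[of x u] xU u UV by fastforce
          qed (use finU in simp)
          have "Q - ?T = Q" using card_nxt_I(3)[of x] UV x AU by auto
          then show "n \<le> card (A - {x}) + card {z \<in> Q - ?T. p z \<in> ?L}"
            using cL cardAQ 3 inL[of Q] by simp
          show "?T \<subseteq> V" "(A - {x}) \<inter> ?T = {}" using card_nxt_I(3)[of x] xU CV AU by auto
        qed (use ne x cT cardAQ n4 3 cL q1 in auto)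
      next
        case False
        have "Bd \<noteq> {}" using \<open>\<not> card Bd \<le> 1\<close> by auto
        then obtain x x' where x: "x \<in> A" "n - 1 \<le> card (I x)" and x': "x' \<in> A" "x' \<noteq> x" "p x' = p x"
          using False by (auto simp: Bd_def)
        have xV: "x \<in> U" "x \<in> V" "x' \<in> U" "x' \<in> V" using x x' UV by blast+
        have Ix: "I x' = I x" using twinR[of x x'] twinR[of x' x] xV x'(3) CV by (auto simp: I_def)
        \<comment> \<open>This covers \<open>u = x\<close> too: \<open>x\<close> and
          \<open>x'\<close> have the same red neighbours on \<open>C\<close>, and \<open>u\<close>
          differs from one of them.\<close>
        have r1: "card {y \<in> nxt C ` I x. R u y} \<le> 1" "card {y \<in> nxt (rev C) ` I x. R u y} \<le> 1" if u: "u \<in> A" for u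
        proof -
          obtain z where z: "z \<in> U" "z \<noteq> u" "I z = I x" using xV x'(2) Ix by metis
          have "card {y \<in> nxt C ` I x. R u y} \<le> card {y \<in> insert z (nxt C ` I z). R u y}"
            "card {y \<in> nxt (rev C) ` I x. R u y} \<le> card {y \<in> insert z (nxt (rev C) ` I z). R u y}"
            using finU z(3) by (intro card_mono; auto)+
          then show "card {y \<in> nxt C ` I x. R u y} \<le> 1" "card {y \<in> nxt (rev C) ` I x. R u y} \<le> 1"
            using red_le_1[OF z(1) UV(4)[OF u] z(2)] by linarith+
        qed
        \<comment> \<open>\<open>x\<close> has no edge to its twin \<open>x'\<close>, so
          \<open>xs\<close>, which is blue to all of \<open>A\<close>, takes its place in
          \<open>T\<close>.\<close>
        let ?T = "insert xs (nxt C ` I x)"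
        have xsC: "xs \<notin> nxt C ` I x" using card_nxt_I(3)[of x] UV xs by auto
        have cT: "card ?T = card (I x) + 1" using xsC card_nxt_I(1)[of x] finU by simp
        have fT: "finite ?T" using finU by simp
        have TV: "?T \<subseteq> V" "A \<inter> ?T = {}" using card_nxt_I(3)[of x] CV xs UV AU by auto
        have miss: "card {y \<in> ?T. \<not> B u y} \<le> 1" if u: "u \<in> A" for u
        proof -
          have "{y \<in> ?T. \<not> B u y} \<subseteq> {y \<in> nxt C ` I x. R u y}"
            using A_blue[OF u] symB'[OF Q_blue[OF xs u]] card_nxt_I(3)[of x] by blast
          then have "card {y \<in> ?T. \<not> B u y} \<le> card {y \<in> nxt C ` I x. R u y}" using finU by (intro card_mono) auto
          then show ?thesis using r1(1)[OF u] by linarith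
        qed
        show False
        proof (cases "card A \<le> card ?T - 1")
          case True
          show False
          proof (rule jackson_finish[where \<Lambda> = ?L and L = A and T = ?T and k = "card ?T - 1", OF _ lam])
            show "card ?T - 1 \<le> card {y \<in> ?T. B u y}" if u: "u \<in> A" for u
              by (rule card_filter_ge[OF fT miss[OF u]])
            have "Q - ?T = Q - {xs}" using card_nxt_I(3)[of x] UV by auto
            then have "card {z \<in> Q - ?T. p z \<in> ?L} = card Q - 1" unfolding inL[OF Diff_subset] using xs finU by simp
            then show "n \<le> card A + card {z \<in> Q - ?T. p z \<in> ?L}" using cardAQ by linarith
          qed (use ne TV cT cardAQ n4 3 q1 x True in auto)
        next
          case False
          then have cA: "card A = n" "card ?T = n" "card Q = 1" using cT x(2) cardAQ q1 by linarith+
          \<comment> \<open>Both sides have n vertices and k is n - 1, out of reach for Jackson's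
            theorem; the Hamiltonian lemma fails only at an \<open>s\<close> with at most one blue
            neighbour.\<close>
          have "\<exists>s\<in>?T. \<not> 2 \<le> card {u \<in> A. B u s}"
          proof (rule ccontr)
            assume "\<not> ?thesis"
            then have "\<exists>D. is_cycle (bip B A ?T) D \<and> length D = 2 * n"
              by (intro near_complete_bipartite_hamiltonian[OF symB _ fT TV(2) cA(1,2) n4 miss]) (use finU in auto)
            then obtain D where D: "is_cycle (bip B A ?T) D" "length D = 2 * n" by blast
            have "set D \<subseteq> V" using bip_cycle_subset[OF D(1)] TV AU(2) UV(1) by blast
            then show False using noB[OF bip_cycle_is_cycle[OF D(1)]] D(2) by blast
          qed
          then obtain s where "s \<in> ?T" "\<not> 2 \<le> card {u \<in> A. B u s}" by blast
          then have s: "s \<in> ?T" "card {u \<in> A. B u s} \<le> 1" by linarith+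
          have "s \<noteq> xs"
          proof
            assume "s = xs"
            then have "{u \<in> A. B u s} = A" using symB'[OF Q_blue[OF xs]] by auto
            then show False using s cA n4 by simp
          qed
          then have sI: "s \<in> nxt C ` I x" using s by auto
          then have sC: "s \<in> set C" using card_nxt_I(3) by auto
          define A' where "A' = {u \<in> A. R u s}"
          have fA': "finite A'" using finU by (simp add: A'_def)
          have "A \<subseteq> A' \<union> {u \<in> A. B u s}" using A_blue sC by (auto simp: A'_def)
          then have "card A \<le> card (A' \<union> {u \<in> A. B u s})" using finU fA' by (intro card_mono) auto
          then have cA': "n - 1 \<le> card A'" using card_Un_le[of A' "{u \<in> A. B u s}"] s(2) cA by linarith
          have "x \<in> A' \<or> x' \<in> A'"
          proof (rule ccontr)
            assume "\<not> ?thesis"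
            then have "A' \<subseteq> A - {x, x'}" by (auto simp: A'_def)
            then have "card A' \<le> card (A - {x, x'})" using finU by (intro card_mono) auto
            also have "\<dots> = n - 2" using x x' cA finU card_Diff_subset[of "{x, x'}" A] by auto
            finally show False using cA' n4 by linarith
          qed
          then have "R x s" using twinR[of x' x s] xV x'(3) sC CV by (auto simp: A'_def)
          \<comment> \<open>\<open>s\<close> is in \<open>I x\<close> and also a successor of a
            member of \<open>I x\<close>, so \<open>I x\<close> is not a parity class and has at
            least n + 1 cycle neighbours.\<close>
          then have sIx: "s \<in> I x" using sC by (simp add: I_def)
          have ev: "even (length C)" using lenC by simp
          have "I x \<noteq> evens C" "I x \<noteq> odds C"
            using sI sIx nxt_evens[OF distC ev] evens_odds(2)[OF distC] by blast+
          then have cP: "n + 1 \<le> card (nxt C ` I x \<union> nxt (rev C) ` I x)"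
            using card_cycle_neighbours[OF distC, of "n - 1" "I x"] lenC n4 x(2) by (simp add: I_def)
          let ?P = "(nxt C ` I x \<union> nxt (rev C) ` I x) - {s}"
          have cP': "n \<le> card ?P" using cP sI finU by simp
          have fP: "finite ?P" using finU by simp
          have PC: "?P \<subseteq> set C" using card_nxt_I(3)[of x] card_nxt_I(4)[of x] by blast
          obtain L where L: "L \<subseteq> A'" "card L = n - 1" by (rule obtain_subset_with_card_n[OF cA'])
          have LA: "L \<subseteq> A" using L by (auto simp: A'_def)
          show False
          \<comment> \<open>The vertices of \<open>L\<close> have \<open>s\<close> as their only red
            successor, and \<open>s\<close> is left out of \<open>T\<close>; so each misses at most
            one vertex of \<open>T\<close>, a predecessor.\<close>
          proof (rule jackson_finish[where \<Lambda> = ?L and L = L and T = ?P and k = "card ?P - 1", OF _ lam])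
            show "card ?P - 1 \<le> card {y \<in> ?P. B u y}" if u: "u \<in> L" for u
            proof (rule card_filter_ge[OF fP])
              have uA: "u \<in> A" "R u s" using u L by (auto simp: A'_def)
              have nx: "y \<notin> nxt C ` I x" if "y \<in> ?P" "R u y" for y
              proof
                assume "y \<in> nxt C ` I x"
                then have "{y, s} \<subseteq> {y \<in> nxt C ` I x. R u y}" using that uA sI by auto
                then have "card {y, s} \<le> card {y \<in> nxt C ` I x. R u y}" using finU by (intro card_mono) auto
                then show False using r1(1)[OF uA(1)] that(1) by auto
              qed
              have "{y \<in> ?P. \<not> B u y} \<subseteq> {y \<in> nxt (rev C) ` I x. R u y}"
                using A_blue[OF uA(1)] PC nx by blast
              then have "card {y \<in> ?P. \<not> B u y} \<le> card {y \<in> nxt (rev C) ` I x. R u y}" using finU by (intro card_mono) auto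
              then show "card {y \<in> ?P. \<not> B u y} \<le> 1" using r1(2)[OF uA(1)] by linarith
            qed
            have "Q - ?P = Q" using PC UV by auto
            then show "n \<le> card L + card {z \<in> Q - ?P. p z \<in> ?L}" using L cA inL[of Q] n4 by simp
            show "?P \<subseteq> V" "L \<inter> ?P = {}" using PC CV LA AU by auto
            show "card ?P + 2 \<le> 2 * (card ?P - 1)" "card L \<le> card ?P - 1" using cP' n4 L by auto
          qed (use ne LA L n4 in auto)
        qed
      qed
    qed
  qed
qed

end

section \<open>Vertices with many red neighbours on the cycle, when no class is split\<close>

context red_cycle
begin

lemma A_eq_U: "A = U"
  using no_split by (simp add: A_def)

lemma no_jackson:
  assumes L: "L \<subseteq> U" "card L = n" and T: "T \<subseteq> V" "L \<inter> T = {}"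
    and k: "n \<le> k" "card T + 2 \<le> 2 * k" and deg: "\<And>x. x \<in> L \<Longrightarrow> k \<le> card {y \<in> T. B x y}"
  shows False
proof -
  have fL: "finite L" "finite T" using finite_subset[OF L(1)] finite_subset[OF T(1)] finU fin by auto
  obtain Z where Z: "is_cycle (bip B L T) Z" "length Z = 2 * card L"
    using jackson[OF symB fL T(2) _ _ k(2) deg] L(2) k(1) n4 by auto
  have "set Z \<subseteq> V" using bip_cycle_subset[OF Z(1)] L(1) T(1) UV(1) by blast
  then show False using noB[OF bip_cycle_is_cycle[OF Z(1)]] Z(2) L(2) by blast
qed

lemma no_near_complete:
  assumes L: "L \<subseteq> V" "card L = n" and T: "T \<subseteq> V" "card T = n" "L \<inter> T = {}"
    and miss: "\<And>x. x \<in> L \<Longrightarrow> card {y \<in> T. \<not> B x y} \<le> 1"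
    and deg: "\<And>y. y \<in> T \<Longrightarrow> 2 \<le> card {x \<in> L. B x y}"
  shows False
proof -
  have fL: "finite L" "finite T" using finite_subset[OF L(1)] finite_subset[OF T(1)] fin by auto
  obtain Z where Z: "is_cycle (bip B L T) Z" "length Z = 2 * n"
    using near_complete_bipartite_hamiltonian[OF symB fL T(3) L(2) T(2) n4 miss deg] by blast
  have "set Z \<subseteq> V" using bip_cycle_subset[OF Z(1)] L(1) T(1) by blast
  then show False using noB[OF bip_cycle_is_cycle[OF Z(1)]] Z(2) by blast
qed

definition "W = {u \<in> U. n - 1 \<le> card (I u)}"

text \<open>Otherwise n vertices off the cycle have at least n blue neighbours each among the 2n - 2
  on it, which is Jackson's bound for k = n.\<close>

lemma two_bad: "2 \<le> card W"
proof (rule ccontr)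
  assume "\<not> 2 \<le> card W"
  moreover have fW: "finite W" using finU by (simp add: W_def)
  moreover have "U \<noteq> {}" using cardU by auto
  ultimately have "\<exists>y\<in>U. W \<subseteq> {y}"
  proof (cases "W = {}")
    case False
    then have "card W = 1" using \<open>\<not> 2 \<le> card W\<close> fW by (metis One_nat_def Suc_1 card_0_eq less_2_cases not_less)
    then obtain y where "W = {y}" by (metis card_1_singletonE)
    then show ?thesis by (auto simp: W_def)
  qed auto
  then obtain y where y: "y \<in> U" "W \<subseteq> {y}" by blast
  show False
  proof (rule no_jackson[of "U - {y}" "set C" n])
    show "card (U - {y}) = n" using y cardU finU by simp
    show "n \<le> card {z \<in> set C. B u z}" if u: "u \<in> U - {y}" for u
    proof -
      have "card (I u) \<le> n - 2" using u y by (auto simp: W_def)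
      moreover have "{z \<in> set C. \<not> B u z} \<subseteq> I u" using A_blue[of u] u A_eq_U by (auto simp: I_def)
      then have "card {z \<in> set C. \<not> B u z} \<le> card (I u)" using finU by (intro card_mono) auto
      ultimately have "card (set C) - (n - 2) \<le> card {z \<in> set C. B u z}" by (intro card_filter_ge) auto
      then show ?thesis using cardC n4 by linarith
    qed
  qed (use CV cardC n4 in \<open>auto simp: U_def\<close>)
qed

text \<open>If both cycle neighbours of some vertex are red to \<open>x\<close>, swapping that
  vertex for \<open>x\<close> gives a red cycle that splits the class of \<open>x\<close> and
  \<open>u\<close>. Otherwise the successors and predecessors of \<open>I x\<close> are disjoint and
  fill \<open>C\<close>, so another vertex of \<open>W\<close> has at most 1 + 1 red neighbours on
  \<open>C\<close>, fewer than n - 1.\<close>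

lemma bad_no_twin:
  assumes x: "x \<in> W" and u: "u \<in> U" "u \<noteq> x"
  shows "p u \<noteq> p x"
proof
  assume pux: "p u = p x"
  have xU: "x \<in> U" using x by (simp add: W_def)
  show False
  proof (cases "nxt C ` I x \<inter> nxt (rev C) ` I x = {}")
    case False
    then obtain v w where v: "v \<in> I x" "w \<in> I x" "nxt C v = nxt (rev C) w" by auto
    let ?z = "nxt C v"
    have z: "?z \<in> set C" using nxt_edge(2)[OF C, of v] v by (simp add: I_def)
    have zw: "nxt C ?z = w" using prv(3)[of w] v by (simp add: I_def)
    have "\<exists>D. is_cycle R D \<and> set D = insert x (set C - {?z})"
      by (rule cycle_swap[OF C symR z, of x v]) (use v zw xU UV lenC n4 in \<open>auto simp: I_def\<close>)
    then obtain D where D: "is_cycle R D" "set D = insert x (set C - {?z})" by blast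
    have "card (set D) = 2 * n - 2" using D(2) z UV(2)[OF xU] cardC n4 by simp
    then have "length D = 2 * n - 2" using is_cycle_card[OF D(1)] by simp
    then interpret D: red_cycle V p R B n D
      using D CV UV(1)[OF xU] by unfold_locales auto
    have "u \<in> D.U" using D(2) u UV by (auto simp: D.U_def)
    then have "u \<in> D.Q" using D(2) pux by (auto simp: D.Q_def)
    then show False using D.no_split by simp
  next
    case True
    let ?P = "nxt C ` I x \<union> nxt (rev C) ` I x"
    have "card ?P = 2 * card (I x)"
      using card_Un_disjoint[OF _ _ True] card_nxt_I(1,2)[of x] finU by simp
    moreover have "n - 1 \<le> card (I x)" using x by (simp add: W_def)
    ultimately have "card (set C) \<le> card ?P" using cardC by linarith
    then have P: "?P = set C"
      by (intro card_seteq) (use card_nxt_I(3)[of x] card_nxt_I(4)[of x] in blast)+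
    obtain y where y: "y \<in> W" "y \<noteq> x"
      using two_bad by (metis two_elements)
    then have yU: "y \<in> U" by (simp add: W_def)
    have "I y \<subseteq> {z \<in> insert x (nxt C ` I x). R y z} \<union> {z \<in> insert x (nxt (rev C) ` I x). R y z}"
      using P by (auto simp: I_def)
    then have "card (I y) \<le> card ({z \<in> insert x (nxt C ` I x). R y z} \<union> {z \<in> insert x (nxt (rev C) ` I x). R y z})"
      using finU by (intro card_mono) auto
    also have "\<dots> \<le> card {z \<in> insert x (nxt C ` I x). R y z} + card {z \<in> insert x (nxt (rev C) ` I x). R y z}"
      by (rule card_Un_le)
    also have "\<dots> \<le> 1 + 1" using red_le_1[OF xU yU y(2)[symmetric]] by (intro add_mono)
    finally have "card (I y) \<le> 2" by simp
    moreover have "n - 1 \<le> card (I y)" using y by (simp add: W_def)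
    ultimately show False using n4 by linarith
  qed
qed

lemma bad_blue:
  assumes "x \<in> W" "u \<in> U" "u \<noteq> x" "\<not> R u x"
  shows "B u x"
  using dich[of u x] bad_no_twin[OF assms(1-3)] assms UV(1) by (auto simp: W_def)

lemma U_blue: "u \<in> U \<Longrightarrow> z \<in> set C \<Longrightarrow> \<not> R u z \<Longrightarrow> B u z"
  using A_blue A_eq_U by auto

text \<open>If not, \<open>x\<close> with all cycle neighbours of \<open>I x\<close> makes a set of
  at least n + 2 vertices, of which any other \<open>u\<close> misses in blue at most one successor
  and one predecessor. As n + 2 >= 6, Jackson's theorem tolerates two missing vertices.\<close>

lemma bad_alternates:
  assumes x: "x \<in> W"
  shows "I x = evens C \<or> I x = odds C"
proof (rule ccontr)
  assume "\<not> ?thesis"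
  then have cP: "n + 1 \<le> card (nxt C ` I x \<union> nxt (rev C) ` I x)"
    using card_cycle_neighbours[OF distC, of "n - 1" "I x"] lenC n4 x by (simp add: I_def W_def)
  have xU: "x \<in> U" using x by (simp add: W_def)
  let ?P = "nxt C ` I x \<union> nxt (rev C) ` I x"
  let ?T = "insert x ?P"
  have PC: "?P \<subseteq> set C" using card_nxt_I(3)[of x] card_nxt_I(4)[of x] by blast
  then have "x \<notin> ?P" using UV xU by blast
  then have cT: "card ?T = card ?P + 1" using finU by simp
  show False
  proof (rule no_jackson[of "U - {x}" ?T "card ?T - 2"])
    show "card (U - {x}) = n" using xU cardU finU by simp
    show "?T \<subseteq> V" "(U - {x}) \<inter> ?T = {}" using PC CV UV xU by blast+
    show "n \<le> card ?T - 2" using cT cP by simp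
    show "card ?T + 2 \<le> 2 * (card ?T - 2)" using cT cP n4 by linarith
    show "card ?T - 2 \<le> card {y \<in> ?T. B u y}" if u: "u \<in> U - {x}" for u
    proof (rule card_filter_ge)
      let ?X = "{z \<in> insert x (nxt C ` I x). R u z}" and ?Y = "{z \<in> insert x (nxt (rev C) ` I x). R u z}"
      have "{y \<in> ?T. \<not> B u y} \<subseteq> ?X \<union> ?Y"
        using bad_blue[OF x, of u] U_blue[of u] u PC by blast
      then have "card {y \<in> ?T. \<not> B u y} \<le> card (?X \<union> ?Y)" using finU by (intro card_mono) auto
      also have "\<dots> \<le> card ?X + card ?Y" by (rule card_Un_le)
      also have "\<dots> \<le> 1 + 1" using red_le_1[OF xU, of u] u by (intro add_mono) auto
      finally show "card {y \<in> ?T. \<not> B u y} \<le> 2" by simp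
    qed (use finU in simp)
  qed auto
qed

text \<open>All vertices of \<open>W\<close> are red to the same alternate vertices of the cycle. Moving one vertex \<open>u\<close> from
  \<open>U\<close> to the set \<open>E\<close> of the other alternate vertices makes \<open>U\<close> and \<open>E\<close> a nearly complete bipartite graph in
  blue, up to one exceptional star.\<close>

theorem no_red_cycle: False
proof -
  obtain x y where xy: "x \<in> W" "y \<in> W" "x \<noteq> y" using two_elements[OF two_bad] by blast
  have WU: "u \<in> U" if "u \<in> W" for u using that by (simp add: W_def)
  have ev: "even (length C)" using lenC by simp
  have nxtI: "nxt C ` I u = set C - I u" "card (I u) = n - 1" if u: "u \<in> W" for u
  proof -
    have c: "card (evens C) = n - 1" "card (odds C) = n - 1"
      using card_evens[OF distC, of "n - 1"] lenC n4 by simp_all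
    then show "card (I u) = n - 1" using bad_alternates[OF u] by auto
    have "nxt C ` I u \<subseteq> set C - I u"
      using bad_alternates[OF u] nxt_evens[OF distC ev] evens_odds[of C] distC by blast
    moreover have "card (set C - I u) = n - 1"
      using card_Diff_subset[of "I u" "set C"] finU cardC \<open>card (I u) = n - 1\<close> by (simp add: I_def)
    ultimately show "nxt C ` I u = set C - I u"
      by (intro card_seteq) (use card_nxt_I(1)[of u] \<open>card (I u) = n - 1\<close> in auto)
  qed
  \<comment> \<open>Were they different, \<open>I w\<close> would consist of successors of
    \<open>I u\<close>, of which \<open>w\<close> sees at most one in red.\<close>
  have same: "I u = I w" if u: "u \<in> W" and w: "w \<in> W" for u w
  proof (rule ccontr)
    assume ne: "I u \<noteq> I w"
    then have "I w = set C - I u"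
      using bad_alternates[OF u] bad_alternates[OF w] evens_odds[of C] distC by blast
    then have "I w \<subseteq> {z \<in> insert u (nxt C ` I u). R w z}" using nxtI(1)[OF u] by (auto simp: I_def)
    then have "card (I w) \<le> card {z \<in> insert u (nxt C ` I u). R w z}" using finU by (intro card_mono) auto
    then show False using red_le_1(1)[OF WU[OF u] WU[OF w]] ne nxtI(2)[OF w] n4 by fastforce
  qed
  define E where "E = set C - I x"
  have E: "nxt C ` I u = E" "I u = set C - E" if "u \<in> W" for u
    using nxtI(1)[OF that] same[OF that xy(1)] by (auto simp: E_def I_def)
  have cE: "card E = n - 1" using nxtI[OF xy(1)] card_nxt_I(1)[of x] by (simp add: E_def)
  have EC: "E \<subseteq> set C" "finite E" by (auto simp: E_def)
  have WE: "B u e" "\<not> R u e" if "u \<in> W" "e \<in> E" for u e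
    using E(2)[OF that(1)] that EC U_blue[OF WU] by (auto simp: I_def)
  \<comment> \<open>Otherwise the path \<open>a\<close>, \<open>u\<close>, \<open>b\<close> could
    replace a vertex \<open>e\<close> of \<open>E\<close> on the cycle, whose two neighbours there
    are red to \<open>a\<close> and \<open>b\<close>; the length would become 2n.\<close>
  have common: "\<not> (R u a \<and> R u b)" if a: "a \<in> W" and b: "b \<in> W" and u: "u \<in> U" and "a \<noteq> b" for a b u
  proof
    assume uab: "R u a \<and> R u b"
    have "E \<noteq> {}" using cE n4 by auto
    then obtain e where e: "e \<in> E" by blast
    then have eC: "e \<in> set C" using EC by auto
    obtain D where D: "is_cycle R (D @ [e])" "set (D @ [e]) = set C" "length (D @ [e]) = length C"
        "hd (D @ [e]) = nxt C e" "\<And>t. t \<in> set C \<Longrightarrow> nxt (D @ [e]) t = nxt C t"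
      using cycle_rotate_to_last[OF C eC] by metis
    have Dn: "D \<noteq> []" using D(3) lenC n4 by auto
    have "D @ [e] = butlast D @ last D # [e]" using Dn by simp
    moreover have "distinct (D @ [e])" using D(1) by (simp add: is_cycle_def)
    ultimately have "nxt (D @ [e]) (last D) = e"
      using nxt_split[of "butlast D" "last D" "[e]"] by (metis append_Cons append_Nil list.sel(1))
    moreover have DC: "set D \<subseteq> set C" using D(2) by auto
    then have lC: "last D \<in> set C" "hd D \<in> set C" using Dn last_in_set hd_in_set by blast+
    ultimately have nl: "nxt C (last D) = e" using D(5)[OF lC(1)] by simp
    have EE: "E = odds C \<or> E = evens C"
      using bad_alternates[OF xy(1)] evens_odds(1)[of C] evens_odds(2)[OF distC] unfolding E_def by blast
    have flip: "nxt C z \<in> E \<longleftrightarrow> z \<notin> E" if "z \<in> set C" for z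
    proof (cases "z \<in> evens C")
      case True
      then show ?thesis using EE nxt_evens(1)[OF distC ev True] evens_odds(2)[OF distC] by blast
    next
      case False
      then have "z \<in> odds C" using that evens_odds(1)[of C] by blast
      then show ?thesis using EE nxt_evens(2)[OF distC ev, of z] evens_odds(2)[OF distC] by blast
    qed
    have "last D \<notin> E" using flip[OF lC(1)] nl e by simp
    moreover have "hd D \<notin> E" using flip[OF eC] D(4) Dn e by simp
    ultimately have r: "R a (last D)" "R b (hd D)"
      using E(2)[OF a] E(2)[OF b] lC by (auto simp: I_def)
    have out: "a \<notin> set D" "b \<notin> set D" "u \<notin> set D" using DC UV(2) WU a b u by blast+
    have "is_cycle R (D @ [a, u, b])"
    proof -
      have "a \<noteq> u" "b \<noteq> u" using uab R_cls by blast+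
      then show ?thesis
        using D(1) Dn r out \<open>a \<noteq> b\<close> uab symR'[OF conjunct1[OF uab]] symR'[OF r(1)]
        by (auto simp: is_cycle_def successively_append_iff)
    qed
    moreover have "length (D @ [a, u, b]) = 2 * n" using D(3) lenC n4 by simp
    moreover have "set (D @ [a, u, b]) \<subseteq> V" using DC CV UV(1) WU a b u by auto
    ultimately show False using noR by blast
  qed
  \<comment> \<open>Between \<open>U - {u}\<close> and \<open>insert u E\<close> a vertex of
    \<open>U - {u}\<close> misses at most one blue edge, so only the degree condition on the other
    side can fail.\<close>
  have star: "\<exists>s\<in>insert u E. n - 1 \<le> card {w \<in> U - {u}. R w s}" if u: "u \<in> W" for u
  proof (rule ccontr)
    assume no: "\<not> ?thesis"
    have uC: "u \<notin> E" using EC UV WU[OF u] by auto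
    show False
    proof (rule no_near_complete[of "U - {u}" "insert u E"])
      show "U - {u} \<subseteq> V" "insert u E \<subseteq> V" "(U - {u}) \<inter> insert u E = {}" using UV EC CV WU[OF u] by blast+
      show cU: "card (U - {u}) = n" using WU[OF u] cardU finU by simp
      show "card (insert u E) = n" using uC cE EC n4 by simp
      have bl: "B w s" if "w \<in> U - {u}" "s \<in> insert u E" "\<not> R w s" for w s
        using bad_blue[OF u, of w] U_blue[of w s] that EC by auto
      show "card {s \<in> insert u E. \<not> B w s} \<le> 1" if w: "w \<in> U - {u}" for w
      proof -
        have "{s \<in> insert u E. \<not> B w s} \<subseteq> {s \<in> insert u (nxt C ` I u). R w s}"
          using bl[OF w] E(1)[OF u] by auto
        then have "card {s \<in> insert u E. \<not> B w s} \<le> card {s \<in> insert u (nxt C ` I u). R w s}"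
          using finU by (intro card_mono) auto
        then show ?thesis using red_le_1(1)[OF WU[OF u], of w] w by fastforce
      qed
      show "2 \<le> card {w \<in> U - {u}. B w s}" if s: "s \<in> insert u E" for s
      proof -
        have "U - {u} = {w \<in> U - {u}. R w s} \<union> {w \<in> U - {u}. B w s}" using bl s by auto
        then have "n \<le> card {w \<in> U - {u}. R w s} + card {w \<in> U - {u}. B w s}" using cU by (metis card_Un_le)
        moreover have "card {w \<in> U - {u}. R w s} < n - 1" using no s by auto
        ultimately show ?thesis by linarith
      qed
    qed
  qed
  have cU2: "card (U - {a, b}) = n - 1" if "a \<in> W" "b \<in> W" "a \<noteq> b" for a b
    using card_Diff_subset[of "{a, b}" U] WU that cardU finU by auto
  have starE: "\<exists>s\<in>E. {w \<in> U - {a}. R w s} = U - {a, b}" if ab: "a \<in> W" "b \<in> W" "a \<noteq> b"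
      and s: "s \<in> E" "n - 1 \<le> card {w \<in> U - {a}. R w s}" for a b s
  proof -
    have "{w \<in> U - {a}. R w s} \<subseteq> U - {a, b}" using WE(2)[OF ab(2) s(1)] by auto
    then have "{w \<in> U - {a}. R w s} = U - {a, b}"
      by (rule card_seteq[rotated]) (use finU cU2[OF ab] s in auto)
    then show ?thesis using s by blast
  qed
  \<comment> \<open>Otherwise the red stars chosen for \<open>x\<close> and for \<open>y\<close>
    each have n - 2 leaves in \<open>U - {x, y}\<close>. The leaves are disjoint, but 2(n - 2) > n -
    1.\<close>
  have x_not: "\<not> n - 1 \<le> card {w \<in> U - {x}. R w x}"
  proof
    assume "n - 1 \<le> card {w \<in> U - {x}. R w x}"
    moreover have "card {w \<in> U - {x}. R w x} \<le> card ({w \<in> U - {x, y}. R w x} \<union> {y})"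
      using finU by (intro card_mono) auto
    then have "card {w \<in> U - {x}. R w x} \<le> card {w \<in> U - {x, y}. R w x} + 1"
      using card_Un_le[of "{w \<in> U - {x, y}. R w x}" "{y}"] by simp
    ultimately have cx: "n - 2 \<le> card {w \<in> U - {x, y}. R w x}" by linarith
    obtain s where s: "s \<in> insert y E" "n - 1 \<le> card {w \<in> U - {y}. R w s}" using star[OF xy(2)] by blast
    have "n - 2 \<le> card {w \<in> U - {x, y}. R w s}"
    proof -
      have "card {w \<in> U - {y}. R w s} \<le> card ({w \<in> U - {x, y}. R w s} \<union> {x})"
        using finU by (intro card_mono) auto
      then show ?thesis using card_Un_le[of "{w \<in> U - {x, y}. R w s}" "{x}"] s by simp
    qed
    moreover have "{w \<in> U - {x, y}. R w x} \<inter> {w \<in> U - {x, y}. R w s} = {}"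
    proof (cases "s = y")
      case True then show ?thesis using common[OF xy(1,2) _ xy(3)] by blast
    next
      case False
      then have sE: "s \<in> E" using s by auto
      have "x \<notin> E" using EC UV WU[OF xy(1)] by auto
      show ?thesis
      proof (rule ccontr)
        assume "\<not> ?thesis"
        then obtain w where w: "w \<in> U" "w \<noteq> x" "R w x" "R w s" by auto
        then have "x = s" using cross[OF WU[OF xy(1)] w(1), of x s] E(1)[OF xy(1)] sE by auto
        then show False using \<open>x \<notin> E\<close> sE by simp
      qed
    qed
    moreover have "card ({w \<in> U - {x, y}. R w x} \<union> {w \<in> U - {x, y}. R w s}) \<le> n - 1"
      using card_mono[of "U - {x, y}" "{w \<in> U - {x, y}. R w x} \<union> {w \<in> U - {x, y}. R w s}"] finU cU2[OF xy] by auto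
    ultimately show False using cx n4 finU card_Un_disjoint[of "{w \<in> U - {x, y}. R w x}" "{w \<in> U - {x, y}. R w s}"]
      by auto
  qed
  obtain s where s: "s \<in> E" "{w \<in> U - {x}. R w s} = U - {x, y}"
    using star[OF xy(1)] x_not starE[OF xy] by blast
  let ?N = "U - {x, y}"
  have N: "R w s" "w \<in> U" "w \<noteq> x" "w \<noteq> y" if "w \<in> ?N" for w using s(2) that by blast+
  have sN: "s \<notin> ?N" "s \<in> set C" using s EC UV by auto
  \<comment> \<open>The red edge to \<open>s\<close> is the only one that \<open>cross\<close>
    allows \<open>w\<close> to have into \<open>insert x E\<close> and into
    \<open>insert y E\<close>.\<close>
  have NE: "B w z" if w: "w \<in> ?N" and z: "z \<in> insert x (insert y (E - {s}))" for w z
  proof -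
    have "\<not> R w z"
    proof
      assume wz: "R w z"
      consider "z \<in> insert x (E - {s})" | "z = y" using z by auto
      then show False
      proof cases
        case 1
        then have "z = s" using cross[OF WU[OF xy(1)] N(2)[OF w], of z s] N[OF w] E(1)[OF xy(1)] s(1) wz by auto
        then show False using 1 s EC UV WU[OF xy(1)] by auto
      next
        case 2
        then have "z = s" using cross[OF WU[OF xy(2)] N(2)[OF w], of z s] N[OF w] E(1)[OF xy(2)] s(1) wz by auto
        then show False using 2 s EC UV WU[OF xy(2)] by auto
      qed
    qed
    then show ?thesis
      using z bad_blue[OF xy(1), of w] bad_blue[OF xy(2), of w] U_blue[of w z] N[OF w] EC by auto
  qed
  have xyC: "x \<notin> set C" "y \<notin> set C" using UV WU xy by auto
  show False
  \<comment> \<open>With \<open>x\<close> and \<open>y\<close> on the side of \<open>E\<close> and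
    \<open>s\<close> on the other, blue is complete except possibly at \<open>s\<close>, which still
    has the blue neighbours \<open>x\<close> and \<open>y\<close>.\<close>
  proof (rule no_near_complete[of "insert x (insert y (E - {s}))" "insert s ?N"])
    show "insert x (insert y (E - {s})) \<subseteq> V" "insert s ?N \<subseteq> V"
      using EC CV WU xy UV(1) sN by blast+
    show "card (insert s ?N) = n" using sN finU cU2[OF xy] n4 by simp
    have "card (E - {s}) = n - 2" using s cE EC by simp
    moreover have "x \<notin> insert y (E - {s})" "y \<notin> E - {s}" using xy xyC EC by blast+
    ultimately show "card (insert x (insert y (E - {s}))) = n" using EC n4 by simp
    show "insert x (insert y (E - {s})) \<inter> insert s ?N = {}" using s xyC sN EC UV(2) by blast
    show "card {t \<in> insert s ?N. \<not> B z t} \<le> 1" if z: "z \<in> insert x (insert y (E - {s}))" for z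
    proof -
      have "{t \<in> insert s ?N. \<not> B z t} \<subseteq> {s}" using symB'[OF NE[OF _ z]] by auto
      then have "card {t \<in> insert s ?N. \<not> B z t} \<le> card {s}" by (intro card_mono) auto
      then show ?thesis by simp
    qed
    show "2 \<le> card {z \<in> insert x (insert y (E - {s})). B z t}" if t: "t \<in> insert s ?N" for t
    proof -
      have "{x, y} \<subseteq> {z \<in> insert x (insert y (E - {s})). B z t}"
        using t symB'[OF NE[of t]] WE(1)[OF xy(1) s(1)] WE(1)[OF xy(2) s(1)] by auto
      then have "card {x, y} \<le> card {z \<in> insert x (insert y (E - {s})). B z t}" using EC by (intro card_mono) auto
      then show ?thesis using xy by simp
    qed
  qed
qed

end

lemma (in critical_blowup) no_cycle:
  assumes "set C \<subseteq> V" "length C = 2 * n - 2"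
  shows "\<not> is_cycle R C" "\<not> is_cycle B C"
proof -
  show "\<not> is_cycle R C"
  proof
    assume "is_cycle R C"
    then interpret red_cycle V p R B n C using assms by unfold_locales
    show False by (rule no_red_cycle)
  qed
  show "\<not> is_cycle B C"
  proof
    assume C: "is_cycle B C"
    interpret sw: critical_blowup V p B R n by (rule swap_critical)
    interpret red_cycle V p B R n C using assms C by unfold_locales
    show False by (rule no_red_cycle)
  qed
qed

section \<open>Six and eight vertices\<close>

lemma edge_sym_if_less: "symp R \<Longrightarrow> i < j \<Longrightarrow> R (f j) (f i) \<longleftrightarrow> R (f i) (f j)"
  for f :: "nat \<Rightarrow> 'a"
  by (meson sympD)

lemma mono_C4_of_six:
  assumes sym: "symp R" "symp B" and V: "6 \<le> card V"
    and edge: "\<And>x y. x \<in> V \<Longrightarrow> y \<in> V \<Longrightarrow> x \<noteq> y \<Longrightarrow> R x y \<or> B x y"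
  shows "\<exists>C. set C \<subseteq> V \<and> length C = 4 \<and> (is_cycle R C \<or> is_cycle B C)"
proof (rule ccontr)
  assume no: "\<not> ?thesis"
  have fin: "finite V" by (rule card_ge_0_finite) (use V in linarith)
  then have "\<exists>f. bij_betw f {0..<card V} V" by (rule ex_bij_betw_nat_finite)
  then obtain f where f: "bij_betw f {0..<card V} V" by blast
  have inj: "inj_on f {..<6}" and fV: "f ` {..<6} \<subseteq> V"
    using f V by (auto simp: bij_betw_def intro: inj_on_subset)
  \<comment> \<open>The three 4-cycles on each of the 15 sets of four vertices.\<close>
  define xss :: "nat list list" where "xss = [[0,1,2,3], [0,1,3,2], [0,2,1,3], [0,1,2,4], [0,1,4,2], [0,2,1,4], [0,1,2,5], [0,1,5,2],
      [0,2,1,5], [0,1,3,4], [0,1,4,3], [0,3,1,4], [0,1,3,5], [0,1,5,3], [0,3,1,5], [0,1,4,5],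
      [0,1,5,4], [0,4,1,5], [0,2,3,4], [0,2,4,3], [0,3,2,4], [0,2,3,5], [0,2,5,3], [0,3,2,5],
      [0,2,4,5], [0,2,5,4], [0,4,2,5], [0,3,4,5], [0,3,5,4], [0,4,3,5], [1,2,3,4], [1,2,4,3],
      [1,3,2,4], [1,2,3,5], [1,2,5,3], [1,3,2,5], [1,2,4,5], [1,2,5,4], [1,4,2,5], [1,3,4,5],
      [1,3,5,4], [1,4,3,5], [2,3,4,5], [2,3,5,4], [2,4,3,5]]"
  have "\<forall>xs\<in>set xss. set xs \<subseteq> {..<6} \<and> length xs = 4" by (simp add: xss_def)
  moreover have "\<not> is_cycle R (map f xs) \<and> \<not> is_cycle B (map f xs)" if "set xs \<subseteq> {..<6}" "length xs = 4" for xs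
  proof -
    have "set (map f xs) \<subseteq> V" using that(1) fV by auto
    then show ?thesis using no that(2) by (metis length_map)
  qed
  ultimately have cyc: "\<forall>xs\<in>set xss. \<not> is_cycle R (map f xs) \<and> \<not> is_cycle B (map f xs)" by blast
  have e: "R (f i) (f j) \<or> B (f i) (f j)" if "i < 6" "j < 6" "i \<noteq> j" for i j
    using that fV inj by (intro edge) (auto simp: inj_on_eq_iff)
  have "\<forall>j\<in>set [0, 1, 2, 3, 4, 5]. \<forall>i\<in>set [0, 1, 2, 3, 4, 5]. i < j \<longrightarrow> R (f i) (f j) \<or> B (f i) (f j)"
    using e by auto
  then show False
    using cyc
    by (simp add: xss_def is_cycle_def inj_on_eq_iff[OF inj] edge_sym_if_less[OF sym(1)] edge_sym_if_less[OF sym(2)] del: One_nat_def) sat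
qed

context blowup
begin

text \<open>An atom for \<open>sat\<close> in place of an equation between classes, with the same
  symmetry rule as the colors.\<close>

definition twin :: "'a \<Rightarrow> 'a \<Rightarrow> bool" where "twin x y \<longleftrightarrow> p x = p y"

lemma symp_twin: "symp twin"
  by (auto simp: symp_def twin_def)

text \<open>The clauses handed to \<open>sat\<close>. A pair may be red and blue at once; the class
  bound 2 becomes the absence of three mutual twins.\<close>

lemma no_C6_constraints:
  fixes f :: "nat \<Rightarrow> 'a"
  defines "S \<equiv> [0, 1, 2, 3, 4, 5, 6, 7]"
  assumes cls: "\<And>x. x \<in> V \<Longrightarrow> card {v \<in> V. p v = p x} \<le> 2"
    and inj: "inj_on f {..<8}" and fV: "f ` {..<8} \<subseteq> V"
    and no: "\<nexists>C. set C \<subseteq> V \<and> length C = 6 \<and> (is_cycle R C \<or> is_cycle B C)"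
    and xss: "\<forall>(a, b, c, d, e, g)\<in>set xss. distinct [a, b, c, d, e, g] \<and> set [a, b, c, d, e, g] \<subseteq> {..<8}"
  shows "\<forall>(a, b, c, d, e, g)\<in>set xss. \<forall>P\<in>set [R, B].
      \<not> (P (f a) (f b) \<and> P (f b) (f c) \<and> P (f c) (f d) \<and> P (f d) (f e) \<and> P (f e) (f g) \<and> P (f a) (f g))"
    and "\<forall>i\<in>set S. \<forall>j\<in>set S. i < j \<longrightarrow> (R (f i) (f j) \<or> B (f i) (f j) \<or> twin (f i) (f j)) \<and>
      (twin (f i) (f j) \<longrightarrow> \<not> R (f i) (f j) \<and> \<not> B (f i) (f j))"
    and "\<forall>i\<in>set S. \<forall>j\<in>set S. \<forall>k\<in>set S. i \<noteq> j \<longrightarrow> i \<noteq> k \<longrightarrow> j \<noteq> k \<longrightarrow>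
      (twin (f i) (f j) \<longrightarrow> \<not> twin (f j) (f k) \<and>
        (R (f i) (f k) \<longrightarrow> R (f j) (f k)) \<and> (B (f i) (f k) \<longrightarrow> B (f j) (f k)))"
proof -
  have S: "f i \<in> V" "i < 8" if "i \<in> set S" for i using that fV by (auto simp: S_def)
  have nc: "\<not> (P (f a) (f b) \<and> P (f b) (f c) \<and> P (f c) (f d) \<and> P (f d) (f e) \<and> P (f e) (f g) \<and> P (f a) (f g))"
    if x: "(a, b, c, d, e, g) \<in> set xss" and P: "P = R \<or> P = B" for a b c d e g P
  proof
    assume *: "P (f a) (f b) \<and> P (f b) (f c) \<and> P (f c) (f d) \<and> P (f d) (f e) \<and> P (f e) (f g) \<and> P (f a) (f g)"
    have d: "distinct [a, b, c, d, e, g]" "set [a, b, c, d, e, g] \<subseteq> {..<8}" using bspec[OF xss x] by auto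
    have "P (f g) (f a)" using * P symR' symB' by blast
    moreover have "distinct (map f [a, b, c, d, e, g])"
      using d inj_on_subset[OF inj d(2)] by (simp only: distinct_map)
    ultimately have "is_cycle P (map f [a, b, c, d, e, g])" using * by (simp add: is_cycle_def)
    moreover have "set (map f [a, b, c, d, e, g]) \<subseteq> V" using d(2) fV by auto
    ultimately show False using no P by (metis length_map length_Cons list.size(3) numeral_eq_Suc pred_numeral_simps arith_simps)
  qed
  show "\<forall>(a, b, c, d, e, g)\<in>set xss. \<forall>P\<in>set [R, B].
      \<not> (P (f a) (f b) \<and> P (f b) (f c) \<and> P (f c) (f d) \<and> P (f d) (f e) \<and> P (f e) (f g) \<and> P (f a) (f g))"
    using nc[of _ _ _ _ _ _ R] nc[of _ _ _ _ _ _ B] by auto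
  show "\<forall>i\<in>set S. \<forall>j\<in>set S. i < j \<longrightarrow> (R (f i) (f j) \<or> B (f i) (f j) \<or> twin (f i) (f j)) \<and>
      (twin (f i) (f j) \<longrightarrow> \<not> R (f i) (f j) \<and> \<not> B (f i) (f j))"
    using S dich[OF S(1) S(1)] R_cls B_cls unfolding twin_def by blast
  show "\<forall>i\<in>set S. \<forall>j\<in>set S. \<forall>k\<in>set S. i \<noteq> j \<longrightarrow> i \<noteq> k \<longrightarrow> j \<noteq> k \<longrightarrow>
      (twin (f i) (f j) \<longrightarrow> \<not> twin (f j) (f k) \<and>
        (R (f i) (f k) \<longrightarrow> R (f j) (f k)) \<and> (B (f i) (f k) \<longrightarrow> B (f j) (f k)))"
  proof (intro ballI impI)
    fix i j k assume S': "i \<in> set S" "j \<in> set S" "k \<in> set S" and ne: "i \<noteq> j" "i \<noteq> k" "j \<noteq> k"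
      and ij: "twin (f i) (f j)"
    have "\<not> twin (f j) (f k)"
    proof
      assume "twin (f j) (f k)"
      then have "{f i, f j, f k} \<subseteq> {v \<in> V. p v = p (f i)}" using S S' ij by (auto simp: twin_def)
      then have "card {f i, f j, f k} \<le> card {v \<in> V. p v = p (f i)}" using fin by (intro card_mono) auto
      moreover have "card {f i, f j, f k} = 3" using ne S S' inj by (simp add: inj_on_eq_iff)
      ultimately show False using cls[OF S(1)[OF S'(1)]] by simp
    qed
    then show "\<not> twin (f j) (f k) \<and> (R (f i) (f k) \<longrightarrow> R (f j) (f k)) \<and> (B (f i) (f k) \<longrightarrow> B (f j) (f k))"
      using twinR[of "f i" "f j" "f k"] twinB[of "f i" "f j" "f k"] S S' ij by (auto simp: twin_def)
  qed
qed

text \<open>In the next two lemmas \<open>xss\<close> is a small part of the 1680 labelled 6-cycles that already makes the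
  constraints unsatisfiable. The simplifier orients symmetric edges by the term order, in which 6 precedes 5;
  the facts \<open>c4\<close> make up for this.\<close>

lemma mono_C6_of_labelled_C5:
  fixes f :: "nat \<Rightarrow> 'a"
  assumes cls: "\<And>x. x \<in> V \<Longrightarrow> card {v \<in> V. p v = p x} \<le> 2"
    and inj: "inj_on f {..<8}" and fV: "f ` {..<8} \<subseteq> V"
    and red: "R (f 0) (f 1)" "R (f 1) (f 2)" "R (f 2) (f 3)" "R (f 3) (f 4)" "R (f 0) (f 4)"
    and non: "\<not> R (f 0) (f 5)" "\<not> R (f 1) (f 5)" "\<not> R (f 3) (f 5)"
  shows "\<exists>C. set C \<subseteq> V \<and> length C = 6 \<and> (is_cycle R C \<or> is_cycle B C)"
proof (rule ccontr)
  assume no: "\<not> ?thesis"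
  define xss :: "(nat \<times> nat \<times> nat \<times> nat \<times> nat \<times> nat) list" where "xss =
   [(0,1,2,3,4,7), (0,1,2,3,6,4), (0,1,2,3,7,4), (0,1,2,3,7,6), (0,1,2,4,5,6), (0,1,2,4,5,7),
    (0,1,2,4,6,7), (0,1,2,5,4,3), (0,1,2,5,4,6), (0,1,2,5,7,3), (0,1,2,6,3,4), (0,1,2,6,4,3),
    (0,1,2,6,7,4), (0,1,2,7,3,6), (0,1,2,7,4,3), (0,1,2,7,5,6), (0,1,3,2,4,6), (0,1,3,2,6,7),
    (0,1,3,2,7,6), (0,1,3,4,2,7), (0,1,3,4,5,2), (0,1,3,7,6,4), (0,1,4,3,2,7), (0,1,4,5,7,2),
    (0,1,4,5,7,3), (0,1,6,2,7,4), (0,1,6,3,2,7), (0,1,6,4,5,2), (0,1,6,5,2,4), (0,1,6,7,3,2),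
    (0,1,7,2,3,4), (0,1,7,3,4,6), (0,1,7,3,6,4), (0,1,7,4,3,2), (0,1,7,6,3,4), (0,2,1,6,4,3),
    (0,2,1,6,4,7), (0,2,1,7,3,6), (0,2,1,7,6,4), (0,2,3,4,1,6), (0,2,3,4,6,7), (0,2,3,6,7,4),
    (0,2,4,1,3,5), (0,2,4,1,3,6), (0,2,4,1,5,7), (0,2,4,6,7,3), (0,2,4,7,1,5), (0,2,5,1,3,7),
    (0,2,5,4,3,6), (0,2,5,6,7,3), (0,2,5,6,7,4), (0,2,6,1,3,4), (0,2,6,4,7,5), (0,2,6,5,1,3),
    (0,2,6,5,1,7), (0,2,6,7,1,5), (0,2,6,7,4,5), (0,2,7,1,5,6), (0,2,7,3,6,5), (0,2,7,6,4,5),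
    (0,2,7,6,5,4), (0,3,1,5,4,6), (0,3,1,5,6,7), (0,3,1,6,2,4), (0,3,2,1,4,6), (0,3,2,1,7,4),
    (0,3,2,5,6,4), (0,3,4,1,2,6), (0,3,4,7,2,5), (0,3,5,1,6,7), (0,3,5,2,4,6), (0,3,5,4,2,6),
    (0,3,5,6,1,7), (0,3,5,6,2,4), (0,3,5,7,2,6), (0,3,6,1,2,4), (0,3,6,1,4,5), (0,3,6,1,4,7),
    (0,3,6,1,5,7), (0,3,6,2,7,5), (0,3,6,4,1,5), (0,3,6,7,2,5), (0,3,7,1,2,4), (0,3,7,1,4,6),
    (0,3,7,4,5,6), (0,3,7,5,1,6), (0,3,7,5,2,6), (0,3,7,6,2,4), (0,3,7,6,4,5), (0,4,1,2,3,7),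
    (0,4,1,2,6,7), (0,4,1,3,2,6), (0,4,1,7,5,6), (0,4,2,1,3,6), (0,4,3,2,5,7), (0,4,3,7,2,6),
    (0,4,5,7,3,6), (0,4,6,2,1,7), (0,4,7,2,1,6), (0,4,7,2,3,6), (0,5,1,4,6,7), (0,5,1,4,7,6),
    (0,5,1,7,2,6), (0,5,2,4,1,6), (0,5,2,6,1,7), (0,5,2,7,4,6), (0,5,3,1,4,7), (0,5,3,7,2,6),
    (0,5,3,7,4,6), (0,5,4,6,2,7), (0,5,7,1,4,6), (0,6,1,2,3,7), (0,6,1,5,2,7), (0,6,1,5,4,7),
    (0,6,2,4,5,7), (0,6,3,1,5,7), (0,6,3,5,1,7), (0,6,3,5,4,7), (1,2,3,4,5,6), (1,2,4,5,7,6),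
    (1,2,5,6,7,4), (1,2,6,7,3,4), (1,3,2,5,4,6), (1,3,4,7,5,6), (1,3,5,4,6,7), (1,3,6,5,4,7),
    (1,3,7,2,4,5), (1,3,7,2,5,4), (1,3,7,4,2,5), (1,3,7,4,6,5), (1,4,2,6,7,5), (1,4,2,7,3,5),
    (1,4,2,7,3,6), (1,4,5,2,3,7), (1,4,5,2,6,7), (1,4,5,3,7,6), (1,4,5,6,2,7), (1,4,5,7,2,6),
    (1,4,6,3,7,5), (1,4,7,6,3,5), (1,5,2,4,6,7), (1,5,2,6,4,7), (1,5,3,7,4,6), (1,5,7,2,4,6),
    (1,6,2,3,4,7), (1,6,3,5,4,7), (2,3,6,7,5,4), (2,4,7,5,3,6), (2,5,3,7,4,6)]"
  have "\<forall>(a, b, c, d, e, g)\<in>set xss. distinct [a, b, c, d, e, g] \<and> set [a, b, c, d, e, g] \<subseteq> {..<8}"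
    by (simp add: xss_def)
  note * = no_C6_constraints[OF cls inj fV no this]
  note [simp] = edge_sym_if_less[OF symR] edge_sym_if_less[OF symB] edge_sym_if_less[OF symp_twin]
  note c1 = *(1)[unfolded xss_def, simplified]
  note c2 = *(2)[simplified]
  note c3 = *(3)[simplified]
  have "5 < (6 :: nat)" by simp
  note c4 = edge_sym_if_less[OF symR this, of f] edge_sym_if_less[OF symB this, of f] edge_sym_if_less[OF symp_twin this, of f]
  show False
    using c1 c2 c3 c4 red non unfolding One_nat_def by sat
qed

lemma mono_C6_of_labelled_C4:
  fixes f :: "nat \<Rightarrow> 'a"
  assumes cls: "\<And>x. x \<in> V \<Longrightarrow> card {v \<in> V. p v = p x} \<le> 2"
    and inj: "inj_on f {..<8}" and fV: "f ` {..<8} \<subseteq> V"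
    and red: "R (f 0) (f 1)" "R (f 1) (f 2)" "R (f 2) (f 3)" "R (f 0) (f 3)"
    and non: "\<not> R (f 1) (f 4)" "\<not> R (f 3) (f 4)" "\<not> R (f 1) (f 5)" "\<not> R (f 3) (f 5)"
  shows "\<exists>C. set C \<subseteq> V \<and> length C = 6 \<and> (is_cycle R C \<or> is_cycle B C)"
proof (rule ccontr)
  assume no: "\<not> ?thesis"
  define xss :: "(nat \<times> nat \<times> nat \<times> nat \<times> nat \<times> nat) list" where "xss =
   [(0,1,2,3,6,5), (0,1,2,4,6,3), (0,1,2,4,7,5), (0,1,2,5,7,4), (0,1,2,6,3,7), (0,1,2,6,4,7),
    (0,1,2,6,7,4), (0,1,2,7,6,3), (0,1,3,2,7,5), (0,1,3,6,7,5), (0,1,3,7,5,2), (0,1,3,7,6,2),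
    (0,1,3,7,6,4), (0,1,6,3,2,5), (0,1,6,3,7,4), (0,1,6,4,2,3), (0,1,6,5,2,4), (0,1,6,5,4,2),
    (0,1,7,3,2,4), (0,1,7,3,2,5), (0,1,7,3,4,6), (0,1,7,3,6,4), (0,1,7,4,2,5), (0,1,7,5,4,6),
    (0,1,7,6,5,4), (0,2,1,3,6,4), (0,2,1,6,4,5), (0,2,1,6,5,7), (0,2,1,7,6,3), (0,2,1,7,6,4),
    (0,2,3,1,4,6), (0,2,3,7,4,6), (0,2,4,1,3,6), (0,2,4,1,7,5), (0,2,4,3,5,7), (0,2,4,3,7,5),
    (0,2,4,7,6,3), (0,2,5,1,7,4), (0,2,5,3,1,6), (0,2,5,4,7,6), (0,2,5,6,7,4), (0,2,6,1,7,3),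
    (0,2,6,1,7,4), (0,2,6,3,7,5), (0,2,6,4,1,5), (0,2,6,5,1,7), (0,2,6,7,4,5), (0,2,7,1,3,6),
    (0,2,7,1,4,5), (0,2,7,1,4,6), (0,2,7,3,1,5), (0,2,7,4,1,6), (0,2,7,5,3,4), (0,2,7,6,1,5),
    (0,3,1,2,7,4), (0,3,1,7,5,6), (0,3,2,1,6,5), (0,3,2,1,6,7), (0,3,2,1,7,6), (0,3,2,4,6,5),
    (0,3,2,4,7,6), (0,3,2,5,6,4), (0,3,2,5,6,7), (0,3,2,6,1,7), (0,3,2,6,7,5), (0,3,2,7,4,6),
    (0,3,2,7,6,4), (0,3,4,2,1,5), (0,3,5,1,2,6), (0,3,6,1,2,7), (0,3,7,2,6,4), (0,3,7,4,5,6),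
    (0,3,7,5,2,4), (0,3,7,5,2,6), (0,3,7,5,4,6), (0,4,1,3,7,5), (0,4,1,5,3,6), (0,4,1,5,3,7),
    (0,4,1,6,3,5), (0,4,1,7,2,5), (0,4,2,1,7,5), (0,4,2,3,7,6), (0,4,2,6,7,5), (0,4,3,5,1,6),
    (0,4,3,5,6,7), (0,4,3,7,1,5), (0,4,5,2,6,7), (0,4,5,7,3,6), (0,4,6,1,3,5), (0,4,6,5,2,7),
    (0,4,7,1,3,6), (0,4,7,2,6,5), (0,5,1,3,4,6), (0,5,1,3,4,7), (0,5,1,4,3,6), (0,5,1,4,3,7),
    (0,5,1,6,4,7), (0,5,1,7,2,6), (0,5,2,3,7,6), (0,5,2,4,1,7), (0,5,3,1,4,6), (0,5,3,4,2,7),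
    (0,5,3,4,6,7), (0,5,3,4,7,6), (0,5,4,2,7,6), (0,5,4,6,2,7), (0,5,6,4,1,7), (0,5,7,3,2,6),
    (0,6,1,2,3,7), (0,6,1,2,5,7), (0,6,3,5,2,7), (0,6,3,5,4,7), (0,6,4,1,2,7), (0,6,4,1,5,7),
    (0,6,5,2,4,7), (0,6,5,4,1,7), (1,2,3,7,4,6), (1,2,3,7,5,6), (1,2,4,5,7,6), (1,2,5,7,3,4),
    (1,2,5,7,3,6), (1,2,6,4,5,3), (1,2,6,7,4,3), (1,2,7,6,5,4), (1,3,2,5,4,7), (1,3,4,2,5,7),
    (1,3,4,2,6,5), (1,3,4,5,2,6), (1,3,4,5,7,6), (1,3,4,6,2,5), (1,3,4,7,5,6), (1,3,5,2,4,7),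
    (1,3,5,4,2,6), (1,3,7,2,5,6), (1,3,7,2,6,4), (1,3,7,6,5,4), (1,4,2,5,3,7), (1,4,2,7,5,6),
    (1,4,3,5,6,7), (1,4,3,5,7,6), (1,4,3,6,2,7), (1,4,3,6,5,7), (1,4,3,7,2,5), (1,4,5,2,7,6),
    (1,4,5,3,6,7), (1,4,6,3,5,7), (1,4,6,7,2,5), (1,4,6,7,3,5), (1,4,7,2,5,6), (1,4,7,3,5,6),
    (1,4,7,5,3,6), (1,4,7,6,3,5), (1,5,2,4,3,6), (1,5,2,4,6,7), (1,5,3,6,4,7), (1,5,4,3,2,6),
    (1,5,4,3,6,7), (1,5,4,3,7,6), (1,5,7,2,4,6), (1,6,2,4,3,7), (1,6,3,2,4,7), (1,6,4,5,2,7),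
    (1,6,4,5,3,7), (2,3,6,4,5,7), (2,3,6,5,7,4), (2,3,6,7,4,5), (2,3,7,6,4,5), (2,4,5,3,6,7),
    (2,5,3,4,7,6), (2,6,3,4,5,7), (2,6,5,3,4,7)]"
  have "\<forall>(a, b, c, d, e, g)\<in>set xss. distinct [a, b, c, d, e, g] \<and> set [a, b, c, d, e, g] \<subseteq> {..<8}"
    by (simp add: xss_def)
  note * = no_C6_constraints[OF cls inj fV no this]
  note [simp] = edge_sym_if_less[OF symR] edge_sym_if_less[OF symB] edge_sym_if_less[OF symp_twin]
  note c1 = *(1)[unfolded xss_def, simplified]
  note c2 = *(2)[simplified]
  note c3 = *(3)[simplified]
  have "5 < (6 :: nat)" by simp
  note c4 = edge_sym_if_less[OF symR this, of f] edge_sym_if_less[OF symB this, of f] edge_sym_if_less[OF symp_twin this, of f]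
  show False
    using c1 c2 c3 c4 red non unfolding One_nat_def by sat
qed

end

text \<open>A vertex \<open>u\<close> red to two consecutive vertices of the cycle can be inserted.
  Otherwise its red neighbours lie among two non-adjacent vertices, and a suitable rotation gives
  the labelled case.\<close>

lemma (in blowup) mono_C6_of_C5:
  assumes V: "card V = 8" and cls: "\<And>x. x \<in> V \<Longrightarrow> card {v \<in> V. p v = p x} \<le> 2"
    and D: "is_cycle R D" "set D \<subseteq> V" "length D = 5"
  shows "\<exists>C. set C \<subseteq> V \<and> length C = 6 \<and> (is_cycle R C \<or> is_cycle B C)"
proof (rule ccontr)
  assume no: "\<not> ?thesis"
  have dD: "distinct D" using D(1) by (simp add: is_cycle_def)
  obtain E where E: "set E = V - set D" "distinct E" using finite_distinct_list[of "V - set D"] fin by auto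
  have "length E = 3"
    using distinct_card[OF E(2)] E(1) card_Diff_subset[OF _ D(2)] distinct_card[OF dD] D(3) V by simp
  then obtain u v w where uvw: "E = [u, v, w]" by (auto simp: numeral_eq_Suc length_Suc_conv)
  have nonred: "\<not> (\<not> R u a \<and> \<not> R u b \<and> \<not> R u d)"
    if c: "is_cycle R [a, b, c, d, e]" "set [a, b, c, d, e] = set D" for a b c d e
  proof
    assume non: "\<not> R u a \<and> \<not> R u b \<and> \<not> R u d"
    define L where "L = [a, b, c, d, e, u, v, w]"
    define f where "f = (!) L"
    have dL: "distinct L" "set L = V" "length L = 8"
      using c E uvw D(2) by (auto simp: L_def is_cycle_def)
    have f1: "inj_on f {..<8}" using inj_on_nth[OF dL(1), of "{..<8}"] dL(3) by (simp add: f_def)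
    have f2: "f ` {..<8} \<subseteq> V" using nth_mem[of _ L] unfolding dL(2,3) by (auto simp: f_def)
    have fx: "f 0 = a" "f 1 = b" "f 2 = c" "f 3 = d" "f 4 = e" "f 5 = u" by (simp_all add: f_def L_def)
    have red: "R a b" "R b c" "R c d" "R d e" "R a e" using c(1) symR'[of e a] by (auto simp: is_cycle_def)
    have non': "\<not> R a u" "\<not> R b u" "\<not> R d u" using non symR' by blast+
    show False
      using mono_C6_of_labelled_C5[OF cls f1 f2] red non' no unfolding fx by blast
  qed
  have ins: "\<not> (R u a \<and> R u b)" if c: "is_cycle R [a, b, c, d, e]" "set [a, b, c, d, e] = set D" for a b c d e
  proof
    assume "R u a \<and> R u b"
    moreover have "u \<in> V" "u \<notin> set D" using E uvw by auto
    ultimately have "is_cycle R [a, u, b, c, d, e]" "set [a, u, b, c, d, e] \<subseteq> V"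
      using c D(2) symR'[of u a] by (auto simp: is_cycle_def)
    moreover have "length [a, u, b, c, d, e] = 6" by simp
    ultimately show False using no by blast
  qed
  obtain a b c d e where abc: "D = [a, b, c, d, e]" using D(3) by (auto simp: numeral_eq_Suc length_Suc_conv)
  have rot: "is_cycle R [b, c, d, e, a] \<and> set [b, c, d, e, a] = set D"
    if "is_cycle R [a, b, c, d, e] \<and> set [a, b, c, d, e] = set D" for a b c d e
    using that by (auto simp: is_cycle_def)
  have c0: "is_cycle R [a, b, c, d, e] \<and> set [a, b, c, d, e] = set D" using D(1) abc by simp
  note c1 = rot[OF c0]
  note c2 = rot[OF c1]
  note c3 = rot[OF c2]
  note c4 = rot[OF c3]
  show False
    using nonred[OF c0[THEN conjunct1] c0[THEN conjunct2]] ins[OF c0[THEN conjunct1] c0[THEN conjunct2]]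
      nonred[OF c1[THEN conjunct1] c1[THEN conjunct2]] ins[OF c1[THEN conjunct1] c1[THEN conjunct2]]
      nonred[OF c2[THEN conjunct1] c2[THEN conjunct2]] ins[OF c2[THEN conjunct1] c2[THEN conjunct2]]
      nonred[OF c3[THEN conjunct1] c3[THEN conjunct2]] ins[OF c3[THEN conjunct1] c3[THEN conjunct2]]
      nonred[OF c4[THEN conjunct1] c4[THEN conjunct2]] ins[OF c4[THEN conjunct1] c4[THEN conjunct2]]
    by sat
qed

text \<open>A vertex red to two consecutive vertices of the cycle gives a red 5-cycle. Otherwise
  each vertex off the cycle is non-red to one of the two opposite pairs, and two of any three share
  such a pair: the labelled case.\<close>

lemma (in blowup) mono_C6_of_C4:
  assumes V: "card V = 8" and cls: "\<And>x. x \<in> V \<Longrightarrow> card {v \<in> V. p v = p x} \<le> 2"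
    and D: "is_cycle R D" "set D \<subseteq> V" "length D = 4"
  shows "\<exists>C. set C \<subseteq> V \<and> length C = 6 \<and> (is_cycle R C \<or> is_cycle B C)"
proof (rule ccontr)
  assume no: "\<not> ?thesis"
  have dD: "distinct D" using D(1) by (simp add: is_cycle_def)
  obtain E where E: "set E = V - set D" "distinct E" using finite_distinct_list[of "V - set D"] fin by auto
  have "length E = 4"
    using distinct_card[OF E(2)] E(1) card_Diff_subset[OF _ D(2)] distinct_card[OF dD] D(3) V by simp
  then obtain u v w z where E': "E = [u, v, w, z]" by (auto simp: numeral_eq_Suc length_Suc_conv)
  have nonred: "\<not> (\<not> R u b \<and> \<not> R u d \<and> \<not> R v b \<and> \<not> R v d)"
    if c: "is_cycle R [a, b, c, d] \<and> set [a, b, c, d] = set D" and uv: "{u, v, w, z} = set E" "distinct [u, v, w, z]"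
    for a b c d u v w z
  proof
    assume non: "\<not> R u b \<and> \<not> R u d \<and> \<not> R v b \<and> \<not> R v d"
    define L where "L = [a, b, c, d, u, v, w, z]"
    define f where "f = (!) L"
    have dL: "distinct L" "set L = V" "length L = 8"
      using c E uv D(2) by (auto simp: L_def is_cycle_def)
    have f1: "inj_on f {..<8}" using inj_on_nth[OF dL(1), of "{..<8}"] dL(3) by (simp add: f_def)
    have f2: "f ` {..<8} \<subseteq> V" using nth_mem[of _ L] unfolding dL(2,3) by (auto simp: f_def)
    have fx: "f 0 = a" "f 1 = b" "f 2 = c" "f 3 = d" "f 4 = u" "f 5 = v" by (simp_all add: f_def L_def)
    have red: "R a b" "R b c" "R c d" "R a d" using c symR'[of d a] by (auto simp: is_cycle_def)
    have non': "\<not> R b u" "\<not> R d u" "\<not> R b v" "\<not> R d v" using non symR' by blast+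
    show False
      using mono_C6_of_labelled_C4[OF cls f1 f2] red non' no unfolding fx by blast
  qed
  have ins: "\<not> (R u a \<and> R u b)" if c: "is_cycle R [a, b, c, d] \<and> set [a, b, c, d] = set D" and u: "u \<in> set E"
    for a b c d u
  proof
    assume "R u a \<and> R u b"
    moreover have "u \<in> V" "u \<notin> set D" using E u by auto
    ultimately have "is_cycle R [a, u, b, c, d]" "set [a, u, b, c, d] \<subseteq> V"
      using c D(2) symR'[of u a] by (auto simp: is_cycle_def)
    then show False using mono_C6_of_C5[OF V cls, of "[a, u, b, c, d]"] no by simp
  qed
  obtain a b c d where abc: "D = [a, b, c, d]" using D(3) by (auto simp: numeral_eq_Suc length_Suc_conv)
  have rot: "is_cycle R [b, c, d, a] \<and> set [b, c, d, a] = set D"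
    if "is_cycle R [a, b, c, d] \<and> set [a, b, c, d] = set D" for a b c d
    using that by (auto simp: is_cycle_def)
  have c0: "is_cycle R [a, b, c, d] \<and> set [a, b, c, d] = set D" using D(1) abc by simp
  note c1 = rot[OF c0]
  note c2 = rot[OF c1]
  note c3 = rot[OF c2]
  have opp: "(\<not> R x b \<and> \<not> R x d) \<or> (\<not> R x a \<and> \<not> R x c)" if "x \<in> set E" for x
    using ins[OF c0 that] ins[OF c1 that] ins[OF c2 that] ins[OF c3 that] by blast
  have uvw: "{u, v, w, z} = set E \<and> distinct [u, v, w, z]" "{u, w, v, z} = set E \<and> distinct [u, w, v, z]"
    "{v, w, u, z} = set E \<and> distinct [v, w, u, z]"
    using E(2) E' by auto
  show False
    using nonred[OF c0 uvw(1)[THEN conjunct1] uvw(1)[THEN conjunct2]] nonred[OF c1 uvw(1)[THEN conjunct1] uvw(1)[THEN conjunct2]]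
      nonred[OF c0 uvw(2)[THEN conjunct1] uvw(2)[THEN conjunct2]] nonred[OF c1 uvw(2)[THEN conjunct1] uvw(2)[THEN conjunct2]]
      nonred[OF c0 uvw(3)[THEN conjunct1] uvw(3)[THEN conjunct2]] nonred[OF c1 uvw(3)[THEN conjunct1] uvw(3)[THEN conjunct2]]
      opp[of u] opp[of v] opp[of w] E'
    by auto
qed

lemma (in blowup) blowup_subset:
  assumes "V' \<subseteq> V"
  shows "blowup V' p R B"
proof
  show "finite V'" by (rule finite_subset[OF assms fin])
  show "symp R" by (rule symR)
  show "symp B" by (rule symB)
  show "R x y \<Longrightarrow> p x \<noteq> p y" for x y by (rule R_cls)
  show "B x y \<Longrightarrow> p x \<noteq> p y" for x y by (rule B_cls)
  fix x y assume xy: "x \<in> V'" "y \<in> V'"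
  then have xy': "x \<in> V" "y \<in> V" using assms by auto
  show "p x \<noteq> p y \<Longrightarrow> R x y \<or> B x y" by (rule dich[OF xy'])
  fix x' assume "x' \<in> V'"
  then have x': "x' \<in> V" using assms by auto
  show "p x = p y \<Longrightarrow> R x x' \<Longrightarrow> R y x'" by (rule twinR[OF xy' x'])
  show "p x = p y \<Longrightarrow> B x x' \<Longrightarrow> B y x'" by (rule twinB[OF xy' x'])
qed

lemma (in blowup) twin_C4:
  assumes "x \<in> V" "y \<in> V" "x' \<in> V" "y' \<in> V" "p x' = p x" "p y' = p y" "x \<noteq> x'" "y \<noteq> y'" "R x y"
  shows "is_cycle R [x, y, x', y']"
proof -
  have 1: "R x' y" using twinR[of x x' y] assms by simp
  have 2: "R y' x" using twinR[of y y' x] symR' assms by simp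
  have 3: "R y' x'" using twinR[of y y' x'] symR'[OF 1] assms by simp
  show ?thesis using assms 1 2 3 symR' R_cls[OF assms(9)] by (auto simp: is_cycle_def)
qed

text \<open>Six classes give a two-colored complete graph on six representatives. With fewer, two
  classes have two members each, and the edges between them form a monochromatic 4-cycle.\<close>

lemma (in blowup) mono_C4:
  assumes V: "card V = 8" and cls: "\<And>x. x \<in> V \<Longrightarrow> card {v \<in> V. p v = p x} \<le> 2"
  shows "\<exists>C. set C \<subseteq> V \<and> length C = 4 \<and> (is_cycle R C \<or> is_cycle B C)"
proof -
  have "\<forall>l\<in>p ` V. \<exists>v\<in>V. p v = l" by auto
  then obtain g where g: "\<And>l. l \<in> p ` V \<Longrightarrow> g l \<in> V \<and> p (g l) = l" by metis
  define S where "S = g ` p ` V"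
  have SV: "S \<subseteq> V" using g by (auto simp: S_def)
  have injS: "x = y" if "x \<in> S" "y \<in> S" "p x = p y" for x y using that g by (auto simp: S_def)
  show ?thesis
  proof (cases "6 \<le> card S")
    case True
    have "R x y \<or> B x y" if "x \<in> S" "y \<in> S" "x \<noteq> y" for x y
      using dich[of x y] injS[of x y] that SV by auto
    from mono_C4_of_six[OF symR symB True this] show ?thesis using SV by blast
  next
    case False
    then have "3 \<le> card (V - S)" using card_Diff_subset[OF finite_subset[OF SV fin] SV] V by simp
    then have "2 \<le> card (V - S)" by simp
    then obtain x y where xy: "x \<in> V - S" "y \<in> V - S" "x \<noteq> y" by (rule two_elements)
    define x' y' where "x' = g (p x)" and "y' = g (p y)"
    have tw: "x' \<in> V" "p x' = p x" "x' \<in> S" "y' \<in> V" "p y' = p y" "y' \<in> S"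
      using g[of "p x"] g[of "p y"] xy by (auto simp: x'_def y'_def S_def)
    have "p x \<noteq> p y"
    proof
      assume eq: "p x = p y"
      then have "{x, y, x'} \<subseteq> {v \<in> V. p v = p x}" using xy tw by auto
      then have "card {x, y, x'} \<le> card {v \<in> V. p v = p x}" using fin by (intro card_mono) auto
      moreover have "x' \<noteq> x" "x' \<noteq> y" using xy tw by auto
      then have "card {x, y, x'} = 3" using xy by simp
      ultimately show False using cls[of x] xy by simp
    qed
    then have "R x y \<or> B x y" using dich xy by auto
    moreover interpret sw: blowup V p B R by (rule swap)
    have "x \<noteq> x'" "y \<noteq> y'" using xy tw by auto
    ultimately have "is_cycle R [x, y, x', y'] \<or> is_cycle B [x, y, x', y']"
      using twin_C4[of x y x' y'] sw.twin_C4[of x y x' y'] xy tw by auto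
    then show ?thesis using xy tw by (intro exI[of _ "[x, y, x', y']"]) auto
  qed
qed

lemma (in blowup) mono_C6:
  assumes V: "card V = 8" and cls: "\<And>x. x \<in> V \<Longrightarrow> card {v \<in> V. p v = p x} \<le> 2"
  shows "\<exists>C. set C \<subseteq> V \<and> length C = 6 \<and> (is_cycle R C \<or> is_cycle B C)"
proof -
  interpret sw: blowup V p B R by (rule swap)
  obtain D where D: "set D \<subseteq> V" "length D = 4" "is_cycle R D \<or> is_cycle B D" using mono_C4[OF assms] by blast
  then show ?thesis using mono_C6_of_C4[OF assms _ D(1,2)] sw.mono_C6_of_C4[OF assms _ D(1,2)] by blast
qed

section \<open>The two-color theorem for blow-ups, by induction on n\<close>

theorem blowup_ramsey:
  assumes "3 \<le> n" "blowup V p R B" "card V = 3 * n - 1" "\<And>x. x \<in> V \<Longrightarrow> card {v \<in> V. p v = p x} \<le> n - 1"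
  shows "\<exists>C. set C \<subseteq> V \<and> length C = 2 * n \<and> (is_cycle R C \<or> is_cycle B C)"
  using assms
proof (induction n arbitrary: V rule: nat_induct_at_least)
  case base
  then interpret blowup V p R B by simp
  show ?case using mono_C6 base by simp
next
  case (Suc n)
  interpret blowup V p R B by (rule Suc.prems)
  define \<Lambda> where "\<Lambda> = {l \<in> p ` V. card {v \<in> V. p v = l} = n}"
  have f\<Lambda>: "finite \<Lambda>" using fin by (simp add: \<Lambda>_def)
  have "card \<Lambda> * n = (\<Sum>l\<in>\<Lambda>. card {v \<in> V. p v = l})" by (simp add: \<Lambda>_def)
  also have "\<dots> = card (\<Union>l\<in>\<Lambda>. {v \<in> V. p v = l})"
    by (rule card_UN_disjoint[symmetric]) (use f\<Lambda> fin in auto)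
  also have "\<dots> \<le> card V" using fin by (intro card_mono) auto
  finally have "card \<Lambda> * n \<le> 3 * n + 2" using Suc.prems by simp
  \<comment> \<open>Four classes of size n do not fit into 3n + 2 vertices, so three vertices meet
    all of them; removing these leaves 3n - 1.\<close>
  then have "card \<Lambda> * n < 4 * n" using Suc.hyps by linarith
  then have c3: "card \<Lambda> \<le> 3" by simp
  have "\<forall>l\<in>\<Lambda>. \<exists>v\<in>V. p v = l" by (auto simp: \<Lambda>_def)
  then obtain g where g: "\<And>l. l \<in> \<Lambda> \<Longrightarrow> g l \<in> V \<and> p (g l) = l" by metis
  have "card (g ` \<Lambda>) \<le> 3" using card_image_le[OF f\<Lambda>, of g] c3 by linarith
  moreover have "3 \<le> card V" using Suc by simp
  moreover have "g ` \<Lambda> \<subseteq> V" using g by auto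
  ultimately obtain X where X: "g ` \<Lambda> \<subseteq> X" "X \<subseteq> V" "card X = 3"
    using exists_subset_between[of "g ` \<Lambda>" 3 V] fin by blast
  have "\<exists>C. set C \<subseteq> V - X \<and> length C = 2 * n \<and> (is_cycle R C \<or> is_cycle B C)"
  proof (rule Suc.IH)
    show "blowup (V - X) p R B" by (rule blowup_subset) auto
    show "card (V - X) = 3 * n - 1" using card_Diff_subset[OF finite_subset[OF X(2) fin] X(2)] X Suc by simp
    show "card {v \<in> V - X. p v = p x} \<le> n - 1" if x: "x \<in> V - X" for x
    proof (cases "p x \<in> \<Lambda>")
      case True
      then have "g (p x) \<in> X" "p (g (p x)) = p x" "g (p x) \<in> V" using g X by auto
      then have "{v \<in> V - X. p v = p x} \<subset> {v \<in> V. p v = p x}" by auto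
      then have "card {v \<in> V - X. p v = p x} < card {v \<in> V. p v = p x}" using fin by (intro psubset_card_mono) auto
      then show ?thesis using True by (simp add: \<Lambda>_def)
    next
      case False
      then have "card {v \<in> V. p v = p x} \<noteq> n" using x by (auto simp: \<Lambda>_def)
      moreover have "card {v \<in> V. p v = p x} \<le> n" using Suc.prems(3)[of x] x by simp
      moreover have "card {v \<in> V - X. p v = p x} \<le> card {v \<in> V. p v = p x}" using fin by (intro card_mono) auto
      ultimately show ?thesis by linarith
    qed
  qed
  then obtain C where C: "set C \<subseteq> V" "length C = 2 * Suc n - 2" "is_cycle R C \<or> is_cycle B C" by auto
  show ?case
  proof (rule ccontr)
    assume no: "\<not> ?case"
    interpret critical_blowup V p R B "Suc n"
    proof unfold_locales
      show "4 \<le> Suc n" "card V = 3 * Suc n - 1" using Suc by auto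
      show "card {v \<in> V. p v = p x} \<le> Suc n - 1" if "x \<in> V" for x using Suc.prems(3)[OF that] .
      show "length C \<noteq> 2 * Suc n" if "is_cycle R C" "set C \<subseteq> V" for C using that no by blast
      show "length C \<noteq> 2 * Suc n" if "is_cycle B C" "set C \<subseteq> V" for C using that no by blast
    qed
    show False using no_cycle[OF C(1,2)] C(3) by blast
  qed
qed

section \<open>Gallai colorings\<close>

locale gallai =
  fixes A :: "'a set" and col :: "'a \<Rightarrow> 'a \<Rightarrow> nat"
  assumes finA: "finite A" and col_sym: "col x y = col y x"
    and no_rainbow: "x \<in> A \<Longrightarrow> y \<in> A \<Longrightarrow> z \<in> A \<Longrightarrow> x \<noteq> y \<Longrightarrow> y \<noteq> z \<Longrightarrow> x \<noteq> z \<Longrightarrow>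
       col x y = col y z \<or> col y z = col x z \<or> col x y = col x z"
begin

definition edge_rel :: "nat set \<Rightarrow> ('a \<times> 'a) set" where
  "edge_rel P = {(x, y). x \<in> A \<and> y \<in> A \<and> x \<noteq> y \<and> col x y \<in> P}"

definition comp :: "nat set \<Rightarrow> 'a \<Rightarrow> 'a set" where
  "comp P y = {z. (y, z) \<in> (edge_rel P)\<^sup>*}"

text \<open>A certificate that the colors in \<open>P\<close> together do not connect
  \<open>A\<close>.\<close>

definition cut :: "nat set \<Rightarrow> 'a set \<Rightarrow> bool" where
  "cut P X \<longleftrightarrow> X \<noteq> {} \<and> X \<subset> A \<and> (\<forall>x\<in>X. \<forall>y\<in>A - X. col x y \<notin> P)"

lemma comp_refl: "y \<in> comp P y"
  by (simp add: comp_def)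

lemma comp_sub: "y \<in> A \<Longrightarrow> comp P y \<subseteq> A"
proof
  fix z assume y: "y \<in> A" and "z \<in> comp P y"
  then have "(y, z) \<in> (edge_rel P)\<^sup>*" by (simp add: comp_def)
  then show "z \<in> A" using y by (induction rule: rtrancl_induct) (auto simp: edge_rel_def)
qed

lemma comp_sym: "z \<in> comp P y \<Longrightarrow> y \<in> comp P z"
proof -
  have "sym (edge_rel P)" by (auto simp: sym_def edge_rel_def col_sym)
  then have "sym ((edge_rel P)\<^sup>*)" by (rule sym_rtrancl)
  then show "z \<in> comp P y \<Longrightarrow> y \<in> comp P z" by (auto simp: comp_def dest: symD)
qed

lemma comp_eq: "z \<in> comp P y \<Longrightarrow> comp P z = comp P y"
  using comp_sym[of z P y] by (auto simp: comp_def intro: rtrancl_trans)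

lemma comp_edge: "y \<in> A \<Longrightarrow> z \<in> A \<Longrightarrow> z \<notin> comp P y \<Longrightarrow> col y z \<notin> P"
  using comp_refl[of y P] by (auto simp: comp_def edge_rel_def)

lemma comp_edge': "y \<in> A \<Longrightarrow> y1 \<in> comp P y \<Longrightarrow> z \<in> A \<Longrightarrow> z \<notin> comp P y \<Longrightarrow> col y1 z \<notin> P"
  using comp_edge[of y1 z P] comp_eq[of y1 P y] comp_sub[of y P] by auto

text \<open>Along an edge \<open>u w\<close> with color in \<open>P\<close>, neither
  \<open>z u\<close> nor \<open>z w\<close> has a color in \<open>P\<close>; they agree, or the
  triangle would be rainbow.\<close>

lemma comp_module:
  assumes y: "y \<in> A" and z: "z \<in> A" "z \<notin> comp P y" and y1: "y1 \<in> comp P y"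
  shows "col z y1 = col z y"
proof -
  have "(y, y1) \<in> (edge_rel P)\<^sup>*" using y1 by (simp add: comp_def)
  then show ?thesis
  proof (induction rule: rtrancl_induct)
    case (step u w)
    have u: "u \<in> comp P y" "w \<in> comp P y" using step.hyps by (auto simp: comp_def)
    have "u \<in> A" "w \<in> A" "u \<noteq> w" "col u w \<in> P" using step.hyps by (auto simp: edge_rel_def)
    moreover have "z \<noteq> u" "z \<noteq> w" "col z u \<notin> P" "col z w \<notin> P"
      using comp_edge'[OF y u(1) z] comp_edge'[OF y u(2) z] u z col_sym by auto
    ultimately have "col z w = col z u" using no_rainbow[of z u w] z by metis
    then show ?case using step.IH by simp
  qed simp
qed

lemma comp_cut:
  assumes "cut P X" "y \<in> A"
  shows "comp P y \<noteq> A"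
proof -
  have *: "z \<in> X \<longleftrightarrow> y \<in> X" if "z \<in> comp P y" for z
  proof -
    have "(y, z) \<in> (edge_rel P)\<^sup>*" using that by (simp add: comp_def)
    then show ?thesis
    proof (induction rule: rtrancl_induct)
      case (step u w)
      have "u \<in> A" "w \<in> A" "col u w \<in> P" "col w u \<in> P" using step.hyps col_sym[of u w] by (auto simp: edge_rel_def)
      then show ?case using step.IH assms(1) by (auto simp: cut_def)
    qed simp
  qed
  then show ?thesis using assms(1) by (auto simp: cut_def)
qed

lemma cut_comp:
  assumes "y \<in> A" "comp P y \<noteq> A"
  shows "cut P (comp P y)"
  using assms comp_sub[of y P] comp_refl[of y P] comp_edge' by (auto simp: cut_def)

end

text \<open>At most two colors of a Gallai coloring are connected. If deleting \<open>v\<close> disconnects the color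
  \<open>d\<close> but none of \<open>d\<close>, \<open>e\<close>, \<open>e'\<close> is disconnected, then a component with an \<open>e\<close>-edge to \<open>v\<close> sees
  all other components in color \<open>e\<close>, and likewise for \<open>e'\<close>.\<close>

lemma gallai_three_colors:
  assumes "gallai A col" "2 \<le> card A" "card D = 3"
  shows "\<exists>d\<in>D. \<exists>X. gallai.cut A col {d} X"
  using assms
proof (induction "card A" arbitrary: A rule: less_induct)
  case less
  interpret gallai A col by (rule less.prems)
  have fD: "finite D" using less.prems(3) by (intro card_ge_0_finite) simp
  show ?case
  proof (cases "card A = 2")
    case True
    then obtain a b where ab: "A = {a, b}" "a \<noteq> b" by (meson card_2_iff)
    have "D - {col a b} \<noteq> {}" using less.prems(3) fD card_mono[of "{col a b}" D] by auto
    then obtain d where "d \<in> D" "d \<noteq> col a b" by blast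
    then have "cut {d} {a}" unfolding cut_def using ab by auto
    then show ?thesis using \<open>d \<in> D\<close> by blast
  next
    case False
    obtain v where v: "v \<in> A" using less.prems(2) by fastforce
    define A' where "A' = A - {v}"
    have cA': "card A' < card A" "2 \<le> card A'" using v finA False less.prems(2) by (auto simp: A'_def)
    interpret G: gallai A' col
      using finA col_sym no_rainbow by unfold_locales (auto simp: A'_def)
    obtain d X where d: "d \<in> D" "G.cut {d} X" using less.hyps[OF cA'(1) _ cA'(2) less.prems(3)] G.gallai_axioms by blast
    have "card (D - {d}) = 2" using d(1) less.prems(3) fD by simp
    then obtain e e' where e: "e \<in> D" "e' \<in> D" "e \<noteq> e'" "e \<noteq> d" "e' \<noteq> d" by (metis DiffE card_2_iff insertCI)
    show ?thesis
    proof (rule ccontr)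
      assume no: "\<not> ?thesis"
      \<comment> \<open>A component without a \<open>d\<close>-edge to \<open>v\<close> would be a
        cut of all of \<open>A\<close>.\<close>
      have ex: "\<exists>x\<in>G.comp {d} z. col v x = d" if z: "z \<in> A'" for z
      proof (rule ccontr)
        assume "\<not> ?thesis"
        moreover have "G.cut {d} (G.comp {d} z)" using G.cut_comp G.comp_cut[OF d(2) z] z by blast
        ultimately have "cut {d} (G.comp {d} z)"
          using v unfolding G.cut_def cut_def by (auto simp: A'_def col_sym)
        then show False using no d by blast
      qed
      \<comment> \<open>Take \<open>x\<close> in the component of \<open>z\<close> with a
        \<open>d\<close>-edge to \<open>v\<close>. The edge \<open>x y\<close> does not have color
        \<open>d\<close>, so the triangle with \<open>v\<close> gives it the color of
        \<open>v y\<close>, and the whole component sees \<open>y\<close> in one color.\<close>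
      have see: "col z y = col v y" if y: "y \<in> A'" "col v y \<noteq> d" and z: "z \<in> A'" "z \<notin> G.comp {d} y" for y z
      proof -
        obtain x where x: "x \<in> G.comp {d} z" "col v x = d" using ex[OF z(1)] by blast
        have xA: "x \<in> A'" using x G.comp_sub z by blast
        have yz: "y \<notin> G.comp {d} z" using G.comp_sym z(2) by blast
        have "col x y \<noteq> d" using G.comp_edge'[OF z(1) x(1) y(1) yz] by simp
        moreover have "x \<noteq> y" using x yz by auto
        ultimately have "col x y = col v y"
          using no_rainbow[of v x y] v xA y x(2) unfolding A'_def by auto
        then show ?thesis using G.comp_module[OF z(1) y(1) yz x(1)] col_sym by metis
      qed
      have edge: "\<exists>y\<in>A'. col v y = c" if "c \<in> D" for c
      proof (rule ccontr)
        assume "\<not> ?thesis"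
        then have "cut {c} {v}" using v less.prems(2) by (auto simp: cut_def A'_def)
        then show False using no that by blast
      qed
      obtain y y' where y: "y \<in> A'" "col v y = e" "y' \<in> A'" "col v y' = e'" using edge e by blast
      show False
      proof (cases "y' \<in> G.comp {d} y")
        case False
        then have "y \<notin> G.comp {d} y'" using G.comp_sym by blast
        then show False using see[of y y'] see[of y' y] False y e col_sym by metis
      next
        case True
        obtain z where z: "z \<in> A'" "z \<notin> G.comp {d} y"
          using G.comp_cut[OF d(2) y(1)] G.comp_sub[OF y(1), of "{d}"] by auto
        then have "z \<notin> G.comp {d} y'" using G.comp_eq[OF True] by simp
        then show False using see[of y z] see[of y' z] G.comp_module[OF y(1) z True] y z e by metis
      qed
    qed
  qed
qed

text \<open>Let \<open>W\<close> be a maximal set of colors that does not connect \<open>A\<close>.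
  If three colors were left, one of them would fail to connect the quotient by the components of
  \<open>W\<close>, and its cut there would lift to a cut for \<open>insert d W\<close>.\<close>

lemma (in gallai) two_colors:
  assumes A2: "2 \<le> card A" and K: "finite K" "2 \<le> card K" and colK: "\<And>x y. x \<in> A \<Longrightarrow> y \<in> A \<Longrightarrow> x \<noteq> y \<Longrightarrow> col x y \<in> K"
  shows "\<exists>r b X. r \<in> K \<and> b \<in> K \<and> r \<noteq> b \<and> cut (- {r, b}) X"
proof -
  define F where "F = {W. W \<subseteq> K \<and> (\<exists>X. cut W X)}"
  have "finite F" using K by (auto simp: F_def)
  obtain a where a: "a \<in> A" using A2 by fastforce
  have "{a} \<noteq> A" using A2 by auto
  then have "cut {} {a}" using a by (auto simp: cut_def)
  then have "{} \<in> F" by (auto simp: F_def)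
  then obtain W where W: "W \<in> F" "\<And>W'. W' \<in> F \<Longrightarrow> W \<subseteq> W' \<Longrightarrow> W' = W"
    using finite_has_maximal[OF \<open>finite F\<close>] by (metis empty_iff)
  then obtain X where X: "cut W X" "W \<subseteq> K" by (auto simp: F_def)
  show ?thesis
  proof (cases "card (K - W) \<le> 2")
    case True
    \<comment> \<open>If fewer than two colors are left, colors from \<open>W\<close> fill up the
      pair.\<close>
    then obtain M where M: "K - W \<subseteq> M" "M \<subseteq> K" "card M = 2"
      using exists_subset_between[of "K - W" 2 K] K by blast
    then obtain r b where rb: "M = {r, b}" "r \<noteq> b" by (meson card_2_iff)
    have "cut (- {r, b}) X"
      unfolding cut_def
    proof (intro conjI ballI)
      fix x y assume xy: "x \<in> X" "y \<in> A - X"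
      then have "x \<in> A" "x \<noteq> y" "col x y \<notin> W" using X by (auto simp: cut_def)
      then show "col x y \<notin> - {r, b}" using colK[of x y] xy M rb by auto
    qed (use X in \<open>auto simp: cut_def\<close>)
    then show ?thesis using rb M by blast
  next
    case False
    then obtain D where D: "D \<subseteq> K - W" "card D = 3"
      using obtain_subset_with_card_n[of 3 "K - W"] by auto
    \<comment> \<open>One representative for each component of \<open>W\<close>. Components see each
      other in a single color, so the representatives form the quotient.\<close>
    define g where "g y = (SOME z. z \<in> comp W y)" for y
    have g: "g y \<in> comp W y" for y unfolding g_def by (rule someI[of _ y]) (rule comp_refl)
    have g_eq: "g x = g y" if "x \<in> comp W y" for x y using comp_eq[OF that] by (simp add: g_def)
    define T where "T = g ` A"
    have TA: "T \<subseteq> A" using g comp_sub by (auto simp: T_def)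
    have TT: "g t = t" if "t \<in> T" for t using that g_eq[OF g] by (auto simp: T_def)
    interpret G: gallai T col
      by unfold_locales (use finite_subset[OF TA finA] col_sym no_rainbow TA in blast)+
    have "2 \<le> card T"
    proof -
      obtain z where z: "z \<in> A" "z \<notin> comp W a" using comp_cut[OF X(1) a] comp_sub[OF a, of W] by auto
      have "g a \<noteq> g z"
        using z(2) comp_eq[OF g[of a]] comp_eq[OF g[of z]] comp_refl[of z W] by metis
      then have "card {g a, g z} = 2" by simp
      then show ?thesis using card_mono[of T "{g a, g z}"] a z finA by (auto simp: T_def)
    qed
    then obtain d Y where d: "d \<in> D" "G.cut {d} Y" using gallai_three_colors[OF G.gallai_axioms _ D(2)] by blast
    have YT: "Y \<noteq> {}" "Y \<subset> T" using d(2) by (auto simp: G.cut_def)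
    define X' where "X' = {x \<in> A. g x \<in> Y}"
    have "cut (insert d W) X'"
      unfolding cut_def
    proof (intro conjI ballI)
      show "X' \<noteq> {}" using YT TA TT by (force simp: X'_def)
      obtain t where "t \<in> T" "t \<notin> Y" using YT by auto
      then show "X' \<subset> A" using TA TT by (force simp: X'_def)
      fix x y assume x: "x \<in> X'" and y: "y \<in> A - X'"
      have xy: "x \<in> A" "y \<in> A" "g x \<in> Y" "g y \<in> T - Y" using x y by (auto simp: X'_def T_def)
      have ne: "g x \<noteq> g y" using xy by auto
      have n1: "y \<notin> comp W x" using g_eq ne by metis
      have n2: "g x \<notin> comp W y" using comp_sym comp_eq[OF g[of x]] n1 comp_eq by metis
      have "col y (g x) = col y x" using comp_module[OF xy(1,2) n1 g] .
      moreover have "col (g x) (g y) = col (g x) y"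
        using comp_module[OF xy(2) _ n2 g] TA YT xy by auto
      moreover have "col (g x) (g y) \<noteq> d" using d(2) xy by (auto simp: G.cut_def)
      ultimately have "col x y \<noteq> d" using col_sym by metis
      moreover have "col x y \<notin> W" using comp_edge[OF xy(1,2) n1] .
      ultimately show "col x y \<notin> insert d W" by simp
    qed
    then have "insert d W \<in> F" using X d D by (auto simp: F_def)
    then have "insert d W = W" using W(2) by blast
    then show ?thesis using d D by auto
  qed
qed

section \<open>The upper bound\<close>

lemma exists_subset_cycle_complete_bipartite:
  assumes sym: "symp R" and L: "finite L" "2 \<le> card L" and T: "finite T" "card T = card L" and disj: "L \<inter> T = {}"
    and R: "\<And>x y. x \<in> L \<Longrightarrow> y \<in> T \<Longrightarrow> R x y"
  shows "\<exists>C. set C \<subseteq> L \<union> T \<and> length C = 2 * card L \<and> is_cycle R C"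
proof -
  have "{y \<in> T. R x y} = T" if "x \<in> L" for x using R[OF that] by auto
  then obtain C where C: "is_cycle (bip R L T) C" "length C = 2 * card L"
    using jackson[OF sym L(1) T(1) disj L(2), of "card L"] L(2) T(2) by auto
  then show ?thesis using bip_cycle_subset[OF C(1)] bip_cycle_is_cycle[OF C(1)] by blast
qed

context gallai
begin

lemma subset_gallai: "A' \<subseteq> A \<Longrightarrow> gallai A' col"
proof
  assume sub: "A' \<subseteq> A"
  show "finite A'" by (rule finite_subset[OF sub finA])
  show "col x y = col y x" for x y by (rule col_sym)
  show "col x y = col y z \<or> col y z = col x z \<or> col x y = col x z"
    if "x \<in> A'" "y \<in> A'" "z \<in> A'" "x \<noteq> y" "y \<noteq> z" "x \<noteq> z" for x y z
    using no_rainbow[of x y z] that sub by blast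
qed

lemma comp_within:
  assumes "x \<in> Y" "\<And>y z. y \<in> Y \<Longrightarrow> z \<in> A - Y \<Longrightarrow> col y z \<notin> P"
  shows "comp P x \<subseteq> Y"
proof
  fix z assume "z \<in> comp P x"
  then have "(x, z) \<in> (edge_rel P)\<^sup>*" by (simp add: comp_def)
  then show "z \<in> Y"
  proof (induction rule: rtrancl_induct)
    case (step u w)
    then show ?case using assms(2)[of u w] by (auto simp: edge_rel_def)
  qed (rule assms(1))
qed

text \<open>The relation \<open>E\<close> drops edges inside a component even if their color is
  \<open>r\<close> or \<open>b\<close>, as a blow-up has no edges within classes; twins come from
  \<open>comp_module\<close>.\<close>

lemma comp_blowup:
  fixes r b :: nat
  defines "E i x y \<equiv> x \<in> A \<and> y \<in> A \<and> y \<notin> comp (- {r, b}) x \<and> col x y = i"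
  shows "blowup A (comp (- {r, b})) (E r) (E b)"
proof -
  let ?p = "comp (- {r, b})"
  have mem: "y \<in> ?p x \<longleftrightarrow> ?p x = ?p y" for x y using comp_eq comp_refl by blast
  have sym: "symp (E i)" for i using comp_sym col_sym by (auto simp: symp_def E_def)
  have tw: "E i x' y" if "x \<in> A" "x' \<in> A" "y \<in> A" "?p x = ?p x'" "E i x y" for i x x' y
    using comp_module[of x y "- {r, b}" x'] that mem[of x' x] mem[of y x] mem[of y x'] col_sym
    unfolding E_def by metis
  show ?thesis
  proof
    show "?p x \<noteq> ?p y \<Longrightarrow> E r x y \<or> E b x y" if "x \<in> A" "y \<in> A" for x y
      using comp_edge[OF that] that mem by (auto simp: E_def)
  qed (use finA sym tw in \<open>auto simp: E_def mem\<close>)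
qed

definition is_module :: "'a set \<Rightarrow> bool" where
  "is_module M \<longleftrightarrow> M \<subseteq> A \<and> (\<forall>v\<in>A - M. \<forall>x\<in>M. \<forall>y\<in>M. col v x = col v y)"

text \<open>Take a minimal module \<open>M\<close> with at least \<open>n\<close> vertices and two colors \<open>r\<close>, \<open>b\<close> whose complement does
  not connect \<open>M\<close>. Each of the at most \<open>k - 2\<close> other colors joins at most \<open>n - 1\<close> vertices to \<open>M\<close>;
  deleting them leaves a blow-up of an \<open>r\<close>-\<open>b\<close>-coloring whose classes within \<open>M\<close> are modules.\<close>

theorem exists_mono_even_cycle:
  assumes n: "2 \<le> n" and K: "finite K" "2 \<le> card K"
    and colK: "\<And>x y. x \<in> A \<Longrightarrow> y \<in> A \<Longrightarrow> x \<noteq> y \<Longrightarrow> col x y \<in> K"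
    and cardA: "(card K - 2) * (n - 1) + (if n = 2 then 6 else 3 * n - 1) \<le> card A"
  shows "\<exists>i C. set C \<subseteq> A \<and> length C = 2 * n \<and> is_cycle (\<lambda>x y. col x y = i) C"
proof (rule ccontr)
  assume no: "\<not> ?thesis"
  have nA: "n \<le> card A" using cardA n by (auto split: if_splits)
  then have "is_module A \<and> n \<le> card A" by (simp add: is_module_def)
  then have "\<exists>M. (is_module M \<and> n \<le> card M) \<and> (\<forall>M'. is_module M' \<and> n \<le> card M' \<longrightarrow> card M \<le> card M')"
    by (rule ex_has_least_nat)
  then obtain M where M: "is_module M" "n \<le> card M"
    and least: "\<And>M'. is_module M' \<Longrightarrow> n \<le> card M' \<Longrightarrow> card M \<le> card M'" by blast
  have MA: "M \<subseteq> A" and finM: "finite M" using M(1) finA by (auto simp: is_module_def intro: finite_subset)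
  obtain m where m: "m \<in> M" using M(2) n by fastforce
  define S where "S i = {v \<in> A - M. \<forall>a\<in>M. col v a = i}" for i
  have finS: "finite (S i)" for i using finA by (simp add: S_def)
  have cS: "card (S i) \<le> n - 1" for i
  proof (rule ccontr)
    assume "\<not> ?thesis"
    then have "n \<le> card (S i)" by linarith
    then obtain T where T: "T \<subseteq> S i" "card T = n" by (rule obtain_subset_with_card_n)
    obtain L where L: "L \<subseteq> M" "card L = n" by (rule obtain_subset_with_card_n[OF M(2)])
    have "\<exists>C. set C \<subseteq> L \<union> T \<and> length C = 2 * card L \<and> is_cycle (\<lambda>x y. col x y = i) C"
    proof (rule exists_subset_cycle_complete_bipartite)
      show "symp (\<lambda>x y. col x y = i)" using col_sym by (auto simp: symp_def)
      show "finite L" "finite T" using finite_subset[OF L(1) finM] finite_subset[OF T(1) finS] by auto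
      show "2 \<le> card L" "card T = card L" using n L T by auto
      show "L \<inter> T = {}" using L T by (auto simp: S_def)
      show "col x y = i" if "x \<in> L" "y \<in> T" for x y using that L T col_sym[of x y] by (auto simp: S_def)
    qed
    moreover have "L \<union> T \<subseteq> A" using L T MA by (auto simp: S_def)
    ultimately show False using no L(2) by blast
  qed
  have AS: "v \<in> S (col v m) \<and> col v m \<in> K" if "v \<in> A - M" for v
  proof -
    have "\<forall>a\<in>M. col v a = col v m" using M(1) that m unfolding is_module_def by blast
    then have "v \<in> S (col v m)" using that unfolding S_def by blast
    moreover have "v \<noteq> m" "m \<in> A" using that m MA by auto
    ultimately show ?thesis using colK[of v m] that by blast
  qed
  interpret GM: gallai M col by (rule subset_gallai[OF MA])
  have "2 \<le> card M" using M(2) n by simp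
  moreover have "col x y \<in> K" if "x \<in> M" "y \<in> M" "x \<noteq> y" for x y using colK[of x y] that MA by blast
  ultimately obtain r b X where rb: "r \<in> K" "b \<in> K" "r \<noteq> b" and X: "GM.cut (- {r, b}) X"
    using GM.two_colors[OF _ K] by blast
  have X': "X \<noteq> {}" "X \<subset> M" "\<And>x y. x \<in> X \<Longrightarrow> y \<in> M - X \<Longrightarrow> col x y \<in> {r, b}"
    using X unfolding GM.cut_def by auto
  define W where "W = M \<union> S r \<union> S b"
  have WA: "W \<subseteq> A" using MA by (auto simp: W_def S_def)
  have "A - W \<subseteq> (\<Union>i\<in>K - {r, b}. S i)" using AS by (fastforce simp: W_def)
  then have "card (A - W) \<le> card (\<Union>i\<in>K - {r, b}. S i)" using K finS by (intro card_mono) auto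
  also have "\<dots> \<le> (\<Sum>i\<in>K - {r, b}. card (S i))" using K by (intro card_UN_le) auto
  also have "\<dots> \<le> (\<Sum>i\<in>K - {r, b}. n - 1)" by (intro sum_mono cS)
  also have "\<dots> = (card K - 2) * (n - 1)" using rb K by (simp add: card_Diff_subset numeral_2_eq_2)
  finally have "card (A - W) \<le> (card K - 2) * (n - 1)" .
  moreover have "card (A - W) = card A - card W" using card_Diff_subset[OF finite_subset[OF WA finA] WA] .
  ultimately have cW: "(if n = 2 then 6 else 3 * n - 1) \<le> card W" using cardA by linarith
  interpret H: gallai W col by (rule subset_gallai[OF WA])
  let ?p = "H.comp (- {r, b})"
  have SM: "col x y = i" "col y x = i" if "x \<in> S i" "y \<in> M" for x y i using that col_sym[of x y] by (auto simp: S_def)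
  have Srb: "col x y \<in> {r, b}" if "x \<in> S r" "y \<in> S b" for x y
  proof -
    have "col x m = r" "col y m = b" using SM[OF that(1) m] SM[OF that(2) m] by auto
    moreover have "x \<in> A" "y \<in> A" "x \<noteq> m" "y \<noteq> m" using that m by (auto simp: S_def)
    moreover have "m \<in> A" using m MA by blast
    ultimately show ?thesis using no_rainbow[of x y m] rb(3) by (cases "x = y") auto
  qed
  have Srb': "col y x \<in> {r, b}" if "x \<in> S r" "y \<in> S b" for x y using Srb[OF that] col_sym[of x y] by simp
  have cls: "card (?p x) \<le> n - 1" if x: "x \<in> W" for x
  proof -
    consider "x \<in> S r" | "x \<in> S b" | "x \<in> M" using x by (auto simp: W_def)
    then show ?thesis
    proof cases
      case 1
      have "col y z \<notin> - {r, b}" if "y \<in> S r" "z \<in> W - S r" for y z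
        using that SM(1)[of y r z] Srb[of y z] by (auto simp: W_def)
      with 1 have "?p x \<subseteq> S r" by (rule H.comp_within)
      then show ?thesis using card_mono[OF finS] cS le_trans by blast
    next
      case 2
      have "col y z \<notin> - {r, b}" if "y \<in> S b" "z \<in> W - S b" for y z
        using that SM(1)[of y b z] Srb'[of z y] by (auto simp: W_def)
      with 2 have "?p x \<subseteq> S b" by (rule H.comp_within)
      then show ?thesis using card_mono[OF finS] cS le_trans by blast
    next
      case 3
      \<comment> \<open>The side of the cut containing \<open>x\<close>: it confines the class of
        \<open>x\<close> to a proper part of \<open>M\<close>.\<close>
      define Y where "Y = (if x \<in> X then X else M - X)"
      have Y: "x \<in> Y" "Y \<subset> M" using X'(1,2) 3 by (auto simp: Y_def)
      have "?p x \<subseteq> Y"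
      proof (rule H.comp_within[OF Y(1)])
        fix y z assume y: "y \<in> Y" and z: "z \<in> W - Y"
        show "col y z \<notin> - {r, b}"
        proof (cases "z \<in> M")
          case True
          then show ?thesis using y z X'(3)[of y z] X'(3)[of z y] col_sym[of y z] by (auto simp: Y_def split: if_splits)
        next
          case False
          then show ?thesis using z SM(2)[of z _ y] y Y(2) by (auto simp: W_def)
        qed
      qed
      then have pM: "?p x \<subset> M" using Y by blast
      \<comment> \<open>A vertex in \<open>W\<close> outside the component sees it in one color, and
        a vertex outside \<open>W\<close> even sees all of \<open>M\<close> in one color. By the
        choice of \<open>M\<close> this smaller module has fewer than n vertices.\<close>
      have "is_module (?p x)"
        unfolding is_module_def
      proof (intro conjI ballI)
        fix v y z assume v: "v \<in> A - ?p x" and y: "y \<in> ?p x" and z: "z \<in> ?p x"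
        show "col v y = col v z"
        proof (cases "v \<in> W")
          case True
          then show ?thesis using H.comp_module[OF x True _ y] H.comp_module[OF x True _ z] v by simp
        next
          case False
          then have "v \<in> A - M" using v by (auto simp: W_def)
          then show ?thesis using M(1) y z pM unfolding is_module_def by blast
        qed
      qed (use pM MA in blast)
      then have "card M \<le> card (?p x)" if "n \<le> card (?p x)" using least that by blast
      moreover have "card (?p x) < card M" using psubset_card_mono[OF finM pM] .
      ultimately show ?thesis by linarith
    qed
  qed
  define E where "E i x y \<longleftrightarrow> x \<in> W \<and> y \<in> W \<and> y \<notin> ?p x \<and> col x y = i" for i x y
  obtain V where V: "V \<subseteq> W" "card V = (if n = 2 then 6 else 3 * n - 1)" by (rule obtain_subset_with_card_n[OF cW])
  interpret bl: blowup W ?p "E r" "E b" using H.comp_blowup[of r b] unfolding E_def by simp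
  interpret blV: blowup V ?p "E r" "E b" by (rule bl.blowup_subset[OF V(1)])
  have clV: "card {v \<in> V. ?p v = ?p x} \<le> n - 1" if "x \<in> V" for x
  proof -
    have "{v \<in> V. ?p v = ?p x} \<subseteq> ?p x" using H.comp_refl by blast
    moreover have "finite (?p x)" using H.comp_sub[of x] V(1) that finite_subset[OF WA finA] finite_subset by blast
    ultimately have "card {v \<in> V. ?p v = ?p x} \<le> card (?p x)" by (intro card_mono)
    then show ?thesis using cls[of x] that V(1) by force
  qed
  have "\<exists>C. set C \<subseteq> V \<and> length C = 2 * n \<and> (is_cycle (E r) C \<or> is_cycle (E b) C)"
  proof (cases "n = 2")
    \<comment> \<open>Classes are single vertices, which leaves an ordinary two-colored complete
      graph on six vertices.\<close>
    case True
    have "E r x y \<or> E b x y" if "x \<in> V" "y \<in> V" "x \<noteq> y" for x y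
    proof (rule blV.dich[OF that(1,2)], rule)
      assume "?p x = ?p y"
      then have "{x, y} \<subseteq> {v \<in> V. ?p v = ?p x}" using that by auto
      then have "card {x, y} \<le> card {v \<in> V. ?p v = ?p x}" using blV.fin by (intro card_mono) auto
      then show False using clV[OF that(1)] that(3) True by simp
    qed
    then show ?thesis using mono_C4_of_six[OF blV.symR blV.symB, of V] V(2) True by simp
  next
    case False
    then show ?thesis using blowup_ramsey[OF _ blV.blowup_axioms _ clV] V(2) n by simp
  qed
  then obtain C i where C: "set C \<subseteq> V" "length C = 2 * n" "is_cycle (E i) C" by blast
  have "is_cycle (\<lambda>x y. col x y = i) C" by (rule is_cycle_mono[OF C(3)]) (simp add: E_def)
  then show False using no C V(1) WA by blast
qed

end

section \<open>Cycles as subgraphs\<close>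

lemma edge_complete_graph_iff: "{x, y} \<in> edges (complete_graph N) \<longleftrightarrow> x < N \<and> y < N \<and> x \<noteq> y"
  by (auto simp: complete_graph_def)

lemma has_mono_copy_cycleI:
  assumes C: "is_cycle (\<lambda>x y. c {x, y} = i) C" "set C \<subseteq> {..<N}" "length C = m" and m: "2 \<le> m"
  shows "has_mono_copy (complete_graph N) c (cycle_graph m)"
proof -
  have dist: "distinct C" using C(1) by (simp add: is_cycle_def)
  let ?E = "(\<lambda>j. {C ! j, C ! (Suc j mod m)}) ` {..<m}"
  have next_lt: "Suc j mod m < m" "Suc j mod m \<noteq> j" if "j < m" for j
    using that m by (auto simp: mod_Suc)
  have V: "C ! j < N" "C ! j \<in> set C" if "j < m" for j using nth_mem[of j C] that C(2,3) by blast+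
  have "subgraph (set C, ?E) (complete_graph N)"
  proof -
    have "{C ! j, C ! (Suc j mod m)} \<in> edges (complete_graph N)" if "j < m" for j
      using V next_lt[OF that] that nth_eq_iff_index_eq[OF dist] C(3) by (simp add: edge_complete_graph_iff)
    moreover have "verts (complete_graph N) = {..<N}" by (simp add: complete_graph_def)
    ultimately show ?thesis using C(2) V next_lt by (auto simp: subgraph_def)
  qed
  moreover have "graph_iso (cycle_graph m) (set C, ?E)"
    unfolding graph_iso_def cycle_graph_def
    using bij_betw_nth[OF dist, of "{..<m}" "set C"] C(3) by (intro exI[of _ "(!) C"]) (simp add: image_image)
  moreover have "c e = i" if e: "e \<in> ?E" for e
  proof -
    obtain j where j: "j < m" "e = {C ! j, C ! (Suc j mod m)}" using e by auto
    then show ?thesis using nxt_edge(1)[OF C(1) V(2)[OF j(1)]] nxt_nth[OF dist, of j] C(3) by simp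
  qed
  ultimately show ?thesis unfolding has_mono_copy_def by (intro exI[of _ "(set C, ?E)"]) auto
qed

lemma has_mono_copy_cycleE:
  assumes "has_mono_copy (complete_graph N) c (cycle_graph m)"
  obtains f i where "inj_on f {..<m}" "f ` {..<m} \<subseteq> {..<N}" "\<And>j. j < m \<Longrightarrow> c {f j, f (Suc j mod m)} = i"
proof -
  obtain H i where H: "subgraph H (complete_graph N)" "graph_iso (cycle_graph m) H" "\<forall>e\<in>edges H. c e = i"
    using assms by (auto simp: has_mono_copy_def)
  obtain f where f: "bij_betw f {..<m} (verts H)" "edges H = (\<lambda>e. f ` e) ` edges (cycle_graph m)"
    using H(2) by (auto simp: graph_iso_def cycle_graph_def)
  have "f ` {..<m} \<subseteq> {..<N}"
    using f(1) H(1) by (auto simp: bij_betw_def subgraph_def complete_graph_def)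
  moreover have "c {f j, f (Suc j mod m)} = i" if "j < m" for j
  proof -
    have "f ` {j, Suc j mod m} \<in> edges H" unfolding f(2) using that by (intro imageI) (simp add: cycle_graph_def)
    then show ?thesis using H(3) by simp
  qed
  ultimately show ?thesis using that[of f i] f(1) by (auto simp: bij_betw_def)
qed

section \<open>The lower bound\<close>

text \<open>Every second edge of the cycle gives n disjoint edges, and \<open>g\<close> selects a
  covered end of each.\<close>

lemma card_cycle_cover:
  assumes f: "inj_on f {..<2 * n}" and T: "finite T"
    and cover: "\<And>j. j < 2 * n \<Longrightarrow> f j \<in> T \<or> f (Suc j mod (2 * n)) \<in> T"
  shows "n \<le> card T"
proof -
  define g where "g t = (if f (2 * t) \<in> T then 2 * t else Suc (2 * t))" for t
  have g: "g t < 2 * n" "f (g t) \<in> T" if "t < n" for t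
    using that cover[of "2 * t"] by (auto simp: g_def)
  have "inj_on g {..<n}"
  proof (rule inj_onI)
    fix s t assume "g s = g t"
    then have "g s div 2 = g t div 2" by simp
    then show "s = t" by (simp add: g_def split: if_splits)
  qed
  then have "inj_on (f \<circ> g) {..<n}"
    using g(1) by (intro comp_inj_on inj_on_subset[OF f]) auto
  then have "card {..<n} \<le> card T"
    by (rule card_inj_on_le) (use g(2) T in auto)
  then show ?thesis by simp
qed

text \<open>An edge is colored by its larger endpoint, in blocks of \<open>n - 1\<close> vertices, except within the first \<open>s\<close>
  vertices.\<close>

lemma exists_gallai_coloring_no_even_cycle:
  assumes n: "2 \<le> n" and q: "q \<le> 3" "q \<le> k + 1" and c0: "\<And>e. c0 e \<in> {1..<q}"
    and N: "N \<le> s + (n - 1) * (k + 1 - q)"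
    and no: "\<And>f i. inj_on f {..<2 * n} \<Longrightarrow> f ` {..<2 * n} \<subseteq> {..<s} \<Longrightarrow>
      \<not> (\<forall>j<2 * n. c0 {f j, f (Suc j mod (2 * n))} = i)"
  shows "\<exists>c. gallai_coloring k (complete_graph N) c \<and> \<not> has_mono_copy (complete_graph N) c (cycle_graph (2 * n))"
proof -
  define col where "col v = q + (v - s) div (n - 1)" for v
  define c where "c e = (if Max e < s then c0 e else col (Max e))" for e
  have cxy: "c {x, y} = (if max x y < s then c0 {x, y} else col (max x y))" for x y
    by (simp add: c_def)
  have col_le: "col v \<le> k" if "s \<le> v" "v < N" for v
  proof -
    have "v - s < (k + 1 - q) * (n - 1)" using that N by (simp add: mult.commute)
    then have "(v - s) div (n - 1) < k + 1 - q" by (rule less_mult_imp_div_less)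
    then show ?thesis using q by (simp add: col_def)
  qed
  have q1: "1 < q" using c0[of "{}"] by simp
  have "c e \<in> {1..k}" if "e \<in> edges (complete_graph N)" for e
  proof -
    have "e \<in> nsets {..<N} 2" using that by (simp add: complete_graph_def)
    then obtain x y where e: "e = {x, y}" "x < N" "y < N" by (auto elim: nsets2_E)
    have "1 \<le> col (max x y)" using q1 by (simp add: col_def)
    then show ?thesis using c0[of e] q col_le[of "max x y"] e by (auto simp: cxy)
  qed
  moreover have "\<not> rainbow_triangle (complete_graph N) c"
  proof
    assume "rainbow_triangle (complete_graph N) c"
    then obtain x y z where xyz: "c {x, y} \<noteq> c {y, z}" "c {y, z} \<noteq> c {x, z}" "c {x, y} \<noteq> c {x, z}"
      by (auto simp: rainbow_triangle_def)
    have eq: "c {u, w} = c {v, w}" if "u \<le> w" "v \<le> w" "s \<le> w" for u v w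
      using that by (simp add: cxy max_absorb2)
    consider "x < s" "y < s" "z < s" | "x \<le> z" "y \<le> z" "s \<le> z" | "x \<le> y" "z \<le> y" "s \<le> y"
      | "y \<le> x" "z \<le> x" "s \<le> x" by linarith
    then show False
    proof cases
      case 1
      \<comment> \<open>At most two colors occur within the first \<open>s\<close> vertices, by
        \<open>q \<le> 3\<close>; triangles with a later vertex have two edges colored by their
        largest vertex.\<close>
      have c01: "1 \<le> c0 e" "c0 e \<le> 2" for e using c0[of e] q(1) by auto
      have "c0 {x, y} = c0 {y, z} \<or> c0 {y, z} = c0 {x, z} \<or> c0 {x, y} = c0 {x, z}"
        using c01[of "{x, y}"] c01[of "{y, z}"] c01[of "{x, z}"] by linarith
      then show False using xyz 1 by (simp add: cxy)
    next
      case 2 then show False using xyz eq[of x z y] by simp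
    next
      case 3 then show False using xyz eq[of x y z] by (simp add: insert_commute)
    next
      case 4 then show False using xyz eq[of y x z] by (simp add: insert_commute)
    qed
  qed
  moreover have "\<not> has_mono_copy (complete_graph N) c (cycle_graph (2 * n))"
  proof
    assume "has_mono_copy (complete_graph N) c (cycle_graph (2 * n))"
    then obtain f i where f: "inj_on f {..<2 * n}" "f ` {..<2 * n} \<subseteq> {..<N}"
      and ci: "\<And>j. j < 2 * n \<Longrightarrow> c {f j, f (Suc j mod (2 * n))} = i"
      by (rule has_mono_copy_cycleE) blast
    have col_ge: "q \<le> col v" for v by (simp add: col_def)
    show False
    proof (cases "i < q")
      case True
      have lt: "max (f j) (f (Suc j mod (2 * n))) < s" if "j < 2 * n" for j
        using ci[OF that] col_ge[of "max (f j) (f (Suc j mod (2 * n)))"] True by (simp add: cxy split: if_splits)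
      then have "f ` {..<2 * n} \<subseteq> {..<s}" by auto
      moreover have "\<forall>j<2 * n. c0 {f j, f (Suc j mod (2 * n))} = i" using ci lt by (simp add: cxy)
      ultimately show False using no[OF f(1)] by blast
    next
      case False
      \<comment> \<open>The block of color \<open>i\<close>: it contains the larger end of every
        edge of this color, and n - 1 vertices cannot cover the cycle.\<close>
      define T where "T = {s + (i - q) * (n - 1)..<s + (i - q) * (n - 1) + (n - 1)}"
      have colT: "v \<in> T" if "s \<le> v" "col v = i" for v
      proof -
        have "(v - s) div (n - 1) = i - q" using that(2) by (auto simp: col_def)
        then have "v - s = (i - q) * (n - 1) + (v - s) mod (n - 1)" by (metis div_mult_mod_eq)
        moreover have "(v - s) mod (n - 1) < n - 1" using n by simp
        ultimately show ?thesis unfolding T_def atLeastLessThan_iff using that(1) by linarith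
      qed
      have "n \<le> card T"
      proof (rule card_cycle_cover[OF f(1)])
        fix j assume j: "j < 2 * n"
        let ?m = "max (f j) (f (Suc j mod (2 * n)))"
        have "c0 {f j, f (Suc j mod (2 * n))} < q" using c0[of "{f j, f (Suc j mod (2 * n))}"] by simp
        then have "\<not> ?m < s" "col ?m = i" using ci[OF j] False unfolding cxy by (auto split: if_splits)
        then have "?m \<in> T" using colT[of ?m] by (simp only: not_less)
        then show "f j \<in> T \<or> f (Suc j mod (2 * n)) \<in> T" unfolding max_def by (simp split: if_splits)
      qed (simp add: T_def)
      then show False using n by (simp add: T_def)
    qed
  qed
  ultimately show ?thesis unfolding gallai_coloring_def by blast
qed

text \<open>The decomposition of the complete graph on five vertices into two 5-cycles.\<close>

definition pentagon :: "nat \<Rightarrow> nat \<Rightarrow> nat" where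
  "pentagon x y = (if (x + 1) mod 5 = y \<or> (y + 1) mod 5 = x then 1 else 2)"

lemma pentagon_no_mono_C4:
  assumes "{w, x, y, z} \<subseteq> {..<5}" "distinct [w, x, y, z]"
  shows "\<not> (pentagon w x = i \<and> pentagon x y = i \<and> pentagon y z = i \<and> pentagon z w = i)"
proof -
  have "\<forall>w\<in>set [0..<5]. \<forall>x\<in>set [0..<5]. \<forall>y\<in>set [0..<5]. \<forall>z\<in>set [0..<5]. distinct [w, x, y, z] \<longrightarrow>
     \<not> (pentagon w x = pentagon x y \<and> pentagon x y = pentagon y z \<and> pentagon y z = pentagon z w)"
    by code_simp
  moreover have "w \<in> set [0..<5]" "x \<in> set [0..<5]" "y \<in> set [0..<5]" "z \<in> set [0..<5]" using assms(1) by auto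
  ultimately have "\<not> (pentagon w x = pentagon x y \<and> pentagon x y = pentagon y z \<and> pentagon y z = pentagon z w)"
    using assms(2) by blast
  then show ?thesis by metis
qed

text \<open>For n >= 3 the start is one color on 2n - 1 vertices, too few for the cycle, and k - 1
  blocks follow. For n = 2 this would reach four vertices with two colors, where the pentagon
  coloring has five; hence the additional 1 in that case.\<close>

lemma gallai_ramsey_lower:
  assumes k: "2 \<le> k" and n: "2 \<le> n" and N: "N < (if 3 \<le> n then (n - 1) * k + n + 1 else (n - 1) * k + n + 2)"
  shows "\<exists>c. gallai_coloring k (complete_graph N) c \<and> \<not> has_mono_copy (complete_graph N) c (cycle_graph (2 * n))"
proof (cases "3 \<le> n")
  case True
  show ?thesis
  proof (rule exists_gallai_coloring_no_even_cycle[OF n, where q = 2 and s = "2 * n - 1" and ?c0.0 = "\<lambda>_. 1"])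
    obtain l where "k = Suc l" using k by (cases k) auto
    moreover obtain m where "n = Suc m" using n by (cases n) auto
    ultimately show "N \<le> 2 * n - 1 + (n - 1) * (k + 1 - 2)" using N True by simp
    fix f :: "nat \<Rightarrow> nat" and i assume f: "inj_on f {..<2 * n}" "f ` {..<2 * n} \<subseteq> {..<2 * n - 1}"
    show "\<not> (\<forall>j<2 * n. 1 = i)" using card_inj_on_le[OF f] n by simp
  qed (use k in auto)
next
  case False
  then have n2: "n = 2" using n by simp
  show ?thesis
  proof (rule exists_gallai_coloring_no_even_cycle[OF n, where q = 3 and s = 5 and ?c0.0 = "\<lambda>e. pentagon (Min e) (Max e)"])
    show "N \<le> 5 + (n - 1) * (k + 1 - 3)" using N k n2 by simp
    fix f :: "nat \<Rightarrow> nat" and i assume f: "inj_on f {..<2 * n}" "f ` {..<2 * n} \<subseteq> {..<5}"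
    show "\<not> (\<forall>j<2 * n. pentagon (Min {f j, f (Suc j mod (2 * n))}) (Max {f j, f (Suc j mod (2 * n))}) = i)"
    proof
      assume *: "\<forall>j<2 * n. pentagon (Min {f j, f (Suc j mod (2 * n))}) (Max {f j, f (Suc j mod (2 * n))}) = i"
      have sym: "pentagon (min x y) (max x y) = pentagon x y" for x y
        by (auto simp: pentagon_def min_def max_def)
      have P: "pentagon (f j) (f (Suc j mod 4)) = i" if "j < 4" for j using * that n2 by (simp add: sym)
      have "pentagon (f 0) (f 1) = i" using P[of 0] by simp
      moreover have "pentagon (f 1) (f 2) = i" using P[of 1] by (simp add: numeral_2_eq_2)
      moreover have "pentagon (f 2) (f 3) = i" "pentagon (f 3) (f 0) = i" using P[of 2] P[of 3] by simp_all
      moreover have "inj_on f {..<4}" using f(1) n2 by simp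
      then have "distinct [f 0, f 1, f 2, f 3]" by (simp add: inj_on_eq_iff)
      moreover have "{f 0, f 1, f 2, f 3} \<subseteq> {..<5}" using f(2) n2 by (simp add: image_subset_iff)
      ultimately show False using pentagon_no_mono_C4 by blast
    qed
  qed (use k in \<open>auto simp: pentagon_def\<close>)
qed

lemma gallai_ramsey_upper:
  assumes k: "2 \<le> k" and n: "2 \<le> n" and N: "N = (if 3 \<le> n then (n - 1) * k + n + 1 else (n - 1) * k + n + 2)"
    and c: "gallai_coloring k (complete_graph N) c"
  shows "has_mono_copy (complete_graph N) c (cycle_graph (2 * n))"
proof -
  interpret gallai "{..<N}" "\<lambda>x y. c {x, y}"
  proof
    show "c {x, y} = c {y, z} \<or> c {y, z} = c {x, z} \<or> c {x, y} = c {x, z}"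
      if "x \<in> {..<N}" "y \<in> {..<N}" "z \<in> {..<N}" "x \<noteq> y" "y \<noteq> z" "x \<noteq> z" for x y z
      using c that unfolding gallai_coloring_def rainbow_triangle_def edge_complete_graph_iff by blast
  qed (simp_all add: insert_commute)
  have "\<exists>i C. set C \<subseteq> {..<N} \<and> length C = 2 * n \<and> is_cycle (\<lambda>x y. c {x, y} = i) C"
  proof (rule exists_mono_even_cycle[OF n, of "{1..k}"])
    show "c {x, y} \<in> {1..k}" if "x \<in> {..<N}" "y \<in> {..<N}" "x \<noteq> y" for x y
    proof -
      have "{x, y} \<in> edges (complete_graph N)" using that by (simp add: edge_complete_graph_iff)
      then show ?thesis using c unfolding gallai_coloring_def by blast
    qed
    obtain l m where "k = 2 + l" "n = 2 + m" using k n by (metis le_Suc_ex)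
    then show "(card {1..k} - 2) * (n - 1) + (if n = 2 then 6 else 3 * n - 1) \<le> card {..<N}"
      by (simp add: N algebra_simps)
  qed (use k in auto)
  then show ?thesis using has_mono_copy_cycleI[of c _ _ N "2 * n"] n by auto
qed

theorem theorem1p8:
  fixes k n :: nat
  assumes "k \<ge> 2" and "n \<ge> 2"
  shows "gallai_ramsey k (cycle_graph (2 * n)) =
    (if n \<ge> 3 then (n - 1) * k + n + 1 else (n - 1) * k + n + 2)"
  unfolding gallai_ramsey_def
proof (rule Least_equality)
  let ?N = "if n \<ge> 3 then (n - 1) * k + n + 1 else (n - 1) * k + n + 2"
  show "?N > 0 \<and> (\<forall>c. gallai_coloring k (complete_graph ?N) c \<longrightarrow>
      has_mono_copy (complete_graph ?N) c (cycle_graph (2 * n)))"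
    using gallai_ramsey_upper[OF assms refl] by auto
  show "?N \<le> N" if "N > 0 \<and> (\<forall>c. gallai_coloring k (complete_graph N) c \<longrightarrow>
      has_mono_copy (complete_graph N) c (cycle_graph (2 * n)))" for N
    using gallai_ramsey_lower[OF assms, of N] that by (meson not_le)
qed

end
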